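(* Consider the sequence of linear models $\mathbf y=\mathbf X\boldsymbol\beta+\boldsymbol\epsilon$ described in the context (right-rotationally invariant designs $\mathbf X\in\mathbb R^{n\times p}$, $n\to\infty$, $p(n)/n\to\gamma\in(0,\infty)$, $\|\boldsymbol\beta\|=r\sqrt n$, noise variance $\sigma^2$). Fix $\lambda>0$, let $\hat{\boldsymbol\beta}_\lambda=(\mathbf X^\top\mathbf X+\lambda\mathbf I)^{-1}\mathbf X^\top\mathbf y$, let $\mathbf S_\lambda=\mathbf X(\mathbf X^\top\mathbf X+\lambda\mathbf I)^{-1}\mathbf X^\top$, and let $$\mathsf{GCV}_n(\lambda)=\frac1n\sum_{i=1}^n\left(\frac{y_i-\mathbf x_i^\top\hat{\boldsymbol\beta}_\lambda}{1-\mathrm{Tr}(\mathbf S_\lambda)/n}\right)^2,$$ where $\mathbf x_i^\top$ is the $i$-th row of $\mathbf X$. Then, as $n\to\infty$, $$\mathsf{GCV}_n(\lambda)-\frac{r^2\left(v_{\mathbf D}(-\lambda)-\lambda v'_{\mathbf D}(-\lambda)\right)+\sigma^2\gamma\, v'_{\mathbf D}(-\lambda)}{\gamma\, v_{\mathbf D}(-\lambda)^2}\xrightarrow{a.s.}0 .$$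
   Context: Right-rotationally invariant design: a random matrix $\mathbf X\in\mathbb R^{n\times p}$ with $\mathbf X\mathbf O_0\stackrel d=\mathbf X$ for every $p\times p$ orthogonal matrix $\mathbf O_0$; equivalently, it has a singular value decomposition $\mathbf X=\mathbf Q^\top\mathbf D\mathbf O$ ($\mathbf Q$ an $n\times n$ orthogonal matrix, $\mathbf D\in\mathbb R^{n\times p}$ diagonal with the singular values on the diagonal, $\mathbf O$ a $p\times p$ orthogonal matrix) with $\mathbf O$ Haar distributed on the orthogonal group and independent of $(\mathbf Q,\mathbf D)$. Setting (all objects are indexed by $n$; the index is suppressed): - $\mathbf X=\mathbf Q^\top\mathbf D\mathbf O\in\mathbb R^{n\times p}$ is right-rotationally invariant, $p=p(n)$, $n\to\infty$, $p(n)/n\to\gamma\in(0,\infty)$. - There is a constant $C$ such that almost surely the limsup as $n\to\infty$ of the largest diagonal entry (largest singular value) of $\mathbf D$ is $<C$. - $\mathbf y=\mathbf X\boldsymbol\beta+\boldsymbol\epsilon$, with $\boldsymbol\beta\in\mathbb R^p$, $\|\boldsymbol\beta\|=r\sqrt n$ for a constant $r\ge 0$, and $\boldsymbol\beta$ either fixed or random and independent of $(\mathbf X,\boldsymbol\epsilon)$. - $\boldsymbol\epsilon\in\mathbb R^n$ is independent of $\mathbf X$ and has independent entries with $\mathbb E[\epsilon_i]=0$, $\mathbb E[\epsilon_i^2]=\sigma^2$, and $\mathbb E[|\epsilon_i|^{4+\eta}]<\infty$ for some $\eta>0$. Notation: with $D_{ii}:=0$ for $i>\min(n,p)$, $v_{\mathbf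 D}(z)=\frac1n\sum_{i=1}^n\frac{1}{D_{ii}^2-z}$, and $v'_{\mathbf D}$ is its derivative in $z$, so $v'_{\mathbf D}(-\lambda)=\frac1n\sum_{i=1}^n\frac1{(D_{ii}^2+\lambda)^2}$.
   Formalization: The moment condition E|ε_i|^{4+η}<∞ is taken uniformly: one η>0 and one constant bound the moments of all entries for all n; with merely finite moments the claim fails (X=0, ε_i=±σn² with probability n^{-4}, else 0). *)

theory Defs
  imports "HOL-Probability.Probability" "Jordan_Normal_Form.Gauss_Jordan_Elimination"
begin

(* Vectors and matrices are those of Jordan_Normal_Form, since the dimensions n and p(n) vary;
   the "$" of HOL-Analysis is switched off to avoid ambiguous parses. *)
unbundle no vec_syntax

(* Borel sigma-algebras of R^n and R^(n x p), transported from the product sigma-algebra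
   along the coordinates. *)
definition vec_borel :: "nat \<Rightarrow> real vec measure" where
  "vec_borel n =
    vimage_algebra (carrier_vec n) (\<lambda>v. restrict (vec_index v) {..<n})
      (Pi\<^sub>M {..<n} (\<lambda>_. borel))"

definition mat_borel :: "nat \<Rightarrow> nat \<Rightarrow> real mat measure" where
  "mat_borel n p =
    vimage_algebra (carrier_mat n p) (\<lambda>A. restrict (index_mat A) ({..<n} \<times> {..<p}))
      (Pi\<^sub>M ({..<n} \<times> {..<p}) (\<lambda>_. borel))"

(* The library's indep_var requires both variables to have the same value type. *)
definition indep_rv ::
  "'w measure \<Rightarrow> 'a measure \<Rightarrow> ('w \<Rightarrow> 'a) \<Rightarrow> 'b measure \<Rightarrow> ('w \<Rightarrow> 'b) \<Rightarrow> bool" where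
  "indep_rv M S X T Y \<longleftrightarrow>
    X \<in> measurable M S \<and> Y \<in> measurable M T \<and>
    prob_space.indep_set M
      (sets (vimage_algebra (space M) X S)) (sets (vimage_algebra (space M) Y T))"

definition vec_norm2 :: "real vec \<Rightarrow> real" where
  "vec_norm2 v = sqrt (v \<bullet> v)"

(* Not Jordan_Normal_Form's orthogonal_mat, which does not normalise the columns. *)
definition orth_mat :: "nat \<Rightarrow> real mat \<Rightarrow> bool" where
  "orth_mat n U \<longleftrightarrow> U \<in> carrier_mat n n \<and> U\<^sup>T * U = 1\<^sub>m n"

definition mat_trace :: "real mat \<Rightarrow> real" where
  "mat_trace A = (\<Sum>i<dim_row A. A $$ (i, i))"

(* Meaningful for invertible matrices only (see mat_inv_eqI). *)
definition mat_inv :: "real mat \<Rightarrow> real mat" where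
  "mat_inv A = the (mat_inverse A)"

lemma mat_inv_eqI:
  assumes A: "A \<in> carrier_mat n n" and B: "B \<in> carrier_mat n n"
    and AB: "A * B = 1\<^sub>m n" and BA: "B * A = 1\<^sub>m n"
  shows "mat_inv A = B"
proof -
  have "A \<in> Units (ring_mat TYPE(real) n ())"
    using assms unfolding Units_def by (auto simp: ring_mat_simps)
  then obtain C where C: "mat_inverse A = Some C"
    using mat_inverse(1)[OF A, of "()"] by (cases "mat_inverse A") auto
  note C' = mat_inverse(2)[OF A C]
  then have "C = C * (A * B)" using AB by (metis right_mult_one_mat)
  also have "\<dots> = (C * A) * B" using C' A B by (metis assoc_mult_mat)
  also have "\<dots> = B" using C' B by simp
  finally show ?thesis by (simp add: mat_inv_def C)
qed

definition right_rot_invariant ::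
  "'w measure \<Rightarrow> nat \<Rightarrow> nat \<Rightarrow> ('w \<Rightarrow> real mat) \<Rightarrow> bool" where
  "right_rot_invariant M n p X \<longleftrightarrow>
    X \<in> measurable M (mat_borel n p) \<and>
    (\<forall>U. orth_mat p U \<longrightarrow>
      distr M (mat_borel n p) (\<lambda>\<omega>. X \<omega> * U) = distr M (mat_borel n p) X)"

(* W plays the role of the right orthogonal factor O ("O" is reserved for relation
   composition). The diagonal entries need not be sorted. *)
definition is_svd ::
  "nat \<Rightarrow> nat \<Rightarrow> real mat \<Rightarrow> real mat \<Rightarrow> real mat \<Rightarrow> real mat \<Rightarrow> bool" where
  "is_svd n p X Q D W \<longleftrightarrow>
    orth_mat n Q \<and> orth_mat p W \<and>
    D \<in> carrier_mat n p \<and> diagonal_mat D \<and> (\<forall>i<min n p. D $$ (i, i) \<ge> 0) \<and>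
    X = Q\<^sup>T * D * W"

definition max_sv :: "real mat \<Rightarrow> real" where
  "max_sv D = Max ((\<lambda>i. D $$ (i, i)) ` {..<min (dim_row D) (dim_col D)})"

definition diag_entry :: "real mat \<Rightarrow> nat \<Rightarrow> real" where
  "diag_entry D i = (if i < min (dim_row D) (dim_col D) then D $$ (i, i) else 0)"

definition v_D :: "real mat \<Rightarrow> real \<Rightarrow> real" where
  "v_D D z = (1 / real (dim_row D)) * (\<Sum>i<dim_row D. 1 / ((diag_entry D i)\<^sup>2 - z))"

definition ridge_inv :: "real \<Rightarrow> real mat \<Rightarrow> real mat" where
  "ridge_inv lam X = mat_inv (X\<^sup>T * X + lam \<cdot>\<^sub>m 1\<^sub>m (dim_col X))"

definition ridge_est :: "real \<Rightarrow> real mat \<Rightarrow> real vec \<Rightarrow> real vec" where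
  "ridge_est lam X y = (ridge_inv lam X * X\<^sup>T) *\<^sub>v y"

definition ridge_smoother :: "real \<Rightarrow> real mat \<Rightarrow> real mat" where
  "ridge_smoother lam X = X * ridge_inv lam X * X\<^sup>T"

definition GCV :: "real \<Rightarrow> real mat \<Rightarrow> real vec \<Rightarrow> real" where
  "GCV lam X y =
    (1 / real (dim_row X)) *
    (\<Sum>i<dim_row X.
      ((y $ i - row X i \<bullet> ridge_est lam X y)
        / (1 - mat_trace (ridge_smoother lam X) / real (dim_row X)))\<^sup>2)"

end

theory Submission
  imports Defs "Jordan_Normal_Form.Determinant"
begin

text \<open>
Let \<open>R = \<lambda> (X X\<^sup>T + \<lambda>)\<^sup>-\<^sup>1\<close> be the identity minus the ridge smoother. The vector of residuals is \<open>R y\<close>, and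
in terms of the singular values \<open>tr R = \<lambda> n v\<close> and \<open>tr R\<^sup>2 = \<lambda>\<^sup>2 n v'\<close>, with \<open>v\<close> and \<open>v'\<close> evaluated at
\<open>-\<lambda>\<close>. Hence GCV is \<open>|R y|\<^sup>2 / n\<close> divided by \<open>(\<lambda> v)\<^sup>2\<close>. Expanding \<open>y = X \<beta> + \<epsilon>\<close> leaves three terms to
be identified:

  \<^item> the noise energy \<open>|R \<epsilon>|\<^sup>2 / n\<close>, close to \<open>\<sigma>\<^sup>2 tr R\<^sup>2 / n = \<lambda>\<^sup>2 \<sigma>\<^sup>2 v'\<close>;
  \<^item> the cross term \<open>(R \<epsilon>) \<bullet> (R X \<beta>) / n\<close>, close to zero;
  \<^item> the signal energy \<open>|R X \<beta>|\<^sup>2 / n\<close>, close to \<open>r\<^sup>2 tr (X\<^sup>T R\<^sup>2 X) / p = \<lambda>\<^sup>2 r\<^sup>2 (n / p) (v - \<lambda> v')\<close>.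

Each of the three errors has tails of order \<open>n\<^sup>-\<^sup>s\<close> for some \<open>s > 1\<close>, so Borel--Cantelli gives almost sure
convergence without any relation between different \<open>n\<close>.

The tails come from conditioning on the design, and on \<open>\<beta>\<close> where it occurs. For a fixed symmetric matrix with rows of length at
most one, a centred quadratic form in independent variables is a martingale when the variables are
revealed one at a time, and \<open>E (1 + T\<^sup>2)\<^sup>s\<close> grows only like \<open>n\<^sup>s\<close>; this costs exactly the moments of
order \<open>4 s\<close> of the noise, which is where \<open>4 + \<eta>\<close> enters (\<open>quadratic_form_tail\<close>). A fourth moment
suffices for the cross term (\<open>linear_form_tail\<close>).

For the signal, rotational invariance makes the law of \<open>|R X b|\<close> depend on \<open>b\<close> only through its norm.
So \<open>b\<close> may be replaced by a multiple of a vector of signs, and then by the average over all vectors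
of signs; exchanging the two averages turns the signal energy into a quadratic form in independent
signs for a fixed design, to which the same bound applies (\<open>right_rot_signal_tail\<close>). Haar measure
on the orthogonal group is thereby avoided.

The bounds on the matrices needed for this hold for every design (\<open>resid_mat_energy\<close>,
\<open>resid_mat_design_energy\<close>). The bound on the largest singular value is used once, to keep \<open>v\<close> away
from zero.
\<close>

unbundle no inner_syntax

section \<open>Moments of linear and quadratic forms in independent variables\<close>

text \<open>A second order Taylor expansion of \<open>(1 + t\<^sup>2)\<^sup>s\<close>, which behaves like \<open>|t|\<^sup>2\<^sup>s\<close> but is smooth at the origin.
The remainder \<open>(1 + t\<^sup>2 + d\<^sup>2)\<^sup>s\<^sup>-\<^sup>1 d\<^sup>2\<close> mixes both variables; comparing \<open>d\<^sup>2\<close> with \<open>\<theta> (1 + t\<^sup>2)\<close> separates them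
at the price of the weights \<open>\<theta>\<close> and \<open>\<theta>\<^sup>1\<^sup>-\<^sup>s\<close>.\<close>

lemma one_plus_sq_powr_step:
  fixes s t d \<theta> :: real
  assumes s: "1 \<le> s" "s \<le> 2" and th: "0 < \<theta>" "\<theta> \<le> 1"
  shows "(1 + (t + d)\<^sup>2) powr s \<le> (1 + 24 * \<theta>) * (1 + t\<^sup>2) powr s
    + 2 * s * (t * (1 + t\<^sup>2) powr (s - 1)) * d + 24 * \<theta> powr (1 - s) * (d\<^sup>2) powr s"
proof (cases "d = 0")
  case True
  then show ?thesis using th by (simp add: algebra_simps)
next
  case d: False
  define df where "df m x = (if m = 0 then (1 + x\<^sup>2) powr s
      else if m = 1 then 2 * s * (x * (1 + x\<^sup>2) powr (s - 1))
      else 2 * s * (1 + x\<^sup>2) powr (s - 1) + 4 * s * (s - 1) * x\<^sup>2 * (1 + x\<^sup>2) powr (s - 2))"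
    for m :: nat and x :: real
  have pos: "0 < 1 + x\<^sup>2" for x :: real by (simp add: add_pos_nonneg)
  have "DERIV (df m) x :> df (Suc m) x" if "m < 2" for m x
  proof -
    from that consider "m = 0" | "m = 1" by linarith
    then show ?thesis
    proof cases
      case 1
      have "((\<lambda>x. (1 + x\<^sup>2) powr s) has_real_derivative
          s * (1 + x\<^sup>2) powr (s - 1) * (2 * x)) (at x)"
        using pos[of x] by (auto intro!: derivative_eq_intros)
      then show ?thesis unfolding 1 df_def by (simp add: algebra_simps)
    next
      case 2
      have "((\<lambda>x. 2 * s * (x * (1 + x\<^sup>2) powr (s - 1))) has_real_derivative
          2 * s * ((1 + x\<^sup>2) powr (s - 1) + x * ((s - 1) * (1 + x\<^sup>2) powr (s - 2) * (2 * x)))) (at x)"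
        using pos[of x] by (auto intro!: derivative_eq_intros simp: algebra_simps)
      then show ?thesis unfolding 2 df_def by (simp add: algebra_simps power2_eq_square)
    qed
  qed
  then have "\<forall>m x. m < 2 \<and> min t (t + d) \<le> x \<and> x \<le> max t (t + d) \<longrightarrow>
      DERIV (df m) x :> df (Suc m) x" by blast
  from Taylor[of 2 df "df 0" "min t (t + d)" "max t (t + d)" t "t + d", OF _ _ this]
  obtain \<xi> where xi: "if t + d < t then t + d < \<xi> \<and> \<xi> < t else t < \<xi> \<and> \<xi> < t + d"
    and eq: "df 0 (t + d) = (\<Sum>m<2. df m t / fact m * d ^ m) + df 2 \<xi> / fact 2 * d\<^sup>2"
    using d by auto
  have x1: "\<bar>\<xi>\<bar> \<le> \<bar>t\<bar> + \<bar>d\<bar>" using xi by (auto split: if_splits)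
  have "\<xi>\<^sup>2 \<le> (\<bar>t\<bar> + \<bar>d\<bar>)\<^sup>2" using power_mono[OF x1, of 2] by simp
  also have "\<dots> \<le> 2 * t\<^sup>2 + 2 * d\<^sup>2"
    using zero_le_power2[of "\<bar>t\<bar> - \<bar>d\<bar>"] by (simp add: power2_eq_square algebra_simps)
  finally have x2: "\<xi>\<^sup>2 \<le> 2 * t\<^sup>2 + 2 * d\<^sup>2" .
  define u where "u = 1 + t\<^sup>2"
  have u: "u \<ge> 1" by (simp add: u_def)
  define P where "P = (1 + \<xi>\<^sup>2) powr (s - 1)"
  have P0: "P \<ge> 0" by (simp add: P_def)
  have "\<xi>\<^sup>2 * (1 + \<xi>\<^sup>2) powr (s - 2) \<le> (1 + \<xi>\<^sup>2) * (1 + \<xi>\<^sup>2) powr (s - 2)"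
    by (intro mult_right_mono) auto
  also have "\<dots> = P"
    using pos[of \<xi>] powr_mult_base[of "1 + \<xi>\<^sup>2" "s - 2"] by (simp add: P_def algebra_simps)
  finally have a: "\<xi>\<^sup>2 * (1 + \<xi>\<^sup>2) powr (s - 2) \<le> P" .
  have "df 2 \<xi> \<le> 2 * s * P + 4 * s * (s - 1) * P"
    using mult_left_mono[OF a, of "4 * s * (s - 1)"] s by (simp add: df_def P_def mult.assoc)
  also have "\<dots> = (2 * s * (2 * s - 1)) * P" by (simp add: algebra_simps)
  also have "\<dots> \<le> 12 * P"
  proof (intro mult_right_mono P0)
    have "2 * s * (2 * s - 1) \<le> 4 * 3" using s by (intro mult_mono) auto
    then show "2 * s * (2 * s - 1) \<le> 12" by simp
  qed
  finally have df2: "df 2 \<xi> \<le> 12 * P" .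
  have "P \<le> (2 * (u + d\<^sup>2)) powr (s - 1)"
    unfolding P_def using x2 s pos[of \<xi>] by (intro powr_mono2) (auto simp: u_def)
  also have "\<dots> = 2 powr (s - 1) * (u + d\<^sup>2) powr (s - 1)"
    by (rule powr_mult)
  also have "\<dots> \<le> 2 * (u + d\<^sup>2) powr (s - 1)"
    using powr_mono[of "s - 1" 1 "2::real"] s by (intro mult_right_mono) auto
  finally have P1: "P \<le> 2 * (u + d\<^sup>2) powr (s - 1)" .
  have key: "(u + d\<^sup>2) powr (s - 1) * d\<^sup>2 \<le> 2 * \<theta> * u powr s + 2 * \<theta> powr (1 - s) * (d\<^sup>2) powr s"
  proof (cases "d\<^sup>2 \<le> \<theta> * u")
    case True
    also have "\<theta> * u \<le> u" using th u by simp
    finally have du: "d\<^sup>2 \<le> u" .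
    have "(u + d\<^sup>2) powr (s - 1) \<le> (2 * u) powr (s - 1)" using du u s by (intro powr_mono2) auto
    also have "\<dots> \<le> 2 * u powr (s - 1)"
      using u powr_mono[of "s - 1" 1 "2::real"] s by (simp add: powr_mult mult_right_mono)
    finally have "(u + d\<^sup>2) powr (s - 1) * d\<^sup>2 \<le> (2 * u powr (s - 1)) * (\<theta> * u)"
      using True u by (intro mult_mono) auto
    also have "\<dots> = 2 * \<theta> * u powr s"
      using u powr_mult_base[of u "s - 1"] by (simp add: algebra_simps)
    finally show ?thesis by (simp add: add_increasing2)
  next
    case False
    have "u \<le> d\<^sup>2 / \<theta>" using False th by (simp add: field_simps)
    moreover have "d\<^sup>2 \<le> d\<^sup>2 / \<theta>" using th by (simp add: field_simps mult_left_le_one_le)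
    ultimately have "u + d\<^sup>2 \<le> 2 * (d\<^sup>2 / \<theta>)" by simp
    then have "(u + d\<^sup>2) powr (s - 1) \<le> (2 * (d\<^sup>2 / \<theta>)) powr (s - 1)"
      using u s by (intro powr_mono2) auto
    also have "\<dots> = 2 powr (s - 1) * ((d\<^sup>2) powr (s - 1) * \<theta> powr (1 - s))"
      using th by (simp add: powr_mult powr_divide powr_minus_divide[of \<theta> "s - 1", simplified])
    also have "\<dots> \<le> 2 * ((d\<^sup>2) powr (s - 1) * \<theta> powr (1 - s))"
      using powr_mono[of "s - 1" 1 "2::real"] s by (intro mult_right_mono) auto
    finally have "(u + d\<^sup>2) powr (s - 1) * d\<^sup>2 \<le> 2 * ((d\<^sup>2) powr (s - 1) * \<theta> powr (1 - s)) * d\<^sup>2"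
      by (intro mult_right_mono) auto
    also have "\<dots> = 2 * \<theta> powr (1 - s) * (d\<^sup>2) powr s"
      using d powr_mult_base[of "d\<^sup>2" "s - 1"] by (simp add: algebra_simps)
    finally show ?thesis using th u by (simp add: add_increasing)
  qed
  have "df 2 \<xi> / 2 * d\<^sup>2 \<le> 6 * P * d\<^sup>2" using df2 by (intro mult_right_mono) auto
  also have "\<dots> \<le> 12 * ((u + d\<^sup>2) powr (s - 1) * d\<^sup>2)"
    using mult_right_mono[OF P1 zero_le_power2[of d]] by linarith
  also have "\<dots> \<le> 24 * \<theta> * u powr s + 24 * \<theta> powr (1 - s) * (d\<^sup>2) powr s"
    using key by simp
  finally have "df 2 \<xi> / 2 * d\<^sup>2 \<le> 24 * \<theta> * u powr s + 24 * \<theta> powr (1 - s) * (d\<^sup>2) powr s" .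
  moreover have "df 0 (t + d) = df 0 t + df 1 t * d + df 2 \<xi> / 2 * d\<^sup>2"
    unfolding eq by (simp add: lessThan_Suc numeral_2_eq_2)
  ultimately show ?thesis by (simp add: df_def u_def algebra_simps)
qed

text \<open>In expectation the first order term of the previous expansion vanishes for a martingale. With
\<open>\<theta> = 1 / n\<close> the factor in front of the old moment compounds to at most \<open>exp 24\<close> over \<open>n\<close> steps, while
the increments contribute \<open>n\<close> times \<open>n\<^sup>s\<^sup>-\<^sup>1\<close>. The orthogonality hypothesis is conditional because the
product in it is integrable only once the moment at step \<open>k\<close> is known to be finite.\<close>

lemma (in prob_space) powr_moment_growth:
  fixes T \<Delta> :: "nat \<Rightarrow> 'a \<Rightarrow> real"
  assumes s: "1 \<le> s" "s \<le> 2" and n: "0 < n"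
    and T0: "\<And>\<omega>. T 0 \<omega> = 0" and TS: "\<And>k \<omega>. k < n \<Longrightarrow> T (Suc k) \<omega> = T k \<omega> + \<Delta> k \<omega>"
    and Tm[measurable]: "\<And>k. k \<le> n \<Longrightarrow> T k \<in> borel_measurable M"
    and B: "\<And>k. k < n \<Longrightarrow> integrable M (\<lambda>\<omega>. ((\<Delta> k \<omega>)\<^sup>2) powr s)"
      "\<And>k. k < n \<Longrightarrow> expectation (\<lambda>\<omega>. ((\<Delta> k \<omega>)\<^sup>2) powr s) \<le> B"
    and orth: "\<And>k. k < n \<Longrightarrow> integrable M (\<lambda>\<omega>. (1 + (T k \<omega>)\<^sup>2) powr s) \<Longrightarrow>
      has_bochner_integral M (\<lambda>\<omega>. T k \<omega> * (1 + (T k \<omega>)\<^sup>2) powr (s - 1) * \<Delta> k \<omega>) 0"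
  shows "integrable M (\<lambda>\<omega>. (1 + (T n \<omega>)\<^sup>2) powr s)"
    and "expectation (\<lambda>\<omega>. (1 + (T n \<omega>)\<^sup>2) powr s) \<le> exp 24 * (1 + 24 * B) * real n powr s"
proof -
  define \<theta> where "\<theta> = 1 / real n"
  have th: "0 < \<theta>" "\<theta> \<le> 1" using n by (auto simp: \<theta>_def)
  define b where "b = 24 * \<theta> powr (1 - s)"
  have b0: "b \<ge> 0" by (simp add: b_def)
  have "0 \<le> expectation (\<lambda>\<omega>. ((\<Delta> 0 \<omega>)\<^sup>2) powr s)"
    by (intro Bochner_Integration.integral_nonneg) auto
  then have B0: "B \<ge> 0" using B(2)[OF n] by linarith
  have main: "integrable M (\<lambda>\<omega>. (1 + (T k \<omega>)\<^sup>2) powr s) \<and>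
      expectation (\<lambda>\<omega>. (1 + (T k \<omega>)\<^sup>2) powr s) \<le> (1 + 24 * \<theta>) ^ k * (1 + k * (b * B))"
    if "k \<le> n" for k
    using that
  proof (induction k)
    case 0
    then show ?case by (simp add: T0 prob_space)
  next
    case (Suc k)
    then have k: "k < n" and int: "integrable M (\<lambda>\<omega>. (1 + (T k \<omega>)\<^sup>2) powr s)"
      and IH: "expectation (\<lambda>\<omega>. (1 + (T k \<omega>)\<^sup>2) powr s) \<le> (1 + 24 * \<theta>) ^ k * (1 + k * (b * B))"
      by auto
    note o = orth[OF k int]
    define U where "U \<omega> = (1 + 24 * \<theta>) * (1 + (T k \<omega>)\<^sup>2) powr s
      + 2 * s * (T k \<omega> * (1 + (T k \<omega>)\<^sup>2) powr (s - 1) * \<Delta> k \<omega>) + b * ((\<Delta> k \<omega>)\<^sup>2) powr s" for \<omega>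
    have le: "(1 + (T (Suc k) \<omega>)\<^sup>2) powr s \<le> U \<omega>" for \<omega>
      using one_plus_sq_powr_step[OF s th, of "T k \<omega>" "\<Delta> k \<omega>"]
      by (simp add: TS[OF k] U_def b_def mult.assoc)
    have Ui: "integrable M U"
      unfolding U_def using int B(1)[OF k] o
      by (intro Bochner_Integration.integrable_add integrable_mult_right)
        (auto simp: has_bochner_integral_iff)
    have i: "integrable M (\<lambda>\<omega>. (1 + (T (Suc k) \<omega>)\<^sup>2) powr s)"
      using Suc.prems le by (intro Bochner_Integration.integrable_bound[OF Ui]) (auto intro!: order_trans[OF le])
    have "expectation (\<lambda>\<omega>. (1 + (T (Suc k) \<omega>)\<^sup>2) powr s) \<le> expectation U"
      by (intro integral_mono i Ui le)
    also have "\<dots> = (1 + 24 * \<theta>) * expectation (\<lambda>\<omega>. (1 + (T k \<omega>)\<^sup>2) powr s)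
        + b * expectation (\<lambda>\<omega>. ((\<Delta> k \<omega>)\<^sup>2) powr s)"
      unfolding U_def using int B(1)[OF k] o
      by (subst Bochner_Integration.integral_add Bochner_Integration.integral_add,
          auto simp: has_bochner_integral_iff)+
    also have "\<dots> \<le> (1 + 24 * \<theta>) * ((1 + 24 * \<theta>) ^ k * (1 + k * (b * B))) + b * B"
      using IH B(2)[OF k] th b0 by (intro add_mono mult_left_mono) auto
    also have "\<dots> \<le> (1 + 24 * \<theta>) * ((1 + 24 * \<theta>) ^ k * (1 + k * (b * B)))
        + (1 + 24 * \<theta>) ^ Suc k * (b * B)"
      using th b0 B0 one_le_power[of "1 + 24 * \<theta>" "Suc k"]
        mult_right_mono[of 1 "(1 + 24 * \<theta>) ^ Suc k" "b * B"] by simp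
    also have "\<dots> = (1 + 24 * \<theta>) ^ Suc k * (1 + Suc k * (b * B))"
      by (simp add: algebra_simps)
    finally show ?case using i by blast
  qed
  show "integrable M (\<lambda>\<omega>. (1 + (T n \<omega>)\<^sup>2) powr s)" using main by blast
  have "n * (b * B) = 24 * B * (real n * real n powr (s - 1))"
    using n by (simp add: b_def \<theta>_def powr_divide powr_minus_divide[of "real n" "s - 1", simplified])
  also have "real n * real n powr (s - 1) = real n powr s"
    using n powr_mult_base[of "real n" "s - 1"] by simp
  finally have nb: "n * (b * B) = 24 * B * real n powr s" .
  have n1: "1 \<le> real n powr s" using n s by (simp add: ge_one_powr_ge_zero)
  have "expectation (\<lambda>\<omega>. (1 + (T n \<omega>)\<^sup>2) powr s) \<le> (1 + 24 * \<theta>) ^ n * (1 + n * (b * B))"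
    using main by blast
  also have "\<dots> \<le> exp 24 * ((1 + 24 * B) * real n powr s)"
  proof (intro mult_mono)
    have "(1 + 24 * \<theta>) ^ n \<le> exp (24 * \<theta>) ^ n"
      using th exp_ge_add_one_self[of "24 * \<theta>"] by (intro power_mono) auto
    also have "\<dots> = exp 24" using n by (simp add: exp_of_nat_mult[symmetric] \<theta>_def)
    finally show "(1 + 24 * \<theta>) ^ n \<le> exp 24" .
    show "1 + n * (b * B) \<le> (1 + 24 * B) * real n powr s"
      unfolding nb using n1 by (simp add: algebra_simps)
  qed (use b0 B0 in auto)
  finally show "expectation (\<lambda>\<omega>. (1 + (T n \<omega>)\<^sup>2) powr s) \<le> exp 24 * (1 + 24 * B) * real n powr s"
    by simp
qed

text \<open>Invariance under restriction to \<open>{..<k}\<close> says that \<open>F\<close> looks at the past only, while \<open>F\<close> can still be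
written as a function of the whole sequence.\<close>

lemma (in prob_space) indep_var_past_present:
  fixes \<epsilon> :: "nat \<Rightarrow> 'a \<Rightarrow> real"
  assumes ind: "indep_vars (\<lambda>_. borel) \<epsilon> {..<n}" and k: "k < n"
    and F: "F \<in> borel_measurable (Pi\<^sub>M {..<k} (\<lambda>_. borel))"
    and Ffe: "\<And>e. F (restrict e {..<k}) = F e"
    and h: "h \<in> borel_measurable borel"
  shows "indep_var borel (\<lambda>\<omega>. F (\<lambda>i. \<epsilon> i \<omega>)) borel (\<lambda>\<omega>. h (\<epsilon> k \<omega>))"
proof -
  have "indep_var (Pi\<^sub>M {..<k} (\<lambda>_. borel)) (\<lambda>\<omega>. restrict (\<lambda>i. \<epsilon> i \<omega>) {..<k})
      (Pi\<^sub>M {k} (\<lambda>_. borel)) (\<lambda>\<omega>. restrict (\<lambda>i. \<epsilon> i \<omega>) {k})"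
    using k by (intro indep_var_restrict[OF ind]) auto
  moreover have "(\<lambda>e. h (e k)) \<in> borel_measurable (Pi\<^sub>M {k} (\<lambda>_. borel))"
    using h by measurable
  ultimately have "indep_var borel (F \<circ> (\<lambda>\<omega>. restrict (\<lambda>i. \<epsilon> i \<omega>) {..<k}))
      borel ((\<lambda>e. h (e k)) \<circ> (\<lambda>\<omega>. restrict (\<lambda>i. \<epsilon> i \<omega>) {k}))"
    using F by (intro indep_var_compose[where ?M1.0 = "Pi\<^sub>M {..<k} (\<lambda>_. borel)" and ?M2.0 = "Pi\<^sub>M {k} (\<lambda>_. borel)"])
  then show ?thesis by (simp add: comp_def Ffe)
qed


text \<open>The summands are added one at a time. The two odd products in the binomial expansion of the fourth
power vanish because in each of them one factor is centred; the product of the two squares is why the second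
moment is carried along.\<close>

lemma (in prob_space) linear_form_moments:
  fixes \<epsilon> :: "nat \<Rightarrow> 'a \<Rightarrow> real"
  assumes ind: "indep_vars (\<lambda>_. borel) \<epsilon> {..<n}" and m: "1 \<le> m"
    and mean: "\<And>i. i < n \<Longrightarrow> expectation (\<epsilon> i) = 0"
    and int4: "\<And>i. i < n \<Longrightarrow> integrable M (\<lambda>\<omega>. (\<epsilon> i \<omega>) ^ 4)"
    and mom4: "\<And>i. i < n \<Longrightarrow> expectation (\<lambda>\<omega>. (\<epsilon> i \<omega>) ^ 4) \<le> m"
  shows "k \<le> n \<Longrightarrow> integrable M (\<lambda>\<omega>. (\<Sum>i<k. c i * \<epsilon> i \<omega>) ^ 4) \<and>
    expectation (\<lambda>\<omega>. (\<Sum>i<k. c i * \<epsilon> i \<omega>)\<^sup>2) \<le> m * (\<Sum>i<k. (c i)\<^sup>2) \<and>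
    expectation (\<lambda>\<omega>. (\<Sum>i<k. c i * \<epsilon> i \<omega>) ^ 4) \<le> 3 * m\<^sup>2 * (\<Sum>i<k. (c i)\<^sup>2)\<^sup>2"
proof (induction k)
  case 0
  then show ?case by simp
next
  case (Suc k)
  then have k: "k < n" by simp
  define L where "L \<omega> = (\<Sum>i<k. c i * \<epsilon> i \<omega>)" for \<omega>
  define z where "z \<omega> = c k * \<epsilon> k \<omega>" for \<omega>
  define S where "S = (\<Sum>i<k. (c i)\<^sup>2)"
  have S0: "S \<ge> 0" by (simp add: S_def sum_nonneg)
  have [measurable]: "\<epsilon> i \<in> borel_measurable M" if "i < n" for i
    using ind that by (auto simp: indep_vars_def)
  have Lm[measurable]: "L \<in> borel_measurable M" and zm[measurable]: "z \<in> borel_measurable M"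
    using k unfolding L_def z_def by auto
  have lower: "integrable M f \<and> integrable M (\<lambda>\<omega>. (f \<omega>)\<^sup>2) \<and> integrable M (\<lambda>\<omega>. (f \<omega>) ^ 3)"
    if f[measurable]: "f \<in> borel_measurable M" and f4: "integrable M (\<lambda>\<omega>. (f \<omega>) ^ 4)"
    for f :: "'a \<Rightarrow> real"
  proof -
    have i: "integrable M (\<lambda>\<omega>. 1 + (f \<omega>) ^ 4)" using f4 by simp
    have "\<bar>x\<bar> ^ j \<le> 1 + x ^ 4" if "j \<le> 4" for x :: real and j
    proof (cases "\<bar>x\<bar> \<le> 1")
      case True
      then show ?thesis using power_le_one[of "\<bar>x\<bar>" j] by (simp add: add_increasing2)
    next
      case False
      then show ?thesis using power_increasing[OF that, of "\<bar>x\<bar>"] by simp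
    qed
    from this[of 1] this[of 2] this[of 3] show ?thesis
      by (intro conjI Bochner_Integration.integrable_bound[OF i]) (auto simp: power_abs)
  qed
  have L4: "integrable M (\<lambda>\<omega>. (L \<omega>) ^ 4)" and EL2: "expectation (\<lambda>\<omega>. (L \<omega>)\<^sup>2) \<le> m * S"
    and EL4: "expectation (\<lambda>\<omega>. (L \<omega>) ^ 4) \<le> 3 * m\<^sup>2 * S\<^sup>2"
    using Suc by (auto simp: L_def S_def)
  note Li = lower[OF Lm L4]
  have z4: "integrable M (\<lambda>\<omega>. (z \<omega>) ^ 4)" using int4[OF k] by (simp add: z_def power_mult_distrib)
  note zi = lower[OF zm z4]
  have Ez: "expectation z = 0" using mean[OF k] by (simp add: z_def[abs_def])
  have Ez4: "expectation (\<lambda>\<omega>. (z \<omega>) ^ 4) \<le> (c k) ^ 4 * m"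
    using mom4[OF k] by (simp add: z_def power_mult_distrib mult_left_mono)
  have "expectation (\<lambda>\<omega>. (\<epsilon> k \<omega>)\<^sup>2) \<le> expectation (\<lambda>\<omega>. (1 + (\<epsilon> k \<omega>) ^ 4) / 2)"
  proof (intro integral_mono)
    show "integrable M (\<lambda>\<omega>. (\<epsilon> k \<omega>)\<^sup>2)" using lower[OF _ int4[OF k]] k by simp
    show "integrable M (\<lambda>\<omega>. (1 + (\<epsilon> k \<omega>) ^ 4) / 2)" using int4[OF k] by simp
    show "x\<^sup>2 \<le> (1 + x ^ 4) / 2" for x :: real
      using zero_le_power2[of "1 - x\<^sup>2"] by (simp add: power2_eq_square algebra_simps power4_eq_xxxx)
  qed
  also have "\<dots> \<le> m" using int4[OF k] mom4[OF k] m by (simp add: prob_space)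
  finally have Ez2: "expectation (\<lambda>\<omega>. (z \<omega>)\<^sup>2) \<le> (c k)\<^sup>2 * m"
    by (simp add: z_def power_mult_distrib mult_left_mono)
  have ind': "indep_var borel (\<lambda>\<omega>. (L \<omega>) ^ a) borel (\<lambda>\<omega>. (z \<omega>) ^ b)" for a b :: nat
    unfolding L_def z_def
    by (rule indep_var_past_present[OF ind k, of "\<lambda>e. (\<Sum>i<k. c i * e i) ^ a" "\<lambda>x. (c k * x) ^ b"]) auto
  have prod: "has_bochner_integral M (\<lambda>\<omega>. (L \<omega>) ^ a * (z \<omega>) ^ b)
      (expectation (\<lambda>\<omega>. (L \<omega>) ^ a) * expectation (\<lambda>\<omega>. (z \<omega>) ^ b))"
    if "a \<in> {1, 2, 3}" "b \<in> {1, 2, 3}" for a b :: nat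
  proof -
    have "integrable M (\<lambda>\<omega>. (L \<omega>) ^ a)" "integrable M (\<lambda>\<omega>. (z \<omega>) ^ b)"
      using that Li zi by auto
    then show ?thesis
      using indep_var_lebesgue_integral[OF ind'] indep_var_integrable[OF ind']
      by (simp add: has_bochner_integral_iff)
  qed
  have EL1: "expectation L = 0"
    unfolding L_def[abs_def] using k mean lower[OF _ int4]
    by (subst Bochner_Integration.integral_sum) auto
  have sum: "(\<Sum>i<Suc k. c i * \<epsilon> i \<omega>) = L \<omega> + z \<omega>" for \<omega> by (simp add: L_def z_def)
  have e4: "(L \<omega> + z \<omega>) ^ 4 = (L \<omega>) ^ 4 + 4 * ((L \<omega>) ^ 3 * (z \<omega>) ^ 1) + 6 * ((L \<omega>)\<^sup>2 * (z \<omega>)\<^sup>2)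
      + 4 * ((L \<omega>) ^ 1 * (z \<omega>) ^ 3) + (z \<omega>) ^ 4" for \<omega>
    by (simp add: power2_eq_square power3_eq_cube power4_eq_xxxx algebra_simps)
  have e2: "(L \<omega> + z \<omega>)\<^sup>2 = (L \<omega>)\<^sup>2 + 2 * ((L \<omega>) ^ 1 * (z \<omega>) ^ 1) + (z \<omega>)\<^sup>2" for \<omega>
    by (simp add: power2_eq_square algebra_simps)
  have h4: "has_bochner_integral M (\<lambda>\<omega>. (L \<omega> + z \<omega>) ^ 4) (expectation (\<lambda>\<omega>. (L \<omega>) ^ 4)
      + 4 * (expectation (\<lambda>\<omega>. (L \<omega>) ^ 3) * expectation (\<lambda>\<omega>. (z \<omega>) ^ 1))
      + 6 * (expectation (\<lambda>\<omega>. (L \<omega>)\<^sup>2) * expectation (\<lambda>\<omega>. (z \<omega>)\<^sup>2))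
      + 4 * (expectation (\<lambda>\<omega>. (L \<omega>) ^ 1) * expectation (\<lambda>\<omega>. (z \<omega>) ^ 3))
      + expectation (\<lambda>\<omega>. (z \<omega>) ^ 4))"
    unfolding e4
    by (intro has_bochner_integral_add has_bochner_integral_mult_right prod
        has_bochner_integral_integrable L4 z4) auto
  have h2: "has_bochner_integral M (\<lambda>\<omega>. (L \<omega> + z \<omega>)\<^sup>2) (expectation (\<lambda>\<omega>. (L \<omega>)\<^sup>2)
      + 2 * (expectation (\<lambda>\<omega>. (L \<omega>) ^ 1) * expectation (\<lambda>\<omega>. (z \<omega>) ^ 1))
      + expectation (\<lambda>\<omega>. (z \<omega>)\<^sup>2))"
    unfolding e2
    by (intro has_bochner_integral_add has_bochner_integral_mult_right prod
        has_bochner_integral_integrable) (use Li zi in auto)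
  have "expectation (\<lambda>\<omega>. (L \<omega> + z \<omega>) ^ 4) = expectation (\<lambda>\<omega>. (L \<omega>) ^ 4)
      + 6 * (expectation (\<lambda>\<omega>. (L \<omega>)\<^sup>2) * expectation (\<lambda>\<omega>. (z \<omega>)\<^sup>2)) + expectation (\<lambda>\<omega>. (z \<omega>) ^ 4)"
    using h4 EL1 Ez by (simp add: has_bochner_integral_iff)
  also have "\<dots> \<le> 3 * m\<^sup>2 * S\<^sup>2 + 6 * ((m * S) * ((c k)\<^sup>2 * m)) + (c k) ^ 4 * m"
    using EL4 EL2 Ez2 Ez4 m S0 by (intro add_mono mult_left_mono mult_mono) auto
  also have "(c k) ^ 4 * m \<le> (c k) ^ 4 * (3 * m\<^sup>2)"
    using m by (intro mult_left_mono) (auto simp: power2_eq_square)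
  finally have E4: "expectation (\<lambda>\<omega>. (L \<omega> + z \<omega>) ^ 4) \<le> 3 * m\<^sup>2 * (S + (c k)\<^sup>2)\<^sup>2"
    by (simp add: power2_eq_square power4_eq_xxxx algebra_simps)
  have E2: "expectation (\<lambda>\<omega>. (L \<omega> + z \<omega>)\<^sup>2) \<le> m * (S + (c k)\<^sup>2)"
    using h2 EL1 Ez EL2 Ez2 by (simp add: has_bochner_integral_iff algebra_simps)
  show ?case
    unfolding sum using h4 E4 E2 by (auto simp: S_def has_bochner_integral_iff)
qed

text \<open>Ordering the indices writes the centred form as a sum of increments
\<open>\<Delta>\<^sub>k = 2 \<epsilon>\<^sub>k L\<^sub>k + a\<^sub>k\<^sub>k (\<epsilon>\<^sub>k\<^sup>2 - \<sigma>\<^sup>2)\<close>, where \<open>L\<^sub>k\<close> is linear in the variables before \<open>k\<close>. Both summands are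
centred given the past, so \<open>powr_moment_growth\<close> applies. Rows of length at most one keep the fourth
moment of \<open>L\<^sub>k\<close> bounded.\<close>

lemma (in prob_space) quadratic_form_moment:
  fixes \<epsilon> :: "nat \<Rightarrow> 'a \<Rightarrow> real" and a :: "nat \<Rightarrow> nat \<Rightarrow> real"
  assumes s: "1 \<le> s" "s \<le> 2" and n: "0 < n"
    and ind: "indep_vars (\<lambda>_. borel) \<epsilon> {..<n}" and m: "1 \<le> m"
    and mean: "\<And>i. i < n \<Longrightarrow> expectation (\<epsilon> i) = 0"
    and var: "\<And>i. i < n \<Longrightarrow> expectation (\<lambda>\<omega>. (\<epsilon> i \<omega>)\<^sup>2) = \<sigma>\<^sup>2"
    and var_le: "(\<sigma> ^ 4) powr s \<le> m"
    and int4: "\<And>i. i < n \<Longrightarrow> integrable M (\<lambda>\<omega>. (\<epsilon> i \<omega>) ^ 4)"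
    and mom4: "\<And>i. i < n \<Longrightarrow> expectation (\<lambda>\<omega>. (\<epsilon> i \<omega>) ^ 4) \<le> m"
    and int4s: "\<And>i. i < n \<Longrightarrow> integrable M (\<lambda>\<omega>. ((\<epsilon> i \<omega>) ^ 4) powr s)"
    and mom4s: "\<And>i. i < n \<Longrightarrow> expectation (\<lambda>\<omega>. ((\<epsilon> i \<omega>) ^ 4) powr s) \<le> m"
    and sym: "\<And>i j. i < n \<Longrightarrow> j < n \<Longrightarrow> a i j = a j i"
    and row: "\<And>i. i < n \<Longrightarrow> (\<Sum>j<n. (a i j)\<^sup>2) \<le> 1"
  defines "q \<equiv> \<lambda>\<omega>. (\<Sum>i<n. \<Sum>j<n. a i j * \<epsilon> i \<omega> * \<epsilon> j \<omega>) - \<sigma>\<^sup>2 * (\<Sum>i<n. a i i)"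
  shows "integrable M (\<lambda>\<omega>. (1 + (q \<omega>)\<^sup>2) powr s)"
    and "expectation (\<lambda>\<omega>. (1 + (q \<omega>)\<^sup>2) powr s) \<le> exp 24 * (1 + 24 * (2080 * m ^ 3)) * real n powr s"
proof -
  have em[measurable]: "\<epsilon> i \<in> borel_measurable M" if "i < n" for i
    using ind that by (auto simp: indep_vars_def)
  define L where "L k e = (\<Sum>i<k. a k i * e i)" for k and e :: "nat \<Rightarrow> real"
  define \<Delta> where "\<Delta> k e = 2 * e k * L k e + a k k * ((e k)\<^sup>2 - \<sigma>\<^sup>2)" for k and e :: "nat \<Rightarrow> real"
  define T where "T k e = (\<Sum>j<k. \<Delta> j e)" for k and e :: "nat \<Rightarrow> real"
  define E where "E \<omega> = (\<lambda>i. \<epsilon> i \<omega>)" for \<omega>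
  have expand: "(\<Sum>i<k. \<Sum>j<k. a i j * e i * e j) - \<sigma>\<^sup>2 * (\<Sum>i<k. a i i) = T k e" if "k \<le> n" for k e
    using that
  proof (induction k)
    case 0
    then show ?case by (simp add: T_def)
  next
    case (Suc k)
    have "(\<Sum>i<k. a i k * e i * e k) = (\<Sum>i<k. a k i * e k * e i)"
      using Suc.prems by (intro sum.cong) (auto simp: sym mult_ac)
    then show ?case using Suc
      by (simp add: T_def \<Delta>_def L_def sum.distrib sum_distrib_left algebra_simps power2_eq_square)
  qed
  have q: "q \<omega> = T n (E \<omega>)" for \<omega> using expand[of n "E \<omega>"] by (simp add: q_def E_def)
  have Em: "(\<lambda>\<omega>. L k (E \<omega>)) \<in> borel_measurable M" "(\<lambda>\<omega>. T k (E \<omega>)) \<in> borel_measurable M"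
    if "k \<le> n" for k
    using that unfolding L_def T_def \<Delta>_def E_def by (auto intro!: borel_measurable_sum)
  have past: "L k \<in> borel_measurable (Pi\<^sub>M {..<k} (\<lambda>_. borel))"
    "T k \<in> borel_measurable (Pi\<^sub>M {..<k} (\<lambda>_. borel))" for k
  proof -
    have *: "(\<lambda>e. e i) \<in> borel_measurable (Pi\<^sub>M {..<k} (\<lambda>_. borel :: real measure))" if "i < k" for i
      using that by (intro measurable_component_singleton) auto
    show "L k \<in> borel_measurable (Pi\<^sub>M {..<k} (\<lambda>_. borel))"
      unfolding L_def by (auto intro!: borel_measurable_sum borel_measurable_times *)
    show "T k \<in> borel_measurable (Pi\<^sub>M {..<k} (\<lambda>_. borel))"
      unfolding T_def \<Delta>_def L_def
      by (auto intro!: borel_measurable_sum borel_measurable_times borel_measurable_add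
          borel_measurable_diff borel_measurable_power *)
  qed
  have restr: "L k (restrict e {..<k}) = L k e" "T k (restrict e {..<k}) = T k e" for k e
    by (auto simp: L_def T_def \<Delta>_def intro!: sum.cong)
  have lin: "integrable M (\<lambda>\<omega>. (L k (E \<omega>)) ^ 4)" "expectation (\<lambda>\<omega>. (L k (E \<omega>)) ^ 4) \<le> 3 * m\<^sup>2"
    if k: "k < n" for k
  proof -
    have "(\<Sum>i<k. (a k i)\<^sup>2) \<le> (\<Sum>i<n. (a k i)\<^sup>2)" using k by (intro sum_mono2) auto
    with row[OF k] have "(\<Sum>i<k. (a k i)\<^sup>2)\<^sup>2 \<le> 1" by (intro power_le_one) (auto simp: sum_nonneg)
    then have "3 * m\<^sup>2 * (\<Sum>i<k. (a k i)\<^sup>2)\<^sup>2 \<le> 3 * m\<^sup>2 * 1" by (intro mult_left_mono) auto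
    with linear_form_moments[OF ind m mean int4 mom4, of k "a k"] k
    show "integrable M (\<lambda>\<omega>. (L k (E \<omega>)) ^ 4)" "expectation (\<lambda>\<omega>. (L k (E \<omega>)) ^ 4) \<le> 3 * m\<^sup>2"
      by (auto simp: L_def E_def)
  qed
  have sq_powr: "(x\<^sup>2) powr s \<le> 1 + x ^ 4" for x :: real
  proof (cases "x\<^sup>2 \<le> 1")
    case True
    then have "(x\<^sup>2) powr s \<le> 1" using s by (intro powr_le1) auto
    then show ?thesis by (simp add: add_increasing2)
  next
    case False
    then have "(x\<^sup>2) powr s \<le> (x\<^sup>2) powr 2" using s by (intro powr_mono) auto
    then show ?thesis using False by (simp add: powr_numeral power_mult[symmetric])
  qed
  have L2s: "integrable M (\<lambda>\<omega>. ((L k (E \<omega>))\<^sup>2) powr s)"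
      "expectation (\<lambda>\<omega>. ((L k (E \<omega>))\<^sup>2) powr s) \<le> 4 * m\<^sup>2" if k: "k < n" for k
  proof -
    have i: "integrable M (\<lambda>\<omega>. 1 + (L k (E \<omega>)) ^ 4)" using lin[OF k] by simp
    show i2: "integrable M (\<lambda>\<omega>. ((L k (E \<omega>))\<^sup>2) powr s)"
      by (rule Bochner_Integration.integrable_bound[OF i]) (use sq_powr Em k in auto)
    have "expectation (\<lambda>\<omega>. ((L k (E \<omega>))\<^sup>2) powr s) \<le> expectation (\<lambda>\<omega>. 1 + (L k (E \<omega>)) ^ 4)"
      by (intro integral_mono i i2 sq_powr)
    also have "\<dots> \<le> 1 + 3 * m\<^sup>2" using lin[OF k] by (simp add: prob_space)
    also have "\<dots> \<le> 4 * m\<^sup>2" using m mult_mono[of 1 m 1 m] by (simp add: power2_eq_square)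
    finally show "expectation (\<lambda>\<omega>. ((L k (E \<omega>))\<^sup>2) powr s) \<le> 4 * m\<^sup>2" .
  qed
  have e2s: "integrable M (\<lambda>\<omega>. ((\<epsilon> k \<omega>)\<^sup>2) powr s)"
      "expectation (\<lambda>\<omega>. ((\<epsilon> k \<omega>)\<^sup>2) powr s) \<le> 2 * m"
      "integrable M (\<epsilon> k)" "integrable M (\<lambda>\<omega>. (\<epsilon> k \<omega>)\<^sup>2)" if k: "k < n" for k
  proof -
    have i: "integrable M (\<lambda>\<omega>. 1 + (\<epsilon> k \<omega>) ^ 4)" using int4[OF k] by simp
    show i2: "integrable M (\<lambda>\<omega>. ((\<epsilon> k \<omega>)\<^sup>2) powr s)"
      by (rule Bochner_Integration.integrable_bound[OF i]) (use sq_powr k in auto)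
    have "expectation (\<lambda>\<omega>. ((\<epsilon> k \<omega>)\<^sup>2) powr s) \<le> expectation (\<lambda>\<omega>. 1 + (\<epsilon> k \<omega>) ^ 4)"
      by (intro integral_mono i i2 sq_powr)
    also have "\<dots> \<le> 2 * m" using int4[OF k] mom4[OF k] m by (simp add: prob_space)
    finally show "expectation (\<lambda>\<omega>. ((\<epsilon> k \<omega>)\<^sup>2) powr s) \<le> 2 * m" .
    have sq: "x\<^sup>2 \<le> 1 + x ^ 4" "\<bar>x\<bar> \<le> 1 + x ^ 4" for x :: real
    proof -
      have "0 \<le> (1 - x\<^sup>2)\<^sup>2" "0 \<le> (1 - \<bar>x\<bar>)\<^sup>2" by simp_all
      then have "2 * x\<^sup>2 \<le> 1 + x ^ 4" "2 * \<bar>x\<bar> \<le> 1 + x\<^sup>2"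
        by (simp_all add: power2_eq_square power4_eq_xxxx algebra_simps)
      moreover have "0 \<le> x ^ 4" by simp
      ultimately show "x\<^sup>2 \<le> 1 + x ^ 4" "\<bar>x\<bar> \<le> 1 + x ^ 4" by linarith+
    qed
    show "integrable M (\<epsilon> k)" "integrable M (\<lambda>\<omega>. (\<epsilon> k \<omega>)\<^sup>2)"
      by (rule Bochner_Integration.integrable_bound[OF i]; use sq k in auto)+
  qed
  have D_le: "((\<Delta> k (E \<omega>))\<^sup>2) powr s \<le> 256 * (((L k (E \<omega>))\<^sup>2) powr s * ((\<epsilon> k \<omega>)\<^sup>2) powr s)
      + 16 * (((\<epsilon> k \<omega>) ^ 4) powr s + (\<sigma> ^ 4) powr s)" if k: "k < n" for k \<omega>
  proof -
    define u where "u = 2 * \<epsilon> k \<omega> * L k (E \<omega>)"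
    define w where "w = a k k * ((\<epsilon> k \<omega>)\<^sup>2 - \<sigma>\<^sup>2)"
    have pw: "(x + y) powr s \<le> 4 * (x powr s + y powr s)" if "0 \<le> x" "0 \<le> y" for x y :: real
    proof -
      have "(x + y) powr s \<le> (2 * max x y) powr s" using that s by (intro powr_mono2) auto
      also have "\<dots> = 2 powr s * (max x y) powr s" by (rule powr_mult)
      also have "\<dots> \<le> 2 powr 2 * (x powr s + y powr s)"
        using s by (intro mult_mono powr_mono) (auto simp: max_def)
      finally show ?thesis by simp
    qed
    have "(a k k)\<^sup>2 \<le> (\<Sum>j<n. (a k j)\<^sup>2)" using k by (intro member_le_sum) auto
    then have akk: "(a k k)\<^sup>2 \<le> 1" using row[OF k] by linarith
    have "\<bar>(\<epsilon> k \<omega>)\<^sup>2 - \<sigma>\<^sup>2\<bar> \<le> max ((\<epsilon> k \<omega>)\<^sup>2) (\<sigma>\<^sup>2)" by (auto simp: max_def abs_if)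
    then have "\<bar>(\<epsilon> k \<omega>)\<^sup>2 - \<sigma>\<^sup>2\<bar>\<^sup>2 \<le> (max ((\<epsilon> k \<omega>)\<^sup>2) (\<sigma>\<^sup>2))\<^sup>2" by (intro power_mono) auto
    also have "\<dots> = max ((\<epsilon> k \<omega>) ^ 4) (\<sigma> ^ 4)"
      by (cases "(\<epsilon> k \<omega>)\<^sup>2 \<le> \<sigma>\<^sup>2")
        (use power_mono[of "(\<epsilon> k \<omega>)\<^sup>2" "\<sigma>\<^sup>2" 2] power_mono[of "\<sigma>\<^sup>2" "(\<epsilon> k \<omega>)\<^sup>2" 2] in
          \<open>auto simp: max_def power_mult[symmetric]\<close>)
    finally have d: "((\<epsilon> k \<omega>)\<^sup>2 - \<sigma>\<^sup>2)\<^sup>2 \<le> max ((\<epsilon> k \<omega>) ^ 4) (\<sigma> ^ 4)" by simp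
    have "w\<^sup>2 \<le> 1 * ((\<epsilon> k \<omega>)\<^sup>2 - \<sigma>\<^sup>2)\<^sup>2"
      unfolding w_def power_mult_distrib using akk by (intro mult_right_mono) auto
    then have w2: "w\<^sup>2 \<le> max ((\<epsilon> k \<omega>) ^ 4) (\<sigma> ^ 4)" using d by simp
    then have "(w\<^sup>2) powr s \<le> (max ((\<epsilon> k \<omega>) ^ 4) (\<sigma> ^ 4)) powr s" using s by (intro powr_mono2) auto
    also have "\<dots> \<le> ((\<epsilon> k \<omega>) ^ 4) powr s + (\<sigma> ^ 4) powr s" by (auto simp: max_def)
    finally have ws: "(w\<^sup>2) powr s \<le> ((\<epsilon> k \<omega>) ^ 4) powr s + (\<sigma> ^ 4) powr s" .
    have "(u\<^sup>2) powr s = 4 powr s * (((L k (E \<omega>))\<^sup>2) powr s * ((\<epsilon> k \<omega>)\<^sup>2) powr s)"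
      by (simp add: u_def power_mult_distrib powr_mult mult_ac)
    also have "\<dots> \<le> 4 powr 2 * (((L k (E \<omega>))\<^sup>2) powr s * ((\<epsilon> k \<omega>)\<^sup>2) powr s)"
      using s by (intro mult_right_mono powr_mono) auto
    finally have us: "(u\<^sup>2) powr s \<le> 16 * (((L k (E \<omega>))\<^sup>2) powr s * ((\<epsilon> k \<omega>)\<^sup>2) powr s)" by simp
    have "(u + w)\<^sup>2 \<le> 2 * (u\<^sup>2 + w\<^sup>2)"
      using zero_le_power2[of "u - w"] by (simp add: power2_eq_square algebra_simps)
    then have "((u + w)\<^sup>2) powr s \<le> (2 * (u\<^sup>2 + w\<^sup>2)) powr s" using s by (intro powr_mono2) auto
    also have "\<dots> = 2 powr s * (u\<^sup>2 + w\<^sup>2) powr s" by (rule powr_mult)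
    also have "\<dots> \<le> 2 powr 2 * (4 * ((u\<^sup>2) powr s + (w\<^sup>2) powr s))"
      using s pw[of "u\<^sup>2" "w\<^sup>2"] by (intro mult_mono powr_mono) auto
    finally have "((u + w)\<^sup>2) powr s \<le> 16 * ((u\<^sup>2) powr s + (w\<^sup>2) powr s)" by simp
    moreover have "\<Delta> k (E \<omega>) = u + w" by (simp add: \<Delta>_def u_def w_def E_def)
    ultimately show ?thesis using us ws by simp
  qed
  \<comment> \<open>Lets \<open>256 * (4 m\<^sup>2) * (2 m) + 16 * (2 m)\<close> be bounded by \<open>2080 m\<^sup>3\<close>.\<close>
  have m3: "m \<le> m ^ 3" using m power_increasing[of 1 3 m] by simp
  have DB: "integrable M (\<lambda>\<omega>. ((\<Delta> k (E \<omega>))\<^sup>2) powr s)"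
      "expectation (\<lambda>\<omega>. ((\<Delta> k (E \<omega>))\<^sup>2) powr s) \<le> 2080 * m ^ 3" if k: "k < n" for k
  proof -
    have iv: "indep_var borel (\<lambda>\<omega>. ((L k (E \<omega>))\<^sup>2) powr s) borel (\<lambda>\<omega>. ((\<epsilon> k \<omega>)\<^sup>2) powr s)"
      unfolding E_def
      by (rule indep_var_past_present[OF ind k, of "\<lambda>e. ((L k e)\<^sup>2) powr s" "\<lambda>x. (x\<^sup>2) powr s"])
        (use past in \<open>auto simp: restr\<close>)
    note p = indep_var_lebesgue_integral[OF iv L2s(1)[OF k] e2s(1)[OF k]]
      and pi = indep_var_integrable[OF iv L2s(1)[OF k] e2s(1)[OF k]]
    define U where "U \<omega> = 256 * (((L k (E \<omega>))\<^sup>2) powr s * ((\<epsilon> k \<omega>)\<^sup>2) powr s)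
      + 16 * (((\<epsilon> k \<omega>) ^ 4) powr s + (\<sigma> ^ 4) powr s)" for \<omega>
    have D_U: "((\<Delta> k (E \<omega>))\<^sup>2) powr s \<le> U \<omega>" for \<omega> using D_le[OF k] by (simp add: U_def)
    have Ui: "integrable M U" unfolding U_def using pi int4s[OF k] by simp
    have [measurable]: "(\<lambda>\<omega>. L k (E \<omega>)) \<in> borel_measurable M" using Em k by simp
    have "(\<lambda>\<omega>. \<Delta> k (E \<omega>)) \<in> borel_measurable M" unfolding \<Delta>_def using k by (simp add: E_def) (simp add: E_def[symmetric])
    then show i: "integrable M (\<lambda>\<omega>. ((\<Delta> k (E \<omega>))\<^sup>2) powr s)"
      by (intro Bochner_Integration.integrable_bound[OF Ui])
        (auto intro!: AE_I2 order_trans[OF D_U abs_ge_self])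
    have "expectation (\<lambda>\<omega>. ((\<Delta> k (E \<omega>))\<^sup>2) powr s) \<le> expectation U"
      by (intro integral_mono i Ui D_U)
    also have "\<dots> = 256 * (expectation (\<lambda>\<omega>. ((L k (E \<omega>))\<^sup>2) powr s) * expectation (\<lambda>\<omega>. ((\<epsilon> k \<omega>)\<^sup>2) powr s))
        + 16 * (expectation (\<lambda>\<omega>. ((\<epsilon> k \<omega>) ^ 4) powr s) + (\<sigma> ^ 4) powr s)"
      unfolding U_def using pi p int4s[OF k] by (simp add: prob_space)
    also have "\<dots> \<le> 256 * ((4 * m\<^sup>2) * (2 * m)) + 16 * (m + m)"
      using L2s(2)[OF k] e2s(2)[OF k] mom4s[OF k] var_le m
      by (intro add_mono mult_left_mono mult_mono) auto
    also have "\<dots> \<le> 2080 * m ^ 3" using m3 by (simp add: power2_eq_square power3_eq_cube)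
    finally show "expectation (\<lambda>\<omega>. ((\<Delta> k (E \<omega>))\<^sup>2) powr s) \<le> 2080 * m ^ 3" .
  qed
  have orth: "has_bochner_integral M
      (\<lambda>\<omega>. T k (E \<omega>) * (1 + (T k (E \<omega>))\<^sup>2) powr (s - 1) * \<Delta> k (E \<omega>)) 0"
    if k: "k < n" and Ti: "integrable M (\<lambda>\<omega>. (1 + (T k (E \<omega>))\<^sup>2) powr s)" for k
  proof -
    define \<phi> where "\<phi> t = t * (1 + t\<^sup>2) powr (s - 1)" for t :: real
    have \<phi>m[measurable]: "\<phi> \<in> borel_measurable borel" unfolding \<phi>_def by measurable
    have [measurable]: "(\<lambda>\<omega>. L k (E \<omega>)) \<in> borel_measurable M" "(\<lambda>\<omega>. T k (E \<omega>)) \<in> borel_measurable M"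
      using Em k by simp_all
    \<comment> \<open>Young's inequality: both \<open>1 + t\<^sup>2\<close> and \<open>l\<^sup>2\<close> are at most their maximum \<open>v\<close>.\<close>
    have \<phi>_le: "\<bar>\<phi> t * l\<bar> \<le> (1 + t\<^sup>2) powr s + (l\<^sup>2) powr s" for t l :: real
    proof -
      have "0 < 1 + t\<^sup>2" by (simp add: add_pos_nonneg)
      define v where "v = max (1 + t\<^sup>2) (l\<^sup>2)"
      have v: "0 < v" "1 + t\<^sup>2 \<le> v" "l\<^sup>2 \<le> v" using \<open>0 < 1 + t\<^sup>2\<close> by (auto simp: v_def)
      have "(\<bar>t\<bar> * \<bar>l\<bar>)\<^sup>2 \<le> v * v"
        unfolding power_mult_distrib using v by (intro mult_mono) auto
      then have "\<bar>t\<bar> * \<bar>l\<bar> \<le> v" using v by (simp add: power2_eq_square[symmetric] power2_le_iff_abs_le)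
      moreover have "(1 + t\<^sup>2) powr (s - 1) \<le> v powr (s - 1)"
        using v s \<open>0 < 1 + t\<^sup>2\<close> by (intro powr_mono2) auto
      ultimately have "(\<bar>t\<bar> * \<bar>l\<bar>) * (1 + t\<^sup>2) powr (s - 1) \<le> v * v powr (s - 1)"
        using v by (intro mult_mono) auto
      also have "\<dots> = v powr s" using v powr_mult_base[of v "s - 1"] by simp
      also have "\<dots> \<le> (1 + t\<^sup>2) powr s + (l\<^sup>2) powr s" by (auto simp: v_def max_def)
      finally show ?thesis by (simp add: \<phi>_def abs_mult mult_ac)
    qed
    have i1: "integrable M (\<lambda>\<omega>. \<phi> (T k (E \<omega>)) * L k (E \<omega>))"
      by (rule Bochner_Integration.integrable_bound[OF Bochner_Integration.integrable_add[OF Ti L2s(1)[OF k]]])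
        (auto intro!: order_trans[OF \<phi>_le])
    have i2: "integrable M (\<lambda>\<omega>. \<phi> (T k (E \<omega>)))"
      by (rule Bochner_Integration.integrable_bound[OF Bochner_Integration.integrable_add[OF Ti integrable_const[of 1]]])
        (use \<phi>_le[of _ 1] in \<open>auto intro!: order_trans[OF \<phi>_le[of _ 1, simplified]]\<close>)
    have iv1: "indep_var borel (\<lambda>\<omega>. \<phi> (T k (E \<omega>)) * L k (E \<omega>)) borel (\<lambda>\<omega>. \<epsilon> k \<omega>)"
      unfolding E_def
      by (rule indep_var_past_present[OF ind k, of "\<lambda>e. \<phi> (T k e) * L k e" "\<lambda>x. x"])
        (use past in \<open>auto simp: restr\<close>)
    have iv2: "indep_var borel (\<lambda>\<omega>. \<phi> (T k (E \<omega>))) borel (\<lambda>\<omega>. (\<epsilon> k \<omega>)\<^sup>2 - \<sigma>\<^sup>2)"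
      unfolding E_def
      by (rule indep_var_past_present[OF ind k, of "\<lambda>e. \<phi> (T k e)" "\<lambda>x. x\<^sup>2 - \<sigma>\<^sup>2"])
        (use past in \<open>auto simp: restr\<close>)
    have i3: "integrable M (\<lambda>\<omega>. (\<epsilon> k \<omega>)\<^sup>2 - \<sigma>\<^sup>2)" using e2s(4)[OF k] by simp
    have e3: "expectation (\<lambda>\<omega>. (\<epsilon> k \<omega>)\<^sup>2 - \<sigma>\<^sup>2) = 0" using e2s(4)[OF k] var[OF k] by (simp add: prob_space)
    have h1: "has_bochner_integral M (\<lambda>\<omega>. (\<phi> (T k (E \<omega>)) * L k (E \<omega>)) * \<epsilon> k \<omega>) 0"
      using indep_var_lebesgue_integral[OF iv1 i1 e2s(3)[OF k]] indep_var_integrable[OF iv1 i1 e2s(3)[OF k]]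
      by (simp add: has_bochner_integral_iff mean[OF k])
    have h2: "has_bochner_integral M (\<lambda>\<omega>. \<phi> (T k (E \<omega>)) * ((\<epsilon> k \<omega>)\<^sup>2 - \<sigma>\<^sup>2)) 0"
      using indep_var_lebesgue_integral[OF iv2 i2 i3] indep_var_integrable[OF iv2 i2 i3]
      by (simp add: has_bochner_integral_iff e3)
    have eq: "(\<lambda>\<omega>. T k (E \<omega>) * (1 + (T k (E \<omega>))\<^sup>2) powr (s - 1) * \<Delta> k (E \<omega>))
      = (\<lambda>\<omega>. 2 * ((\<phi> (T k (E \<omega>)) * L k (E \<omega>)) * \<epsilon> k \<omega>)
        + a k k * (\<phi> (T k (E \<omega>)) * ((\<epsilon> k \<omega>)\<^sup>2 - \<sigma>\<^sup>2)))"
      unfolding \<phi>_def \<Delta>_def E_def by (simp add: algebra_simps)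
    have "has_bochner_integral M (\<lambda>\<omega>. 2 * ((\<phi> (T k (E \<omega>)) * L k (E \<omega>)) * \<epsilon> k \<omega>)
        + a k k * (\<phi> (T k (E \<omega>)) * ((\<epsilon> k \<omega>)\<^sup>2 - \<sigma>\<^sup>2))) (2 * 0 + a k k * 0)"
      by (intro has_bochner_integral_add has_bochner_integral_mult_right h1 h2)
    then show ?thesis unfolding eq by simp
  qed
  have Tm: "(\<lambda>\<omega>. T k (E \<omega>)) \<in> borel_measurable M" if "k \<le> n" for k using Em that by simp
  note growth = powr_moment_growth[where T = "\<lambda>k \<omega>. T k (E \<omega>)" and \<Delta> = "\<lambda>k \<omega>. \<Delta> k (E \<omega>)"
      and B = "2080 * m ^ 3", OF s n _ _ Tm DB orth]
  show "integrable M (\<lambda>\<omega>. (1 + (q \<omega>)\<^sup>2) powr s)"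
    unfolding q by (rule growth(1)) (auto simp: T_def)
  show "expectation (\<lambda>\<omega>. (1 + (q \<omega>)\<^sup>2) powr s) \<le> exp 24 * (1 + 24 * (2080 * m ^ 3)) * real n powr s"
    unfolding q by (rule growth(2)) (auto simp: T_def)
qed

text \<open>Markov's inequality for the moment of order \<open>2 s\<close>: the moment is of order \<open>n\<^sup>s\<close> and the threshold
contributes \<open>n\<^sup>2\<^sup>s\<close>.\<close>

lemma (in prob_space) quadratic_form_tail:
  fixes \<epsilon> :: "nat \<Rightarrow> 'a \<Rightarrow> real" and a :: "nat \<Rightarrow> nat \<Rightarrow> real"
  assumes s: "1 \<le> s" "s \<le> 2" and n: "0 < n"
    and ind: "indep_vars (\<lambda>_. borel) \<epsilon> {..<n}" and m: "1 \<le> m"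
    and mean: "\<And>i. i < n \<Longrightarrow> expectation (\<epsilon> i) = 0"
    and var: "\<And>i. i < n \<Longrightarrow> expectation (\<lambda>\<omega>. (\<epsilon> i \<omega>)\<^sup>2) = \<sigma>\<^sup>2"
    and var_le: "(\<sigma> ^ 4) powr s \<le> m"
    and int4: "\<And>i. i < n \<Longrightarrow> integrable M (\<lambda>\<omega>. (\<epsilon> i \<omega>) ^ 4)"
    and mom4: "\<And>i. i < n \<Longrightarrow> expectation (\<lambda>\<omega>. (\<epsilon> i \<omega>) ^ 4) \<le> m"
    and int4s: "\<And>i. i < n \<Longrightarrow> integrable M (\<lambda>\<omega>. ((\<epsilon> i \<omega>) ^ 4) powr s)"
    and mom4s: "\<And>i. i < n \<Longrightarrow> expectation (\<lambda>\<omega>. ((\<epsilon> i \<omega>) ^ 4) powr s) \<le> m"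
    and sym: "\<And>i j. i < n \<Longrightarrow> j < n \<Longrightarrow> a i j = a j i"
    and row: "\<And>i. i < n \<Longrightarrow> (\<Sum>j<n. (a i j)\<^sup>2) \<le> 1"
    and x: "0 < x"
  shows "prob {\<omega> \<in> space M. real n * x \<le>
      \<bar>(\<Sum>i<n. \<Sum>j<n. a i j * \<epsilon> i \<omega> * \<epsilon> j \<omega>) - \<sigma>\<^sup>2 * (\<Sum>i<n. a i i)\<bar>}
    \<le> exp 24 * (1 + 24 * (2080 * m ^ 3)) / (x\<^sup>2) powr s * real n powr (- s)"
proof -
  define q where "q \<omega> = (\<Sum>i<n. \<Sum>j<n. a i j * \<epsilon> i \<omega> * \<epsilon> j \<omega>) - \<sigma>\<^sup>2 * (\<Sum>i<n. a i i)" for \<omega>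
  define C where "C = exp 24 * (1 + 24 * (2080 * m ^ 3))"
  have em[measurable]: "\<epsilon> i \<in> borel_measurable M" if "i < n" for i
    using ind that by (auto simp: indep_vars_def)
  note q = quadratic_form_moment[OF s n ind m mean var var_le int4 mom4 int4s mom4s sym row, folded q_def C_def]
  define y where "y = (real n * x)\<^sup>2"
  have y: "y > 0" using n x by (simp add: y_def)
  have "{\<omega> \<in> space M. real n * x \<le> \<bar>q \<omega>\<bar>} \<subseteq> {\<omega> \<in> space M. y powr s \<le> (1 + (q \<omega>)\<^sup>2) powr s}"
  proof safe
    fix \<omega> assume "real n * x \<le> \<bar>q \<omega>\<bar>"
    then have "(real n * x)\<^sup>2 \<le> \<bar>q \<omega>\<bar>\<^sup>2" using x by (intro power_mono) auto
    then have "y \<le> 1 + (q \<omega>)\<^sup>2" by (simp add: y_def)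
    then show "y powr s \<le> (1 + (q \<omega>)\<^sup>2) powr s" using s y by (intro powr_mono2) auto
  qed
  then have "prob {\<omega> \<in> space M. real n * x \<le> \<bar>q \<omega>\<bar>} \<le> prob {\<omega> \<in> space M. y powr s \<le> (1 + (q \<omega>)\<^sup>2) powr s}"
    using q by (intro finite_measure_mono) auto
  also have "\<dots> \<le> expectation (\<lambda>\<omega>. (1 + (q \<omega>)\<^sup>2) powr s) / y powr s"
    using y q by (intro integral_Markov_inequality_measure[where A = "{}"]) auto
  also have "\<dots> \<le> (C * real n powr s) / y powr s" using q by (intro divide_right_mono) auto
  also have "\<dots> = C / (x\<^sup>2) powr s * real n powr (- s)"
    using n x by (simp add: y_def power_mult_distrib powr_mult powr_minus divide_simps power2_eq_square)
  finally show ?thesis by (simp add: q_def C_def)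
qed

lemma (in prob_space) linear_form_tail:
  fixes \<epsilon> :: "nat \<Rightarrow> 'a \<Rightarrow> real"
  assumes n: "0 < n" and ind: "indep_vars (\<lambda>_. borel) \<epsilon> {..<n}" and m: "1 \<le> m"
    and mean: "\<And>i. i < n \<Longrightarrow> expectation (\<epsilon> i) = 0"
    and int4: "\<And>i. i < n \<Longrightarrow> integrable M (\<lambda>\<omega>. (\<epsilon> i \<omega>) ^ 4)"
    and mom4: "\<And>i. i < n \<Longrightarrow> expectation (\<lambda>\<omega>. (\<epsilon> i \<omega>) ^ 4) \<le> m"
    and c: "(\<Sum>i<n. (c i)\<^sup>2) \<le> K * real n" and x: "0 < x"
  shows "prob {\<omega> \<in> space M. real n * x \<le> \<bar>\<Sum>i<n. c i * \<epsilon> i \<omega>\<bar>}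
    \<le> 3 * m\<^sup>2 * K\<^sup>2 / x ^ 4 * real n powr (- 2)"
proof -
  define L where "L \<omega> = (\<Sum>i<n. c i * \<epsilon> i \<omega>)" for \<omega>
  have em[measurable]: "\<epsilon> i \<in> borel_measurable M" if "i < n" for i
    using ind that by (auto simp: indep_vars_def)
  have [measurable]: "L \<in> borel_measurable M" unfolding L_def by auto
  have L: "integrable M (\<lambda>\<omega>. (L \<omega>) ^ 4)" "expectation (\<lambda>\<omega>. (L \<omega>) ^ 4) \<le> 3 * m\<^sup>2 * (\<Sum>i<n. (c i)\<^sup>2)\<^sup>2"
    using linear_form_moments[OF ind m mean int4 mom4, of n c] by (auto simp: L_def)
  have "{\<omega> \<in> space M. real n * x \<le> \<bar>L \<omega>\<bar>} \<subseteq> {\<omega> \<in> space M. (real n * x) ^ 4 \<le> (L \<omega>) ^ 4}"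
  proof safe
    fix \<omega> assume "real n * x \<le> \<bar>L \<omega>\<bar>"
    then have "(real n * x) ^ 4 \<le> \<bar>L \<omega>\<bar> ^ 4" using x by (intro power_mono) auto
    then show "(real n * x) ^ 4 \<le> (L \<omega>) ^ 4" by simp
  qed
  then have "prob {\<omega> \<in> space M. real n * x \<le> \<bar>L \<omega>\<bar>} \<le> prob {\<omega> \<in> space M. (real n * x) ^ 4 \<le> (L \<omega>) ^ 4}"
    by (intro finite_measure_mono) auto
  also have "\<dots> \<le> expectation (\<lambda>\<omega>. (L \<omega>) ^ 4) / (real n * x) ^ 4"
    using n x L by (intro integral_Markov_inequality_measure[where A = "{}"]) auto
  also have "\<dots> \<le> (3 * m\<^sup>2 * (K * real n)\<^sup>2) / (real n * x) ^ 4"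
  proof (intro divide_right_mono)
    have "(\<Sum>i<n. (c i)\<^sup>2)\<^sup>2 \<le> (K * real n)\<^sup>2" using c by (intro power_mono) (auto simp: sum_nonneg)
    then have "3 * m\<^sup>2 * (\<Sum>i<n. (c i)\<^sup>2)\<^sup>2 \<le> 3 * m\<^sup>2 * (K * real n)\<^sup>2" by (intro mult_left_mono) auto
    then show "expectation (\<lambda>\<omega>. (L \<omega>) ^ 4) \<le> 3 * m\<^sup>2 * (K * real n)\<^sup>2" using L by linarith
  qed auto
  also have "\<dots> = 3 * m\<^sup>2 * K\<^sup>2 / x ^ 4 * real n powr (- 2)"
    using n x by (simp add: powr_minus powr_numeral divide_simps power2_eq_square power4_eq_xxxx)
  finally show ?thesis by (simp add: L_def)
qed

section \<open>The residual matrix of ridge regression\<close>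

lemma scalar_prod_self_nonneg: "0 \<le> v \<bullet> (v :: real vec)"
  by (simp add: scalar_prod_def sum_nonneg)

lemma scalar_prod_self_eq_0:
  assumes "v \<in> carrier_vec n" "v \<bullet> (v :: real vec) = 0"
  shows "v = 0\<^sub>v n"
proof (rule eq_vecI)
  fix i assume "i < dim_vec (0\<^sub>v n :: real vec)"
  then have i: "i < n" by simp
  have "(\<Sum>k\<in>{0..<n}. v $ k * v $ k) = 0" using assms by (simp add: scalar_prod_def)
  then have "\<forall>k\<in>{0..<n}. v $ k * v $ k = 0" by (subst (asm) sum_nonneg_eq_0_iff) auto
  then show "v $ i = 0\<^sub>v n $ i" using i by simp
qed (use assms in simp)

lemma scalar_prod_le_mean_sq:
  fixes v w :: "real vec"
  assumes "v \<in> carrier_vec n" "w \<in> carrier_vec n"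
  shows "2 * (v \<bullet> w) \<le> v \<bullet> v + w \<bullet> w"
proof -
  have "0 \<le> (\<Sum>i\<in>{0..<n}. (v $ i - w $ i)\<^sup>2)" by (intro sum_nonneg) auto
  also have "\<dots> = v \<bullet> v + w \<bullet> w - 2 * (v \<bullet> w)"
    using assms by (simp add: scalar_prod_def power2_diff sum.distrib sum_subtractf sum_distrib_left
        power2_eq_square[symmetric] mult.assoc)
  finally show ?thesis by simp
qed

lemma quadratic_form_sum:
  fixes B :: "real mat"
  assumes "B \<in> carrier_mat n n" "v \<in> carrier_vec n"
  shows "v \<bullet> (B *\<^sub>v v) = (\<Sum>i<n. \<Sum>j<n. B $$ (i, j) * v $ i * v $ j)"
  using assms by (simp add: scalar_prod_def atLeast0LessThan sum_distrib_left mult_ac)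

lemma transpose_smult: "(c \<cdot>\<^sub>m (A :: real mat))\<^sup>T = c \<cdot>\<^sub>m A\<^sup>T"
  by (intro eq_matI) auto

lemma smult_one_mult_vec:
  assumes "v \<in> carrier_vec n"
  shows "(c \<cdot>\<^sub>m 1\<^sub>m n) *\<^sub>v v = c \<cdot>\<^sub>v (v :: real vec)"
  using assms by (intro eq_vecI) auto

lemma mult_unit_vec_index:
  fixes B :: "real mat"
  assumes "B \<in> carrier_mat n m" "i < m" "j < n"
  shows "(B *\<^sub>v unit_vec m i) $ j = B $$ (j, i)"
  using assms by simp

lemma mat_trace_mult_comm:
  fixes A B :: "real mat"
  assumes "A \<in> carrier_mat n p" "B \<in> carrier_mat p n"
  shows "mat_trace (A * B) = mat_trace (B * A)"
proof -
  have "mat_trace (A * B) = (\<Sum>i<n. \<Sum>j<p. A $$ (i, j) * B $$ (j, i))"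
    using assms by (simp add: mat_trace_def scalar_prod_def atLeast0LessThan)
  also have "\<dots> = (\<Sum>j<p. \<Sum>i<n. B $$ (j, i) * A $$ (i, j))"
    by (subst sum.swap) (simp add: mult.commute)
  also have "\<dots> = mat_trace (B * A)"
    using assms by (simp add: mat_trace_def scalar_prod_def atLeast0LessThan)
  finally show ?thesis .
qed

lemma mat_trace_minus:
  assumes "A \<in> carrier_mat n n" "B \<in> carrier_mat n n"
  shows "mat_trace (A - B) = mat_trace A - mat_trace B"
  using assms by (simp add: mat_trace_def sum_subtractf)

lemma mat_trace_smult:
  assumes "A \<in> carrier_mat n n"
  shows "mat_trace (c \<cdot>\<^sub>m A) = c * mat_trace A"
  using assms by (simp add: mat_trace_def sum_distrib_left)

context
  fixes lam :: real and n p :: nat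
  assumes lam: "lam > 0"
begin

lemma gram_shift_mult_vec:
  fixes A :: "real mat"
  assumes A: "A \<in> carrier_mat n p" and v: "v \<in> carrier_vec p"
  shows "(A\<^sup>T * A + lam \<cdot>\<^sub>m 1\<^sub>m p) *\<^sub>v v = A\<^sup>T *\<^sub>v (A *\<^sub>v v) + lam \<cdot>\<^sub>v v"
proof -
  have "(A\<^sup>T * A + lam \<cdot>\<^sub>m 1\<^sub>m p) *\<^sub>v v = (A\<^sup>T * A) *\<^sub>v v + (lam \<cdot>\<^sub>m 1\<^sub>m p) *\<^sub>v v"
    using A v by (intro add_mult_distrib_mat_vec[of _ p p]) auto
  also have "(A\<^sup>T * A) *\<^sub>v v = A\<^sup>T *\<^sub>v (A *\<^sub>v v)"
    using A v by (intro assoc_mult_mat_vec[of _ p n _ p]) auto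
  also have "(lam \<cdot>\<^sub>m 1\<^sub>m p) *\<^sub>v v = lam \<cdot>\<^sub>v v"
    using v by (simp add: smult_one_mult_vec)
  finally show ?thesis .
qed

lemma gram_shift_det_nonzero:
  fixes A :: "real mat"
  assumes A: "A \<in> carrier_mat n p"
  shows "det (A\<^sup>T * A + lam \<cdot>\<^sub>m 1\<^sub>m p) \<noteq> 0"
proof
  let ?B = "A\<^sup>T * A + lam \<cdot>\<^sub>m 1\<^sub>m p"
  have B: "?B \<in> carrier_mat p p" using A by auto
  assume "det ?B = 0"
  then obtain v where v: "v \<in> carrier_vec p" "v \<noteq> 0\<^sub>v p" and Bv: "?B *\<^sub>v v = 0\<^sub>v p"
    using det_0_iff_vec_prod_zero[OF B] by auto
  have "0 = v \<bullet> (A\<^sup>T *\<^sub>v (A *\<^sub>v v) + lam \<cdot>\<^sub>v v)"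
    using Bv v gram_shift_mult_vec[OF A v(1)] by simp
  also have "\<dots> = v \<bullet> (A\<^sup>T *\<^sub>v (A *\<^sub>v v)) + lam * (v \<bullet> v)"
    using A v by (subst scalar_prod_add_distrib[of _ p]) auto
  also have "v \<bullet> (A\<^sup>T *\<^sub>v (A *\<^sub>v v)) = (A *\<^sub>v v) \<bullet> (A *\<^sub>v v)"
    using transpose_vec_mult_scalar[of A n p v "A *\<^sub>v v"] A v
    by (simp add: comm_scalar_prod[of v p "A\<^sup>T *\<^sub>v (A *\<^sub>v v)"])
  finally have "lam * (v \<bullet> v) = - ((A *\<^sub>v v) \<bullet> (A *\<^sub>v v))" by simp
  then have "lam * (v \<bullet> v) \<le> 0" using scalar_prod_self_nonneg[of "A *\<^sub>v v"] by simp
  then have "v \<bullet> v = 0" using lam scalar_prod_self_nonneg[of v] by (simp add: mult_le_0_iff)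
  with v scalar_prod_self_eq_0[of v p] show False by simp
qed

text \<open>Cramer's rule exhibits the entries of the inverse as rational functions of the design, hence as
measurable functions.\<close>

lemma ridge_inv_adj:
  fixes A :: "real mat"
  assumes A: "A \<in> carrier_mat n p"
  defines "B \<equiv> A\<^sup>T * A + lam \<cdot>\<^sub>m 1\<^sub>m p"
  shows "ridge_inv lam A = inverse (det B) \<cdot>\<^sub>m adj_mat B"
    and "ridge_inv lam A \<in> carrier_mat p p"
    and "B * ridge_inv lam A = 1\<^sub>m p"
proof -
  have B: "B \<in> carrier_mat p p" using A by (auto simp: B_def)
  have d: "det B \<noteq> 0" unfolding B_def by (rule gram_shift_det_nonzero[OF A])
  note adj = adj_mat[OF B]
  have 1: "B * (inverse (det B) \<cdot>\<^sub>m adj_mat B) = 1\<^sub>m p"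
    using d by (intro eq_matI) (auto simp: mult_smult_distrib[OF B adj(1)] adj(2))
  have 2: "(inverse (det B) \<cdot>\<^sub>m adj_mat B) * B = 1\<^sub>m p"
    using d by (intro eq_matI) (auto simp: mult_smult_assoc_mat[OF adj(1) B] adj(3))
  show *: "ridge_inv lam A = inverse (det B) \<cdot>\<^sub>m adj_mat B"
    using mat_inv_eqI[OF B _ 1 2] adj(1) A unfolding ridge_inv_def B_def by auto
  show "ridge_inv lam A \<in> carrier_mat p p" unfolding * using adj by simp
  show "B * ridge_inv lam A = 1\<^sub>m p" unfolding * by (rule 1)
qed

end

text \<open>The matrix that maps the response to the residuals of ridge regression. It equals
\<open>\<lambda> (A A\<^sup>T + \<lambda>)\<^sup>-\<^sup>1\<close>, by \<open>resid_mat_eq\<close> and \<open>resid_mat_unique\<close> below.\<close>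

definition resid_mat :: "real \<Rightarrow> real mat \<Rightarrow> real mat" where
  "resid_mat lam A = 1\<^sub>m (dim_row A) - ridge_smoother lam A"

context
  fixes lam :: real and n p :: nat and A :: "real mat"
  assumes lam: "lam > 0" and A: "A \<in> carrier_mat n p"
begin

lemma ridge_inv_sym: "(ridge_inv lam A)\<^sup>T = ridge_inv lam A"
proof -
  define B where "B = A\<^sup>T * A + lam \<cdot>\<^sub>m 1\<^sub>m p"
  define P where "P = ridge_inv lam A"
  have B: "B \<in> carrier_mat p p" using A by (auto simp: B_def)
  have P: "P \<in> carrier_mat p p" and BP: "B * P = 1\<^sub>m p"
    using ridge_inv_adj[OF lam A] by (auto simp: B_def P_def)
  have Bt: "B\<^sup>T = B"
    unfolding B_def using A
    by (subst transpose_add[of _ p p]) (auto simp: transpose_mult[of _ p n _ p] transpose_smult)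
  have "P\<^sup>T * B = (B * P)\<^sup>T" using B P by (subst transpose_mult[OF B P]) (simp add: Bt)
  then have PtB: "P\<^sup>T * B = 1\<^sub>m p" using BP by simp
  have "P\<^sup>T = P\<^sup>T * (B * P)" using P BP by simp
  also have "\<dots> = (P\<^sup>T * B) * P" using B P by (simp add: assoc_mult_mat[of _ p p _ p _ p])
  finally show ?thesis using P PtB by (simp add: P_def)
qed

lemma resid_mat_carrier: "resid_mat lam A \<in> carrier_mat n n"
  using A ridge_inv_adj[OF lam A] by (auto simp: resid_mat_def ridge_smoother_def)

lemma resid_mat_sym: "(resid_mat lam A)\<^sup>T = resid_mat lam A"
proof -
  define P where "P = ridge_inv lam A"
  have P: "P \<in> carrier_mat p p" using ridge_inv_adj[OF lam A] by (auto simp: P_def)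
  have "(A * P * A\<^sup>T)\<^sup>T = A * (P\<^sup>T * A\<^sup>T)"
    using A P by (simp add: transpose_mult[of _ n p _ n] transpose_mult[of _ p p _ n])
  also have "\<dots> = A * P * A\<^sup>T" using A P by (simp add: P_def ridge_inv_sym)
  finally show ?thesis
    using A P by (simp add: resid_mat_def ridge_smoother_def P_def[symmetric] transpose_minus[of _ n n])
qed

text \<open>The reason is the commutation \<open>(A A\<^sup>T + \<lambda>) A = A (A\<^sup>T A + \<lambda>)\<close>.\<close>

lemma resid_mat_eq: "(A * A\<^sup>T + lam \<cdot>\<^sub>m 1\<^sub>m n) * resid_mat lam A = lam \<cdot>\<^sub>m 1\<^sub>m n"
proof -
  define B where "B = A\<^sup>T * A + lam \<cdot>\<^sub>m 1\<^sub>m p"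
  define C where "C = A * A\<^sup>T + lam \<cdot>\<^sub>m 1\<^sub>m n"
  define P where "P = ridge_inv lam A"
  have B: "B \<in> carrier_mat p p" and C: "C \<in> carrier_mat n n" and At: "A\<^sup>T \<in> carrier_mat p n"
    using A by (auto simp: B_def C_def)
  have P: "P \<in> carrier_mat p p" and BP: "B * P = 1\<^sub>m p"
    using ridge_inv_adj[OF lam A] by (auto simp: B_def P_def)
  have "C * A = A * A\<^sup>T * A + lam \<cdot>\<^sub>m A"
    unfolding C_def using A
    by (subst add_mult_distrib_mat[of _ n n _ _ p]) (auto simp: mult_smult_assoc_mat[of _ n n _ p])
  also have "\<dots> = A * B"
    unfolding B_def using A
    by (subst mult_add_distrib_mat[of _ n p _ p]) (auto simp: mult_smult_distrib[of _ n p _ p])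
  finally have CA: "C * A = A * B" .
  have "C * (A * P * A\<^sup>T) = (C * A) * P * A\<^sup>T"
    using A B C P At by (simp add: assoc_mult_mat[of _ n n _ p _ p] assoc_mult_mat[of _ n n _ p _ n]
        assoc_mult_mat[of _ n p _ p _ n] assoc_mult_mat[of _ n p _ p _ p])
  also have "\<dots> = A * (B * P) * A\<^sup>T"
    unfolding CA using A B P by (simp add: assoc_mult_mat[of _ n p _ p _ p])
  also have "\<dots> = A * A\<^sup>T" using A BP by simp
  finally have CS: "C * (A * P * A\<^sup>T) = A * A\<^sup>T" .
  have "C * resid_mat lam A = C * 1\<^sub>m n - C * (A * P * A\<^sup>T)"
    using A C P by (simp add: resid_mat_def ridge_smoother_def P_def[symmetric]
        mult_minus_distrib_mat[of _ n n _ n])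
  also have "\<dots> = C - A * A\<^sup>T" using C CS by simp
  also have "\<dots> = lam \<cdot>\<^sub>m 1\<^sub>m n" unfolding C_def using A by (intro eq_matI) auto
  finally show ?thesis by (simp add: C_def)
qed

lemma resid_mat_eq': "resid_mat lam A * (A * A\<^sup>T) = lam \<cdot>\<^sub>m 1\<^sub>m n - lam \<cdot>\<^sub>m resid_mat lam A"
proof -
  let ?R = "resid_mat lam A"
  note R = resid_mat_carrier
  have AAt: "(A * A\<^sup>T)\<^sup>T = A * A\<^sup>T" using A by (simp add: transpose_mult[of _ n p _ n])
  have Ct: "(A * A\<^sup>T + lam \<cdot>\<^sub>m 1\<^sub>m n)\<^sup>T = A * A\<^sup>T + lam \<cdot>\<^sub>m 1\<^sub>m n"
    using A by (subst transpose_add[of _ n n]) (auto simp: AAt transpose_smult)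
  have "?R * (A * A\<^sup>T + lam \<cdot>\<^sub>m 1\<^sub>m n) = ((A * A\<^sup>T + lam \<cdot>\<^sub>m 1\<^sub>m n) * ?R)\<^sup>T"
    using A R by (subst transpose_mult[of _ n n _ n]) (auto simp: Ct resid_mat_sym)
  also have "\<dots> = lam \<cdot>\<^sub>m 1\<^sub>m n" by (simp add: resid_mat_eq transpose_smult)
  finally have "?R * (A * A\<^sup>T) + lam \<cdot>\<^sub>m ?R = lam \<cdot>\<^sub>m 1\<^sub>m n"
    using A R by (subst (asm) mult_add_distrib_mat[of _ n n _ n])
      (auto simp: mult_smult_distrib[of _ n n _ n])
  then have "lam \<cdot>\<^sub>m 1\<^sub>m n - lam \<cdot>\<^sub>m ?R = (?R * (A * A\<^sup>T) + lam \<cdot>\<^sub>m ?R) - lam \<cdot>\<^sub>m ?R" by simp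
  also have "\<dots> = ?R * (A * A\<^sup>T)" using A R by (intro eq_matI) auto
  finally show ?thesis by simp
qed

lemma resid_mat_unique:
  assumes Y: "Y \<in> carrier_mat n n" and eq: "(A * A\<^sup>T + lam \<cdot>\<^sub>m 1\<^sub>m n) * Y = lam \<cdot>\<^sub>m 1\<^sub>m n"
  shows "resid_mat lam A = Y"
proof -
  let ?C = "A * A\<^sup>T + lam \<cdot>\<^sub>m 1\<^sub>m n"
  have C: "?C \<in> carrier_mat n n" using A by auto
  have d: "det ?C \<noteq> 0" using gram_shift_det_nonzero[OF lam, of "A\<^sup>T" p n] A by simp
  note adj = adj_mat[OF C]
  have key: "det ?C \<cdot>\<^sub>m Z = adj_mat ?C * (lam \<cdot>\<^sub>m 1\<^sub>m n)"
    if "Z \<in> carrier_mat n n" "?C * Z = lam \<cdot>\<^sub>m 1\<^sub>m n" for Z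
  proof -
    have "adj_mat ?C * (?C * Z) = det ?C \<cdot>\<^sub>m Z"
      using that(1) C adj(1,3) by (simp add: assoc_mult_mat[of _ n n _ n _ n, symmetric] mult_smult_assoc_mat[of _ n n _ n])
    then show ?thesis using that by simp
  qed
  have "det ?C \<cdot>\<^sub>m resid_mat lam A = det ?C \<cdot>\<^sub>m Y"
    using key[OF resid_mat_carrier resid_mat_eq] key[OF Y eq] by simp
  then have "det ?C * resid_mat lam A $$ (i, j) = det ?C * Y $$ (i, j)" if "i < n" "j < n" for i j
    using that Y resid_mat_carrier by (metis carrier_matD index_smult_mat(1))
  then show ?thesis using d Y resid_mat_carrier by (intro eq_matI) auto
qed

text \<open>Pairing \<open>(A A\<^sup>T + \<lambda>) w = \<lambda> v\<close> with \<open>w\<close> gives \<open>|A\<^sup>T w|\<^sup>2 + \<lambda> |w|\<^sup>2 = \<lambda> (v \<bullet> w)\<close>, and the right hand side is at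
most \<open>\<lambda> (|v|\<^sup>2 + |w|\<^sup>2) / 2\<close>. The bounds do not involve the singular values of \<open>A\<close>; that is what
allows conditioning on the design.\<close>

lemma resid_mat_energy:
  assumes v: "v \<in> carrier_vec n"
  defines "w \<equiv> resid_mat lam A *\<^sub>v v"
  shows "w \<bullet> w \<le> v \<bullet> v" and "(A\<^sup>T *\<^sub>v w) \<bullet> (A\<^sup>T *\<^sub>v w) \<le> lam / 2 * (v \<bullet> v)"
proof -
  note R = resid_mat_carrier
  have w: "w \<in> carrier_vec n" using R v by (simp add: w_def)
  have "A *\<^sub>v (A\<^sup>T *\<^sub>v w) + lam \<cdot>\<^sub>v w = (A * A\<^sup>T + lam \<cdot>\<^sub>m 1\<^sub>m n) *\<^sub>v w"
    using gram_shift_mult_vec[OF lam, of "A\<^sup>T" p n w] A w by simp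
  also have "\<dots> = ((A * A\<^sup>T + lam \<cdot>\<^sub>m 1\<^sub>m n) * resid_mat lam A) *\<^sub>v v"
    unfolding w_def using A R v by (subst assoc_mult_mat_vec[of _ n n _ n]) auto
  also have "\<dots> = lam \<cdot>\<^sub>v v"
    using v by (simp add: resid_mat_eq smult_one_mult_vec)
  finally have eq: "A *\<^sub>v (A\<^sup>T *\<^sub>v w) + lam \<cdot>\<^sub>v w = lam \<cdot>\<^sub>v v" .
  have "w \<bullet> (A *\<^sub>v (A\<^sup>T *\<^sub>v w) + lam \<cdot>\<^sub>v w) = (A\<^sup>T *\<^sub>v w) \<bullet> (A\<^sup>T *\<^sub>v w) + lam * (w \<bullet> w)"
    using A w transpose_vec_mult_scalar[of A n p "A\<^sup>T *\<^sub>v w" w]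
    by (subst scalar_prod_add_distrib[of _ n]) auto
  then have e: "(A\<^sup>T *\<^sub>v w) \<bullet> (A\<^sup>T *\<^sub>v w) + lam * (w \<bullet> w) = lam * (v \<bullet> w)"
    unfolding eq using v w by (simp add: comm_scalar_prod[of v n w])
  have "lam * (2 * (v \<bullet> w)) \<le> lam * (v \<bullet> v + w \<bullet> w)"
    using scalar_prod_le_mean_sq[OF v w] lam by (intro mult_left_mono) auto
  then have b: "2 * ((A\<^sup>T *\<^sub>v w) \<bullet> (A\<^sup>T *\<^sub>v w)) + lam * (w \<bullet> w) \<le> lam * (v \<bullet> v)"
    using e by (simp add: algebra_simps)
  have "lam * (w \<bullet> w) \<le> lam * (v \<bullet> v)"
    using b scalar_prod_self_nonneg[of "A\<^sup>T *\<^sub>v w"] by linarith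
  then show "w \<bullet> w \<le> v \<bullet> v" using lam by simp
  have "0 \<le> lam * (w \<bullet> w)" using lam scalar_prod_self_nonneg[of w] by simp
  then show "(A\<^sup>T *\<^sub>v w) \<bullet> (A\<^sup>T *\<^sub>v w) \<le> lam / 2 * (v \<bullet> v)" using b by simp
qed

text \<open>Dual to the second bound above: \<open>R A\<close> is the transpose of \<open>A\<^sup>T R\<close>, so it has the same norm.\<close>

lemma resid_mat_design_energy:
  assumes b: "b \<in> carrier_vec p"
  defines "z \<equiv> resid_mat lam A *\<^sub>v (A *\<^sub>v b)"
  shows "z \<bullet> z \<le> lam / 2 * (b \<bullet> b)"
proof -
  let ?R = "resid_mat lam A"
  note R = resid_mat_carrier
  have z: "z \<in> carrier_vec n" using R A b by (simp add: z_def)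
  define x where "x = A\<^sup>T *\<^sub>v (?R *\<^sub>v z)"
  have x: "x \<in> carrier_vec p" using A R z by (simp add: x_def)
  have "z \<bullet> z = (?R *\<^sub>v z) \<bullet> (A *\<^sub>v b)"
    using transpose_vec_mult_scalar[OF R _ z, of "A *\<^sub>v b"] A b by (simp add: resid_mat_sym z_def)
  also have "\<dots> = x \<bullet> b"
    unfolding x_def using A b R z by (intro transpose_vec_mult_scalar[symmetric]) auto
  finally have zz: "z \<bullet> z = x \<bullet> b" .
  \<comment> \<open>The weight \<open>lam / 2\<close> on \<open>b\<close> balances the two squares, so that half of \<open>z \<bullet> z\<close> can be absorbed.\<close>
  have "2 * (x \<bullet> ((lam / 2) \<cdot>\<^sub>v b)) \<le> x \<bullet> x + ((lam / 2) \<cdot>\<^sub>v b) \<bullet> ((lam / 2) \<cdot>\<^sub>v b)"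
    using x b by (intro scalar_prod_le_mean_sq) auto
  also have "x \<bullet> x \<le> lam / 2 * (z \<bullet> z)" unfolding x_def by (rule resid_mat_energy(2)[OF z])
  finally have "lam * (z \<bullet> z) \<le> lam / 2 * (z \<bullet> z) + lam / 2 * (lam / 2 * (b \<bullet> b))"
    using x b by (simp add: zz)
  then have "lam / 2 * (z \<bullet> z) \<le> lam / 2 * (lam / 2 * (b \<bullet> b))" by simp
  then show ?thesis using lam by simp
qed

end

text \<open>The sum of squared residuals when the response is the noiseless signal \<open>A b\<close>.\<close>

definition signal_energy :: "real \<Rightarrow> real mat \<Rightarrow> real vec \<Rightarrow> real" where
  "signal_energy lam A b =
    (resid_mat lam A *\<^sub>v (A *\<^sub>v b)) \<bullet> (resid_mat lam A *\<^sub>v (A *\<^sub>v b))"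

text \<open>The trace of \<open>A\<^sup>T R\<^sup>2 A\<close>, as the third clause of \<open>signal_entries\<close> shows. In this form it
depends on \<open>A\<close> through the residual matrix alone, which makes its invariance under rotations evident.\<close>

definition signal_trace :: "real \<Rightarrow> real mat \<Rightarrow> real" where
  "signal_trace lam A = lam * (mat_trace (resid_mat lam A) - mat_trace (resid_mat lam A * resid_mat lam A))"

context
  fixes lam :: real and n p :: nat and A :: "real mat"
  assumes lam: "lam > 0" and A: "A \<in> carrier_mat n p"
begin

text \<open>The residual matrix sees the design only through \<open>A A\<^sup>T\<close>.\<close>

lemma resid_mat_orth:
  assumes U: "orth_mat p U"
  shows "resid_mat lam (A * U) = resid_mat lam A"
proof -
  have Uc: "U \<in> carrier_mat p p" and UtU: "U\<^sup>T * U = 1\<^sub>m p" using U by (auto simp: orth_mat_def)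
  have UUt: "U * U\<^sup>T = 1\<^sub>m p" using mat_mult_left_right_inverse[of "U\<^sup>T" p U] Uc UtU by simp
  have "(A * U) * (A * U)\<^sup>T = A * U * (U\<^sup>T * A\<^sup>T)" using A Uc by (simp add: transpose_mult[of _ n p _ p])
  also have "\<dots> = A * (U * U\<^sup>T) * A\<^sup>T"
    using A Uc by (simp add: assoc_mult_mat[of _ n p _ p _ n] assoc_mult_mat[of _ n p _ p _ p]
        assoc_mult_mat[of _ p p _ p _ n])
  also have "\<dots> = A * A\<^sup>T" using A UUt by simp
  finally have eq: "(A * U) * (A * U)\<^sup>T = A * A\<^sup>T" .
  have AU: "A * U \<in> carrier_mat n p" using A Uc by simp
  show ?thesis
    using resid_mat_unique[OF lam AU resid_mat_carrier[OF lam A]] resid_mat_eq[OF lam A] by (simp add: eq)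
qed

text \<open>The noise energy as a quadratic form, in the shape required by \<open>quadratic_form_tail\<close>.\<close>

lemma resid_sq_entries:
  defines "a \<equiv> \<lambda>i j. (resid_mat lam A * resid_mat lam A) $$ (i, j)"
  shows "i < n \<Longrightarrow> j < n \<Longrightarrow> a i j = a j i"
    and "i < n \<Longrightarrow> (\<Sum>j<n. (a i j)\<^sup>2) \<le> 1"
    and "(\<Sum>i<n. a i i) = mat_trace (resid_mat lam A * resid_mat lam A)"
    and "e \<in> carrier_vec n \<Longrightarrow> (resid_mat lam A *\<^sub>v e) \<bullet> (resid_mat lam A *\<^sub>v e)
      = (\<Sum>i<n. \<Sum>j<n. a i j * e $ i * e $ j)"
proof -
  let ?R = "resid_mat lam A"
  note R = resid_mat_carrier[OF lam A] and Rt = resid_mat_sym[OF lam A]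
  have RR: "?R * ?R \<in> carrier_mat n n" using R by simp
  have RRt: "(?R * ?R)\<^sup>T = ?R * ?R" using R by (simp add: transpose_mult[of _ n n _ n] Rt)
  show sym: "a i j = a j i" if "i < n" "j < n" for i j
    using arg_cong[OF RRt, of "\<lambda>B. B $$ (j, i)"] that R by (simp add: a_def)
  show "(\<Sum>j<n. (a i j)\<^sup>2) \<le> 1" if i: "i < n"
  proof -
    define w where "w = ?R *\<^sub>v (?R *\<^sub>v unit_vec n i)"
    have w: "w = (?R * ?R) *\<^sub>v unit_vec n i" using R by (simp add: w_def assoc_mult_mat_vec[of _ n n _ n])
    have wj: "w $ j = a i j" if "j < n" for j
      unfolding w using mult_unit_vec_index[OF RR i that] sym[OF i that] by (simp only: a_def)
    have wc: "w \<in> carrier_vec n" using R by (simp add: w_def)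
    have "(\<Sum>j<n. (a i j)\<^sup>2) = w \<bullet> w"
      using wc wj by (simp add: scalar_prod_def atLeast0LessThan power2_eq_square)
    also have "\<dots> \<le> (?R *\<^sub>v unit_vec n i) \<bullet> (?R *\<^sub>v unit_vec n i)"
      unfolding w_def using R by (intro resid_mat_energy(1)[OF lam A]) auto
    also have "\<dots> \<le> unit_vec n i \<bullet> unit_vec n i"
      by (intro resid_mat_energy(1)[OF lam A]) auto
    also have "\<dots> = 1" using i by simp
    finally show ?thesis .
  qed
  show "(\<Sum>i<n. a i i) = mat_trace (?R * ?R)" using R by (simp add: a_def mat_trace_def)
  show "(?R *\<^sub>v e) \<bullet> (?R *\<^sub>v e) = (\<Sum>i<n. \<Sum>j<n. a i j * e $ i * e $ j)" if e: "e \<in> carrier_vec n"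
  proof -
    have "(?R *\<^sub>v e) \<bullet> (?R *\<^sub>v e) = e \<bullet> (?R *\<^sub>v (?R *\<^sub>v e))"
      using transpose_vec_mult_scalar[OF R _ e, of "?R *\<^sub>v e"] R e by (simp add: Rt)
    also have "?R *\<^sub>v (?R *\<^sub>v e) = (?R * ?R) *\<^sub>v e" using R e by (simp add: assoc_mult_mat_vec[of _ n n _ n])
    finally show ?thesis using quadratic_form_sum[OF RR e] by (simp add: a_def)
  qed
qed

text \<open>For a fixed design and a fixed signal the cross term is a linear form in the noise.\<close>

lemma resid_cross_sum:
  assumes e: "e \<in> carrier_vec n" and b: "b \<in> carrier_vec p"
  defines "c \<equiv> resid_mat lam A *\<^sub>v (resid_mat lam A *\<^sub>v (A *\<^sub>v b))"
  shows "(resid_mat lam A *\<^sub>v e) \<bullet> (resid_mat lam A *\<^sub>v (A *\<^sub>v b)) = (\<Sum>i<n. c $ i * e $ i)"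
    and "(\<Sum>i<n. (c $ i)\<^sup>2) \<le> lam / 2 * (b \<bullet> b)"
proof -
  let ?R = "resid_mat lam A"
  note R = resid_mat_carrier[OF lam A] and Rt = resid_mat_sym[OF lam A]
  have c: "c \<in> carrier_vec n" and z: "?R *\<^sub>v (A *\<^sub>v b) \<in> carrier_vec n"
    using R A b by (auto simp: c_def)
  have "(?R *\<^sub>v e) \<bullet> (?R *\<^sub>v (A *\<^sub>v b)) = e \<bullet> c"
    using transpose_vec_mult_scalar[OF R z e] by (simp add: Rt c_def)
  also have "\<dots> = (\<Sum>i<n. c $ i * e $ i)"
    using c e by (simp add: scalar_prod_def atLeast0LessThan mult.commute)
  finally show "(?R *\<^sub>v e) \<bullet> (?R *\<^sub>v (A *\<^sub>v b)) = (\<Sum>i<n. c $ i * e $ i)" .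
  have "(\<Sum>i<n. (c $ i)\<^sup>2) = c \<bullet> c"
    using c by (simp add: scalar_prod_def atLeast0LessThan power2_eq_square)
  also have "\<dots> \<le> (?R *\<^sub>v (A *\<^sub>v b)) \<bullet> (?R *\<^sub>v (A *\<^sub>v b))"
    unfolding c_def by (rule resid_mat_energy(1)[OF lam A z])
  also have "\<dots> \<le> lam / 2 * (b \<bullet> b)" by (rule resid_mat_design_energy[OF lam A b])
  finally show "(\<Sum>i<n. (c $ i)\<^sup>2) \<le> lam / 2 * (b \<bullet> b)" .
qed

text \<open>The matrix behind the signal energy is \<open>A\<^sup>T R\<^sup>2 A\<close>. Its norm is at most \<open>lam / 2\<close>, so dividing by \<open>lam\<close>
makes its rows short enough for \<open>quadratic_form_tail\<close>. Its trace is computed by moving \<open>A\<close> around and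
using \<open>R (A A\<^sup>T) = \<lambda> (1 - R)\<close>.\<close>

lemma signal_entries:
  shows "\<exists>a :: nat \<Rightarrow> nat \<Rightarrow> real.
    (\<forall>i<p. \<forall>j<p. a i j = a j i) \<and> (\<forall>i<p. (\<Sum>j<p. (a i j)\<^sup>2) \<le> 1) \<and>
    (\<Sum>i<p. a i i) = signal_trace lam A / lam \<and>
    (\<forall>b\<in>carrier_vec p. signal_energy lam A b / lam = (\<Sum>i<p. \<Sum>j<p. a i j * b $ i * b $ j))"
proof -
  let ?R = "resid_mat lam A"
  note R = resid_mat_carrier[OF lam A] and Rt = resid_mat_sym[OF lam A]
  define N where "N = ?R * A"
  have N: "N \<in> carrier_mat n p" using R A by (simp add: N_def)
  have Nt: "N\<^sup>T = A\<^sup>T * ?R" using R A by (simp add: N_def transpose_mult[of _ n n _ p] Rt)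
  define H where "H = N\<^sup>T * N"
  have H: "H \<in> carrier_mat p p" using N by (simp add: H_def)
  have Ht: "H\<^sup>T = H" using N by (simp add: H_def transpose_mult[of _ p n _ p])
  have Nv: "N *\<^sub>v b = ?R *\<^sub>v (A *\<^sub>v b)" if "b \<in> carrier_vec p" for b
    using that R A by (simp add: N_def assoc_mult_mat_vec[of _ n n _ p])
  have Hv: "H *\<^sub>v b = A\<^sup>T *\<^sub>v (?R *\<^sub>v (?R *\<^sub>v (A *\<^sub>v b)))" if b: "b \<in> carrier_vec p" for b
  proof -
    have "H *\<^sub>v b = N\<^sup>T *\<^sub>v (N *\<^sub>v b)"
      unfolding H_def using N b by (intro assoc_mult_mat_vec[of _ p n _ p]) auto
    also have "\<dots> = A\<^sup>T *\<^sub>v (?R *\<^sub>v (N *\<^sub>v b))"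
      unfolding Nt using R A N b by (intro assoc_mult_mat_vec[of _ p n _ n]) auto
    finally show ?thesis by (simp add: Nv[OF b])
  qed
  define a where "a i j = H $$ (i, j) / lam" for i j
  have sym: "a i j = a j i" if "i < p" "j < p" for i j
    using arg_cong[OF Ht, of "\<lambda>B. B $$ (j, i)"] that H by (simp add: a_def)
  have row: "(\<Sum>j<p. (a i j)\<^sup>2) \<le> 1" if i: "i < p" for i
  proof -
    define u :: "real vec" where "u = unit_vec p i"
    have u: "u \<in> carrier_vec p" by (simp add: u_def)
    define w where "w = H *\<^sub>v u"
    have wj: "w $ j = lam * a i j" if "j < p" for j
      using that i H sym[of i j] lam by (simp add: w_def u_def a_def)
    have wc: "w \<in> carrier_vec p" using H u by (simp add: w_def)
    have zc: "?R *\<^sub>v (A *\<^sub>v u) \<in> carrier_vec n" using R A u by simp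
    have "lam\<^sup>2 * (\<Sum>j<p. (a i j)\<^sup>2) = w \<bullet> w"
      using wc wj by (simp add: scalar_prod_def atLeast0LessThan power2_eq_square sum_distrib_left mult_ac)
    also have "\<dots> \<le> lam / 2 * ((?R *\<^sub>v (A *\<^sub>v u)) \<bullet> (?R *\<^sub>v (A *\<^sub>v u)))"
      unfolding w_def Hv[OF u] by (rule resid_mat_energy(2)[OF lam A zc])
    also have "\<dots> \<le> lam / 2 * (lam / 2 * (u \<bullet> u))"
      using lam by (intro mult_left_mono resid_mat_design_energy[OF lam A u]) auto
    also have "\<dots> \<le> lam\<^sup>2 * 1" using i by (simp add: u_def power2_eq_square)
    finally show ?thesis using lam by (simp add: mult_le_cancel_left)
  qed
  have diag: "(\<Sum>i<p. a i i) = signal_trace lam A / lam"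
  proof -
    have "lam * (\<Sum>i<p. a i i) = mat_trace H"
      using H lam by (simp add: mat_trace_def a_def sum_distrib_left)
    also have "\<dots> = mat_trace (N * N\<^sup>T)"
      unfolding H_def using N by (intro mat_trace_mult_comm[of _ p n]) auto
    also have "N * N\<^sup>T = ?R * ((?R * (A * A\<^sup>T))\<^sup>T)"
    proof -
      have "(?R * (A * A\<^sup>T))\<^sup>T = A * A\<^sup>T * ?R"
        using R A by (simp add: transpose_mult[of _ n n _ n] transpose_mult[of _ n p _ n] Rt)
      then show ?thesis
        unfolding Nt using R A by (simp add: N_def assoc_mult_mat[of _ n n _ p _ n] assoc_mult_mat[of _ n p _ n _ n])
    qed
    also have "(?R * (A * A\<^sup>T))\<^sup>T = lam \<cdot>\<^sub>m 1\<^sub>m n - lam \<cdot>\<^sub>m ?R"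
      unfolding resid_mat_eq'[OF lam A] using R
      by (subst transpose_minus[of _ n n]) (auto simp: transpose_smult Rt)
    also have "?R * (lam \<cdot>\<^sub>m 1\<^sub>m n - lam \<cdot>\<^sub>m ?R) = lam \<cdot>\<^sub>m ?R - lam \<cdot>\<^sub>m (?R * ?R)"
      using R by (subst mult_minus_distrib_mat[of _ n n _ n]) (auto simp: mult_smult_distrib[of _ n n _ n])
    also have "mat_trace \<dots> = signal_trace lam A"
      using R by (simp add: mat_trace_minus[of _ n] mat_trace_smult[of _ n] signal_trace_def right_diff_distrib)
    finally show ?thesis using lam by (simp add: field_simps)
  qed
  have quad: "signal_energy lam A b / lam = (\<Sum>i<p. \<Sum>j<p. a i j * b $ i * b $ j)"
    if b: "b \<in> carrier_vec p" for b
  proof -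
    have "signal_energy lam A b = (N *\<^sub>v b) \<bullet> (N *\<^sub>v b)" by (simp add: signal_energy_def Nv[OF b])
    also have "\<dots> = b \<bullet> (N\<^sup>T *\<^sub>v (N *\<^sub>v b))"
      using transpose_vec_mult_scalar[of N n p b "N *\<^sub>v b"] N b
      by (simp add: comm_scalar_prod[of b p])
    also have "N\<^sup>T *\<^sub>v (N *\<^sub>v b) = H *\<^sub>v b"
      unfolding H_def using N b by (intro assoc_mult_mat_vec[of _ p n _ p, symmetric]) auto
    also have "b \<bullet> (H *\<^sub>v b) = (\<Sum>i<p. \<Sum>j<p. H $$ (i, j) * b $ i * b $ j)"
      by (rule quadratic_form_sum[OF H b])
    finally show ?thesis by (simp add: a_def sum_divide_distrib)
  qed
  show ?thesis using sym row diag quad by blast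
qed

lemma signal_energy_smult:
  assumes b: "b \<in> carrier_vec p"
  shows "signal_energy lam A (c \<cdot>\<^sub>v b) = c\<^sup>2 * signal_energy lam A b"
proof -
  note R = resid_mat_carrier[OF lam A]
  have "resid_mat lam A *\<^sub>v (A *\<^sub>v (c \<cdot>\<^sub>v b)) = c \<cdot>\<^sub>v (resid_mat lam A *\<^sub>v (A *\<^sub>v b))"
    using A R b by (simp add: mult_mat_vec[of _ n p] mult_mat_vec[of _ n n])
  then show ?thesis by (simp add: signal_energy_def power2_eq_square mult.assoc)
qed

lemma signal_energy_orth:
  assumes U: "orth_mat p U" and b: "b \<in> carrier_vec p"
  shows "signal_energy lam (A * U) b = signal_energy lam A (U *\<^sub>v b)"
    and "signal_trace lam (A * U) = signal_trace lam A"
proof -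
  have "U \<in> carrier_mat p p" using U by (simp add: orth_mat_def)
  then have "(A * U) *\<^sub>v b = A *\<^sub>v (U *\<^sub>v b)" using A b by (intro assoc_mult_mat_vec[of _ n p _ p]) auto
  then show "signal_energy lam (A * U) b = signal_energy lam A (U *\<^sub>v b)"
    by (simp add: signal_energy_def resid_mat_orth[OF U])
  show "signal_trace lam (A * U) = signal_trace lam A"
    by (simp add: signal_trace_def resid_mat_orth[OF U])
qed

end

text \<open>The reflection in the hyperplane orthogonal to \<open>b - u\<close> (Householder).\<close>

lemma orth_mat_moves_vector:
  assumes b: "b \<in> carrier_vec p" and u: "u \<in> carrier_vec p" and eq: "u \<bullet> u = b \<bullet> b"
  obtains U where "orth_mat p U" "U *\<^sub>v u = b"
proof (cases "b = u")
  case True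
  then show ?thesis using that[of "1\<^sub>m p"] u by (simp add: orth_mat_def)
next
  case False
  define w where "w = b - u"
  have w: "w \<in> carrier_vec p" using b u by (simp add: w_def)
  have ww: "w \<bullet> w \<noteq> 0"
  proof
    assume "w \<bullet> w = 0"
    then have "w = 0\<^sub>v p" by (rule scalar_prod_self_eq_0[OF w])
    then have "b $ i = u $ i" if "i < p" for i
      using that b u by (metis carrier_vecD eq_iff_diff_eq_0 index_minus_vec(1) index_zero_vec(1) w_def)
    then show False using False b u by (auto intro: eq_vecI)
  qed
  define c where "c = 2 / (w \<bullet> w)"
  define U where "U = mat p p (\<lambda>(i, j). (if i = j then 1 else 0) - c * (w $ i * w $ j))"
  have U: "U \<in> carrier_mat p p" by (simp add: U_def)
  have W: "(\<Sum>k<p. w $ k * w $ k) = w \<bullet> w" using w by (simp add: scalar_prod_def atLeast0LessThan)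
  have WW: "(\<Sum>k<p. c\<^sup>2 * (x * y) * (w $ k * w $ k)) = c\<^sup>2 * (x * y) * (w \<bullet> w)" for x y
    by (simp only: sum_distrib_left[symmetric] W)
  have "U\<^sup>T * U = 1\<^sub>m p"
  proof (rule eq_matI)
    fix i j assume "i < dim_row (1\<^sub>m p :: real mat)" "j < dim_col (1\<^sub>m p :: real mat)"
    then have ij: "i < p" "j < p" by auto
    have "(U\<^sup>T * U) $$ (i, j) = (\<Sum>k<p. U $$ (k, i) * U $$ (k, j))"
      using ij U by (simp add: scalar_prod_def atLeast0LessThan)
    also have "\<dots> = (\<Sum>k<p. (if k = i then (if k = j then 1 else 0) else 0)
        - (if k = i then c * (w $ k * w $ j) else 0) - (if k = j then c * (w $ k * w $ i) else 0)
        + c\<^sup>2 * (w $ i * w $ j) * (w $ k * w $ k))"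
      using ij by (intro sum.cong) (auto simp: U_def power2_eq_square algebra_simps)
    also have "\<dots> = (if i = j then 1 else 0) - 2 * c * (w $ i * w $ j) + c\<^sup>2 * (w $ i * w $ j) * (w \<bullet> w)"
      using ij by (simp add: sum.distrib sum_subtractf WW)
    also have "c\<^sup>2 * (w $ i * w $ j) * (w \<bullet> w) = 2 * c * (w $ i * w $ j)"
      using ww by (simp add: c_def power2_eq_square)
    finally show "(U\<^sup>T * U) $$ (i, j) = 1\<^sub>m p $$ (i, j)" using ij by simp
  qed (use U in auto)
  then have orth: "orth_mat p U" using U by (simp add: orth_mat_def)
  have wu: "c * (w \<bullet> u) = -1"
  proof -
    have "w \<bullet> w = (b - u) \<bullet> b - (b - u) \<bullet> u"
      unfolding w_def using b u by (subst scalar_prod_minus_distrib[of _ p]) auto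
    also have "(b - u) \<bullet> b = b \<bullet> b - u \<bullet> b" using b u by (subst minus_scalar_prod_distrib[of _ p]) auto
    also have "u \<bullet> b = b \<bullet> u" using b u by (rule comm_scalar_prod[rotated])
    also have wu: "(b - u) \<bullet> u = b \<bullet> u - u \<bullet> u" using b u by (subst minus_scalar_prod_distrib[of _ p]) auto
    finally have "w \<bullet> w = - 2 * (w \<bullet> u)" using wu eq by (simp add: w_def)
    then show ?thesis using ww by (simp add: c_def field_simps)
  qed
  have "U *\<^sub>v u = b"
  proof (rule eq_vecI)
    fix i assume "i < dim_vec b"
    then have i: "i < p" using b by simp
    have "(U *\<^sub>v u) $ i = (\<Sum>k<p. U $$ (i, k) * u $ k)"
      using i U u by (simp add: scalar_prod_def atLeast0LessThan)
    also have "\<dots> = (\<Sum>k<p. (if k = i then u $ k else 0) - c * w $ i * (w $ k * u $ k))"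
      using i by (intro sum.cong) (auto simp: U_def algebra_simps)
    also have "\<dots> = u $ i - c * w $ i * (w \<bullet> u)"
      using i u by (simp add: sum_subtractf sum_distrib_left[symmetric] scalar_prod_def atLeast0LessThan)
    also have "\<dots> = u $ i - w $ i * (c * (w \<bullet> u))" by simp
    also have "\<dots> = b $ i" unfolding wu using i b u by (simp add: w_def)
    finally show "(U *\<^sub>v u) $ i = b $ i" .
  qed (use U b in auto)
  with orth show ?thesis by (rule that)
qed


context
  fixes n :: nat and Q :: "real mat"
  assumes Q: "orth_mat n Q"
begin

lemma orth_mat_conj_mult:
  assumes M: "B \<in> carrier_mat n n" and N: "C \<in> carrier_mat n n"
  shows "(Q\<^sup>T * B * Q) * (Q\<^sup>T * C * Q) = Q\<^sup>T * (B * C) * Q"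
proof -
  have Qc: "Q \<in> carrier_mat n n" and QtQ: "Q\<^sup>T * Q = 1\<^sub>m n" using Q by (auto simp: orth_mat_def)
  have QQt: "Q * Q\<^sup>T = 1\<^sub>m n" using mat_mult_left_right_inverse[of "Q\<^sup>T" n Q] Qc QtQ by simp
  have "(Q\<^sup>T * B * Q) * (Q\<^sup>T * C * Q) = Q\<^sup>T * B * ((Q * Q\<^sup>T) * C * Q)"
    using Qc M N by (simp add: assoc_mult_mat[of _ n n _ n _ n])
  also have "\<dots> = Q\<^sup>T * (B * C) * Q"
    unfolding QQt using Qc M N by (simp add: assoc_mult_mat[of _ n n _ n _ n])
  finally show ?thesis .
qed

lemma mat_trace_orth_conj:
  assumes M: "B \<in> carrier_mat n n"
  shows "mat_trace (Q\<^sup>T * B * Q) = mat_trace B"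
proof -
  have Qc: "Q \<in> carrier_mat n n" and QtQ: "Q\<^sup>T * Q = 1\<^sub>m n" using Q by (auto simp: orth_mat_def)
  have QQt: "Q * Q\<^sup>T = 1\<^sub>m n" using mat_mult_left_right_inverse[of "Q\<^sup>T" n Q] Qc QtQ by simp
  have "mat_trace (Q\<^sup>T * B * Q) = mat_trace (Q * (Q\<^sup>T * B))"
    using Qc M by (intro mat_trace_mult_comm[of _ n n]) auto
  also have "Q * (Q\<^sup>T * B) = (Q * Q\<^sup>T) * B"
    using Qc M by (intro assoc_mult_mat[symmetric, of _ n n _ n _ n]) auto
  also have "\<dots> = B" unfolding QQt using M by simp
  finally show ?thesis .
qed

end

lemma deriv_v_D:
  assumes lam: "lam > 0"
  shows "deriv (v_D D) (- lam)
    = 1 / real (dim_row D) * (\<Sum>i<dim_row D. 1 / ((diag_entry D i)\<^sup>2 + lam)\<^sup>2)"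
proof (rule DERIV_imp_deriv)
  have "((\<lambda>z. 1 / ((diag_entry D i)\<^sup>2 - z)) has_real_derivative
      1 / ((diag_entry D i)\<^sup>2 + lam)\<^sup>2) (at (- lam))" for i
  proof -
    have "(diag_entry D i)\<^sup>2 + lam \<noteq> 0"
      using lam zero_le_power2[of "diag_entry D i"] by linarith
    then show ?thesis by (auto intro!: derivative_eq_intros simp: power2_eq_square)
  qed
  then show "(v_D D has_field_derivative
      1 / real (dim_row D) * (\<Sum>i<dim_row D. 1 / ((diag_entry D i)\<^sup>2 + lam)\<^sup>2)) (at (- lam))"
    unfolding v_D_def[abs_def] by (intro DERIV_cmult DERIV_sum)
qed

text \<open>The singular value decomposition diagonalises \<open>A A\<^sup>T\<close>, hence
\<open>R = Q\<^sup>T diag (\<lambda> / (d\<^sub>i\<^sup>2 + \<lambda>)) Q\<close>.\<close>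

lemma svd_resid_traces:
  assumes lam: "lam > 0" and n: "n > 0" and svd: "is_svd n p A Q D W"
  shows "mat_trace (resid_mat lam A) = lam * (real n * v_D D (- lam))"
    and "mat_trace (resid_mat lam A * resid_mat lam A) = lam\<^sup>2 * (real n * deriv (v_D D) (- lam))"
proof -
  have Q: "orth_mat n Q" and W: "orth_mat p W" and D: "D \<in> carrier_mat n p" and diag: "diagonal_mat D"
    and A: "A = Q\<^sup>T * D * W"
    using svd by (auto simp: is_svd_def)
  have Qc: "Q \<in> carrier_mat n n" and QtQ: "Q\<^sup>T * Q = 1\<^sub>m n" using Q by (auto simp: orth_mat_def)
  have Wc: "W \<in> carrier_mat p p" and WtW: "W\<^sup>T * W = 1\<^sub>m p" using W by (auto simp: orth_mat_def)
  have WWt: "W * W\<^sup>T = 1\<^sub>m p" using mat_mult_left_right_inverse[of "W\<^sup>T" p W] Wc WtW by simp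
  have Ac: "A \<in> carrier_mat n p" using A Qc D Wc by simp
  define d where "d = diag_entry D"
  have d0: "(d i)\<^sup>2 + lam \<noteq> 0" for i using lam zero_le_power2[of "d i"] by linarith
  have Dik: "D $$ (i, k) = (if k = i then d i else 0)" if "i < n" "k < p" for i k
    using that D diag by (auto simp: diagonal_mat_def d_def diag_entry_def)
  have dp: "d i = 0" if "i \<ge> p" for i using that D by (auto simp: d_def diag_entry_def)
  have DDt: "D * D\<^sup>T = mat_diag n (\<lambda>i. (d i)\<^sup>2)"
  proof (rule eq_matI)
    fix i j assume "i < dim_row (mat_diag n (\<lambda>i. (d i)\<^sup>2))" "j < dim_col (mat_diag n (\<lambda>i. (d i)\<^sup>2))"
    then have ij: "i < n" "j < n" by (auto simp: mat_diag_def)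
    have "(D * D\<^sup>T) $$ (i, j) = (\<Sum>k<p. D $$ (i, k) * D $$ (j, k))"
      using ij D by (simp add: scalar_prod_def atLeast0LessThan)
    also have "\<dots> = (\<Sum>k<p. if k = i then (if i = j then (d i)\<^sup>2 else 0) else 0)"
      using ij by (intro sum.cong) (auto simp: Dik power2_eq_square)
    also have "\<dots> = (if i = j then (d i)\<^sup>2 else 0)" using dp[of i] by (auto simp: not_less)
    finally show "(D * D\<^sup>T) $$ (i, j) = mat_diag n (\<lambda>i. (d i)\<^sup>2) $$ (i, j)"
      using ij by (simp add: mat_diag_def)
  qed (use D in \<open>auto simp: mat_diag_def\<close>)
  have "A\<^sup>T = W\<^sup>T * (D\<^sup>T * Q)"
    unfolding A using Qc D Wc by (simp add: transpose_mult[of _ n p _ p] transpose_mult[of _ n n _ p])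
  then have "A * A\<^sup>T = Q\<^sup>T * D * W * (W\<^sup>T * (D\<^sup>T * Q))" by (simp add: A)
  also have "\<dots> = Q\<^sup>T * D * ((W * W\<^sup>T) * (D\<^sup>T * Q))"
    using Qc D Wc by (simp add: assoc_mult_mat[of _ n p _ p _ n] assoc_mult_mat[of _ n n _ p _ n]
        assoc_mult_mat[of _ n n _ p _ p] assoc_mult_mat[of _ p p _ p _ n] assoc_mult_mat[of _ p n _ n _ n])
  also have "\<dots> = Q\<^sup>T * (D * D\<^sup>T) * Q"
    unfolding WWt using Qc D by (simp add: assoc_mult_mat[of _ n n _ p _ n] assoc_mult_mat[of _ n p _ n _ n]
        assoc_mult_mat[of _ n n _ n _ n])
  finally have AAt: "A * A\<^sup>T = Q\<^sup>T * mat_diag n (\<lambda>i. (d i)\<^sup>2) * Q" by (simp add: DDt)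
  have mdc: "mat_diag n f \<in> carrier_mat n n" for f :: "nat \<Rightarrow> real" by (simp add: mat_diag_def)
  have shift: "A * A\<^sup>T + lam \<cdot>\<^sub>m 1\<^sub>m n = Q\<^sup>T * mat_diag n (\<lambda>i. (d i)\<^sup>2 + lam) * Q"
  proof -
    have "mat_diag n (\<lambda>i. (d i)\<^sup>2 + lam) = mat_diag n (\<lambda>i. (d i)\<^sup>2) + lam \<cdot>\<^sub>m 1\<^sub>m n"
      by (intro eq_matI) (auto simp: mat_diag_def)
    then have "Q\<^sup>T * mat_diag n (\<lambda>i. (d i)\<^sup>2 + lam) * Q
        = (Q\<^sup>T * mat_diag n (\<lambda>i. (d i)\<^sup>2) + lam \<cdot>\<^sub>m Q\<^sup>T) * Q"
      using Qc mdc by (simp add: mult_add_distrib_mat[of _ n n _ n] mult_smult_distrib[of _ n n _ n])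
    also have "\<dots> = Q\<^sup>T * mat_diag n (\<lambda>i. (d i)\<^sup>2) * Q + lam \<cdot>\<^sub>m (Q\<^sup>T * Q)"
      using Qc mdc by (simp add: add_mult_distrib_mat[of _ n n _ _ n] mult_smult_assoc_mat[of _ n n _ n])
    finally show ?thesis by (simp add: AAt QtQ)
  qed
  define Y where "Y = Q\<^sup>T * mat_diag n (\<lambda>i. lam / ((d i)\<^sup>2 + lam)) * Q"
  have Yc: "Y \<in> carrier_mat n n"
    unfolding Y_def by (intro mult_carrier_mat[of _ n n]) (use Qc mdc in auto)
  have "(A * A\<^sup>T + lam \<cdot>\<^sub>m 1\<^sub>m n) * Y = Q\<^sup>T * (mat_diag n (\<lambda>i. (d i)\<^sup>2 + lam) * mat_diag n (\<lambda>i. lam / ((d i)\<^sup>2 + lam))) * Q"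
    unfolding shift Y_def by (intro orth_mat_conj_mult[OF Q] mdc)
  also have "mat_diag n (\<lambda>i. (d i)\<^sup>2 + lam) * mat_diag n (\<lambda>i. lam / ((d i)\<^sup>2 + lam)) = lam \<cdot>\<^sub>m 1\<^sub>m n"
    using d0 by (intro eq_matI) (auto simp: mat_diag_diag, auto simp: mat_diag_def)
  also have "Q\<^sup>T * (lam \<cdot>\<^sub>m 1\<^sub>m n) * Q = lam \<cdot>\<^sub>m 1\<^sub>m n"
    using Qc QtQ by (simp add: mult_smult_distrib[of _ n n _ n] mult_smult_assoc_mat[of _ n n _ n])
  finally have R: "resid_mat lam A = Y" by (intro resid_mat_unique[OF lam Ac Yc])
  have dimD: "dim_row D = n" using D by simp
  show "mat_trace (resid_mat lam A) = lam * (real n * v_D D (- lam))"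
    unfolding R Y_def mat_trace_orth_conj[OF Q mdc]
    using n by (simp add: mat_trace_def mat_diag_def v_D_def dimD d_def[symmetric] sum_distrib_left)
  have "Y * Y = Q\<^sup>T * (mat_diag n (\<lambda>i. lam / ((d i)\<^sup>2 + lam)) * mat_diag n (\<lambda>i. lam / ((d i)\<^sup>2 + lam))) * Q"
    unfolding Y_def by (intro orth_mat_conj_mult[OF Q] mdc)
  then have YY: "Y * Y = Q\<^sup>T * mat_diag n (\<lambda>i. (lam / ((d i)\<^sup>2 + lam)) * (lam / ((d i)\<^sup>2 + lam))) * Q"
    by (simp add: mat_diag_diag)
  show "mat_trace (resid_mat lam A * resid_mat lam A) = lam\<^sup>2 * (real n * deriv (v_D D) (- lam))"
    unfolding R YY mat_trace_orth_conj[OF Q mdc]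
    using n by (simp add: mat_trace_def mat_diag_def deriv_v_D[OF lam] dimD d_def[symmetric] sum_distrib_left
        power2_eq_square)
qed

lemma GCV_decomposition:
  assumes lam: "lam > 0" and n: "n > 0" and svd: "is_svd n p A Q D W"
    and b: "b \<in> carrier_vec p" and e: "e \<in> carrier_vec n"
  shows "GCV lam A (A *\<^sub>v b + e) =
    (signal_energy lam A b
      + 2 * ((resid_mat lam A *\<^sub>v e) \<bullet> (resid_mat lam A *\<^sub>v (A *\<^sub>v b)))
      + (resid_mat lam A *\<^sub>v e) \<bullet> (resid_mat lam A *\<^sub>v e)) / n / (lam * v_D D (- lam))\<^sup>2"
proof -
  have A: "A \<in> carrier_mat n p" using svd by (auto simp: is_svd_def orth_mat_def)
  let ?R = "resid_mat lam A"
  define y where "y = A *\<^sub>v b + e"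
  note R = resid_mat_carrier[OF lam A]
  have y: "y \<in> carrier_vec n" using A b e by (simp add: y_def)
  have S: "ridge_smoother lam A \<in> carrier_mat n n"
    using A ridge_inv_adj[OF lam A] by (simp add: ridge_smoother_def)
  have P: "ridge_inv lam A \<in> carrier_mat p p" using ridge_inv_adj[OF lam A] by simp
  have res: "y $ i - Matrix.row A i \<bullet> ridge_est lam A y = (?R *\<^sub>v y) $ i" if i: "i < n" for i
  proof -
    have "?R *\<^sub>v y = 1\<^sub>m n *\<^sub>v y - ridge_smoother lam A *\<^sub>v y"
      using A S y by (simp add: resid_mat_def minus_mult_distrib_mat_vec[of _ n n])
    also have "ridge_smoother lam A *\<^sub>v y = A *\<^sub>v ridge_est lam A y"
      using A P y by (simp add: ridge_smoother_def ridge_est_def assoc_mult_mat_vec[of _ n p _ n]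
          assoc_mult_mat_vec[of _ p p _ n] assoc_mult_mat[of _ n p _ p _ n])
    finally show ?thesis using i A y by simp
  qed
  have "mat_trace ?R = real n - mat_trace (ridge_smoother lam A)"
    using A S by (simp add: resid_mat_def mat_trace_minus[of _ n]) (simp add: mat_trace_def)
  then have tr: "1 - mat_trace (ridge_smoother lam A) / n = lam * v_D D (- lam)"
    using svd_resid_traces(1)[OF lam n svd] n by (simp add: field_simps)
  have "GCV lam A y = 1 / n * (\<Sum>i<n. ((?R *\<^sub>v y) $ i / (lam * v_D D (- lam)))\<^sup>2)"
    using A tr res by (simp add: GCV_def)
  also have "\<dots> = ((?R *\<^sub>v y) \<bullet> (?R *\<^sub>v y)) / n / (lam * v_D D (- lam))\<^sup>2"
    using R y by (simp add: scalar_prod_def atLeast0LessThan power_divide sum_divide_distrib[symmetric] power2_eq_square)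
  also have "(?R *\<^sub>v y) \<bullet> (?R *\<^sub>v y) = signal_energy lam A b
      + 2 * ((?R *\<^sub>v e) \<bullet> (?R *\<^sub>v (A *\<^sub>v b))) + (?R *\<^sub>v e) \<bullet> (?R *\<^sub>v e)"
  proof -
    define u where "u = ?R *\<^sub>v (A *\<^sub>v b)"
    define w where "w = ?R *\<^sub>v e"
    have u: "u \<in> carrier_vec n" and w: "w \<in> carrier_vec n" using R A b e by (auto simp: u_def w_def)
    have "?R *\<^sub>v y = u + w"
      unfolding y_def u_def w_def using R A b e by (intro mult_add_distrib_mat_vec[of _ n n]) auto
    moreover have "(u + w) \<bullet> (u + w) = u \<bullet> u + 2 * (w \<bullet> u) + w \<bullet> w"
      using u w by (simp add: add_scalar_prod_distrib[of _ n] scalar_prod_add_distrib[of _ n] comm_scalar_prod[of u n w])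
    ultimately show ?thesis by (simp add: signal_energy_def u_def w_def)
  qed
  finally show ?thesis by (simp add: y_def)
qed

text \<open>Keeps the denominator of GCV away from zero.\<close>

lemma v_D_lower_bound:
  assumes lam: "lam > 0" and n: "n > 0" and p: "p > 0" and D: "D \<in> carrier_mat n p"
    and nn: "\<And>i. i < min n p \<Longrightarrow> D $$ (i, i) \<ge> 0" and C: "max_sv D \<le> C"
  shows "1 / (C\<^sup>2 + lam) \<le> v_D D (- lam)"
proof -
  have le: "(diag_entry D i)\<^sup>2 \<le> C\<^sup>2" for i
  proof (cases "i < min n p")
    case True
    then have "D $$ (i, i) \<le> max_sv D" unfolding max_sv_def using D by (intro Max_ge) auto
    then show ?thesis using True D C nn[OF True] by (auto simp: diag_entry_def intro!: power_mono)
  next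
    case False
    then show ?thesis using D by (auto simp: diag_entry_def)
  qed
  have "real n * (1 / (C\<^sup>2 + lam)) \<le> (\<Sum>i<n. 1 / ((diag_entry D i)\<^sup>2 + lam))"
    using le lam by (intro sum_bounded_below[of "{..<n}", simplified] frac_le) (auto simp: add_nonneg_pos)
  then show ?thesis using D n by (simp add: v_D_def field_simps)
qed

lemma deriv_v_D_bounds:
  assumes lam: "lam > 0"
  shows "0 \<le> deriv (v_D D) (- lam)" and "lam * deriv (v_D D) (- lam) \<le> v_D D (- lam)"
proof -
  show "0 \<le> deriv (v_D D) (- lam)" by (simp add: deriv_v_D[OF lam] sum_nonneg)
  have "lam * (1 / ((diag_entry D i)\<^sup>2 + lam)\<^sup>2) \<le> 1 / ((diag_entry D i)\<^sup>2 + lam)" for i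
  proof -
    have pos: "0 < (diag_entry D i)\<^sup>2 + lam" using lam by (simp add: add_nonneg_pos)
    have "lam / ((diag_entry D i)\<^sup>2 + lam) \<le> 1" using pos by simp
    then have "lam / ((diag_entry D i)\<^sup>2 + lam) * (1 / ((diag_entry D i)\<^sup>2 + lam)) \<le> 1 * (1 / ((diag_entry D i)\<^sup>2 + lam))"
      using pos by (intro mult_right_mono) auto
    then show ?thesis by (simp add: power2_eq_square)
  qed
  then have "lam * (\<Sum>i<dim_row D. 1 / ((diag_entry D i)\<^sup>2 + lam)\<^sup>2) \<le> (\<Sum>i<dim_row D. 1 / ((diag_entry D i)\<^sup>2 + lam))"
    unfolding sum_distrib_left by (rule sum_mono)
  then have "1 / real (dim_row D) * (lam * (\<Sum>i<dim_row D. 1 / ((diag_entry D i)\<^sup>2 + lam)\<^sup>2))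
      \<le> 1 / real (dim_row D) * (\<Sum>i<dim_row D. 1 / ((diag_entry D i)\<^sup>2 + lam))"
    by (rule mult_left_mono) simp
  then show "lam * deriv (v_D D) (- lam) \<le> v_D D (- lam)"
    by (simp add: deriv_v_D[OF lam] v_D_def)
qed

section \<open>Measurability of functions of the design\<close>

text \<open>Measurability into the space of matrices is measurability of the entries. With this criterion the
matrix operations below reduce to finite sums and products of real functions.\<close>

lemma measurable_mat_borel_iff:
  "F \<in> measurable N (mat_borel n p) \<longleftrightarrow>
    (\<forall>x\<in>space N. F x \<in> carrier_mat n p) \<and>
    (\<forall>i<n. \<forall>j<p. (\<lambda>x. F x $$ (i, j)) \<in> borel_measurable N)"
proof
  assume F: "F \<in> measurable N (mat_borel n p)"
  have "F x \<in> carrier_mat n p" if "x \<in> space N" for x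
    using measurable_space[OF F that] by (simp add: mat_borel_def)
  moreover have "(\<lambda>x. F x $$ (i, j)) \<in> borel_measurable N" if ij: "i < n" "j < p" for i j
  proof -
    have "(\<lambda>A. restrict (index_mat A) ({..<n} \<times> {..<p})) \<in>
        measurable (mat_borel n p) (Pi\<^sub>M ({..<n} \<times> {..<p}) (\<lambda>_. borel))"
      unfolding mat_borel_def by (intro measurable_vimage_algebra1) (auto simp: space_PiM)
    from measurable_compose[OF F measurable_compose[OF this measurable_component_singleton[of "(i, j)"]]] ij
    show ?thesis by simp
  qed
  ultimately show "(\<forall>x\<in>space N. F x \<in> carrier_mat n p) \<and>
    (\<forall>i<n. \<forall>j<p. (\<lambda>x. F x $$ (i, j)) \<in> borel_measurable N)" by blast
next
  assume "(\<forall>x\<in>space N. F x \<in> carrier_mat n p) \<and>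
    (\<forall>i<n. \<forall>j<p. (\<lambda>x. F x $$ (i, j)) \<in> borel_measurable N)"
  then show "F \<in> measurable N (mat_borel n p)"
    unfolding mat_borel_def
    by (intro measurable_vimage_algebra2 measurable_restrict) auto
qed

lemma measurable_vec_borel_iff:
  "F \<in> measurable N (vec_borel n) \<longleftrightarrow>
    (\<forall>x\<in>space N. F x \<in> carrier_vec n) \<and> (\<forall>i<n. (\<lambda>x. F x $ i) \<in> borel_measurable N)"
proof
  assume F: "F \<in> measurable N (vec_borel n)"
  have "F x \<in> carrier_vec n" if "x \<in> space N" for x
    using measurable_space[OF F that] by (simp add: vec_borel_def)
  moreover have "(\<lambda>x. F x $ i) \<in> borel_measurable N" if i: "i < n" for i
  proof -
    have "(\<lambda>v. restrict (vec_index v) {..<n}) \<in> measurable (vec_borel n) (Pi\<^sub>M {..<n} (\<lambda>_. borel))"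
      unfolding vec_borel_def by (intro measurable_vimage_algebra1) (auto simp: space_PiM)
    from measurable_compose[OF F measurable_compose[OF this measurable_component_singleton[of i]]] i
    show ?thesis by simp
  qed
  ultimately show "(\<forall>x\<in>space N. F x \<in> carrier_vec n) \<and>
    (\<forall>i<n. (\<lambda>x. F x $ i) \<in> borel_measurable N)" by blast
next
  assume "(\<forall>x\<in>space N. F x \<in> carrier_vec n) \<and> (\<forall>i<n. (\<lambda>x. F x $ i) \<in> borel_measurable N)"
  then show "F \<in> measurable N (vec_borel n)"
    unfolding vec_borel_def
    by (intro measurable_vimage_algebra2 measurable_restrict) auto
qed

lemma space_mat_borel: "space (mat_borel n p) = carrier_mat n p"
  by (simp add: mat_borel_def)

lemma space_vec_borel: "space (vec_borel n) = carrier_vec n"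
  by (simp add: vec_borel_def)

lemma measurable_mat_mult:
  assumes "F \<in> measurable N (mat_borel n m)" "G \<in> measurable N (mat_borel m p)"
  shows "(\<lambda>x. F x * G x) \<in> measurable N (mat_borel n p)"
  unfolding measurable_mat_borel_iff
proof (intro conjI ballI allI impI)
  show "F x * G x \<in> carrier_mat n p" if "x \<in> space N" for x
    using assms that by (auto simp: measurable_mat_borel_iff)
  fix i j assume ij: "i < n" "j < p"
  have "(\<lambda>x. \<Sum>k<m. F x $$ (i, k) * G x $$ (k, j)) \<in> borel_measurable N"
    using assms ij by (intro borel_measurable_sum borel_measurable_times) (auto simp: measurable_mat_borel_iff)
  moreover have "(F x * G x) $$ (i, j) = (\<Sum>k<m. F x $$ (i, k) * G x $$ (k, j))" if x: "x \<in> space N" for x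
  proof -
    have "F x \<in> carrier_mat n m" "G x \<in> carrier_mat m p" using assms x by (auto simp: measurable_mat_borel_iff)
    then show ?thesis using ij by (simp add: scalar_prod_def atLeast0LessThan)
  qed
  ultimately show "(\<lambda>x. (F x * G x) $$ (i, j)) \<in> borel_measurable N" by (subst measurable_cong) auto
qed

lemma measurable_mult_mat_vec:
  assumes "F \<in> measurable N (mat_borel n m)" "v \<in> measurable N (vec_borel m)"
  shows "(\<lambda>x. F x *\<^sub>v v x) \<in> measurable N (vec_borel n)"
  unfolding measurable_vec_borel_iff
proof (intro conjI ballI allI impI)
  show "F x *\<^sub>v v x \<in> carrier_vec n" if "x \<in> space N" for x
    using assms that by (auto simp: measurable_mat_borel_iff measurable_vec_borel_iff)
  fix i assume i: "i < n"
  have "(\<lambda>x. \<Sum>k<m. F x $$ (i, k) * v x $ k) \<in> borel_measurable N"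
    using assms i by (intro borel_measurable_sum borel_measurable_times)
      (auto simp: measurable_mat_borel_iff measurable_vec_borel_iff)
  moreover have "(F x *\<^sub>v v x) $ i = (\<Sum>k<m. F x $$ (i, k) * v x $ k)" if x: "x \<in> space N" for x
  proof -
    have "F x \<in> carrier_mat n m" "v x \<in> carrier_vec m"
      using assms x by (auto simp: measurable_mat_borel_iff measurable_vec_borel_iff)
    then show ?thesis using i by (simp add: scalar_prod_def atLeast0LessThan)
  qed
  ultimately show "(\<lambda>x. (F x *\<^sub>v v x) $ i) \<in> borel_measurable N" by (subst measurable_cong) auto
qed

lemma measurable_scalar_prod:
  assumes "v \<in> measurable N (vec_borel n)" "w \<in> measurable N (vec_borel n)"
  shows "(\<lambda>x. v x \<bullet> w x) \<in> borel_measurable N"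
proof -
  have "(\<lambda>x. \<Sum>k<n. v x $ k * w x $ k) \<in> borel_measurable N"
    using assms by (intro borel_measurable_sum borel_measurable_times) (auto simp: measurable_vec_borel_iff)
  moreover have "v x \<bullet> w x = (\<Sum>k<n. v x $ k * w x $ k)" if x: "x \<in> space N" for x
  proof -
    have "v x \<in> carrier_vec n" "w x \<in> carrier_vec n" using assms x by (auto simp: measurable_vec_borel_iff)
    then show ?thesis by (simp add: scalar_prod_def atLeast0LessThan)
  qed
  ultimately show ?thesis by (subst measurable_cong) auto
qed

lemma measurable_mat_trace:
  assumes "F \<in> measurable N (mat_borel n n)"
  shows "(\<lambda>x. mat_trace (F x)) \<in> borel_measurable N"
proof -
  have "(\<lambda>x. \<Sum>i<n. F x $$ (i, i)) \<in> borel_measurable N"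
    using assms by (intro borel_measurable_sum) (auto simp: measurable_mat_borel_iff)
  moreover have "mat_trace (F x) = (\<Sum>i<n. F x $$ (i, i))" if x: "x \<in> space N" for x
  proof -
    have "F x \<in> carrier_mat n n" using assms x by (auto simp: measurable_mat_borel_iff)
    then show ?thesis by (simp add: mat_trace_def)
  qed
  ultimately show ?thesis by (subst measurable_cong) auto
qed

lemma measurable_mat_transpose:
  assumes "F \<in> measurable N (mat_borel n p)"
  shows "(\<lambda>x. (F x)\<^sup>T) \<in> measurable N (mat_borel p n)"
  unfolding measurable_mat_borel_iff
proof (intro conjI ballI allI impI)
  have c: "F x \<in> carrier_mat n p" if "x \<in> space N" for x
    using assms that by (auto simp: measurable_mat_borel_iff)
  then show "(F x)\<^sup>T \<in> carrier_mat p n" if "x \<in> space N" for x using that by auto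
  fix i j assume ij: "i < p" "j < n"
  then have "(\<lambda>x. F x $$ (j, i)) \<in> borel_measurable N" using assms by (auto simp: measurable_mat_borel_iff)
  moreover have "(F x)\<^sup>T $$ (i, j) = F x $$ (j, i)" if "x \<in> space N" for x using c[OF that] ij by simp
  ultimately show "(\<lambda>x. (F x)\<^sup>T $$ (i, j)) \<in> borel_measurable N" by (subst measurable_cong) auto
qed

lemma measurable_det:
  assumes "F \<in> measurable N (mat_borel n n)"
  shows "(\<lambda>x. det (F x)) \<in> borel_measurable N"
proof -
  have "(\<lambda>x. \<Sum>q\<in>{q. q permutes {0..<n}}. signof q * (\<Prod>i = 0..<n. F x $$ (i, q i))) \<in> borel_measurable N"
  proof (intro borel_measurable_sum borel_measurable_times borel_measurable_prod borel_measurable_const)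
    fix q i assume "q \<in> {q. q permutes {0..<n}}" "i \<in> {0..<n}"
    then have "i < n" "q i < n" using permutes_in_image[of q "{0..<n}" i] by auto
    then show "(\<lambda>x. F x $$ (i, q i)) \<in> borel_measurable N"
      using assms by (auto simp: measurable_mat_borel_iff)
  qed
  moreover have "det (F x) = (\<Sum>q\<in>{q. q permutes {0..<n}}. signof q * (\<Prod>i = 0..<n. F x $$ (i, q i)))"
    if x: "x \<in> space N" for x
    using assms x by (intro det_def') (auto simp: measurable_mat_borel_iff)
  ultimately show ?thesis by (subst measurable_cong) auto
qed

lemma measurable_adj_mat:
  assumes F: "F \<in> measurable N (mat_borel n n)"
  shows "(\<lambda>x. adj_mat (F x)) \<in> measurable N (mat_borel n n)"
  unfolding measurable_mat_borel_iff
proof (intro conjI ballI allI impI)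
  have c: "F x \<in> carrier_mat n n" if "x \<in> space N" for x
    using F that by (auto simp: measurable_mat_borel_iff)
  then show "adj_mat (F x) \<in> carrier_mat n n" if "x \<in> space N" for x using adj_mat that by auto
  fix i j assume ij: "i < n" "j < n"
  have "(\<lambda>x. mat_delete (F x) j i) \<in> measurable N (mat_borel (n - 1) (n - 1))"
    unfolding measurable_mat_borel_iff
  proof (intro conjI ballI allI impI)
    show "mat_delete (F x) j i \<in> carrier_mat (n - 1) (n - 1)" if "x \<in> space N" for x
      using c[OF that] by (auto simp: mat_delete_def)
    fix a b assume ab: "a < n - 1" "b < n - 1"
    let ?a = "if a < j then a else Suc a" and ?b = "if b < i then b else Suc b"
    have "?a < n" "?b < n" using ab by auto
    then have "(\<lambda>x. F x $$ (?a, ?b)) \<in> borel_measurable N" using F unfolding measurable_mat_borel_iff by blast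
    moreover have "mat_delete (F x) j i $$ (a, b) = F x $$ (?a, ?b)" if "x \<in> space N" for x
      using c[OF that] ab by (simp add: mat_delete_def)
    ultimately show "(\<lambda>x. mat_delete (F x) j i $$ (a, b)) \<in> borel_measurable N" by (subst measurable_cong) auto
  qed
  then have "(\<lambda>x. cofactor (F x) j i) \<in> borel_measurable N"
    unfolding cofactor_def by (intro borel_measurable_times borel_measurable_const measurable_det)
  moreover have "adj_mat (F x) $$ (i, j) = cofactor (F x) j i" if "x \<in> space N" for x
    using c[OF that] ij by (simp add: adj_mat_def)
  ultimately show "(\<lambda>x. adj_mat (F x) $$ (i, j)) \<in> borel_measurable N" by (subst measurable_cong) auto
qed

lemma measurable_ridge_inv:
  assumes lam: "lam > 0" and F: "F \<in> measurable N (mat_borel n p)"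
  shows "(\<lambda>x. ridge_inv lam (F x)) \<in> measurable N (mat_borel p p)"
proof -
  define B where "B x = (F x)\<^sup>T * F x + lam \<cdot>\<^sub>m 1\<^sub>m p" for x
  have c: "F x \<in> carrier_mat n p" if "x \<in> space N" for x
    using F that by (auto simp: measurable_mat_borel_iff)
  have G: "(\<lambda>x. (F x)\<^sup>T * F x) \<in> measurable N (mat_borel p p)"
    by (intro measurable_mat_mult[of _ N p n _ p] measurable_mat_transpose F)
  have Bm: "B \<in> measurable N (mat_borel p p)"
    unfolding measurable_mat_borel_iff
  proof (intro conjI ballI allI impI)
    show "B x \<in> carrier_mat p p" if "x \<in> space N" for x using c[OF that] by (auto simp: B_def)
    fix i j assume ij: "i < p" "j < p"
    have "(\<lambda>x. ((F x)\<^sup>T * F x) $$ (i, j) + lam * (1\<^sub>m p $$ (i, j))) \<in> borel_measurable N"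
      using G ij by (intro borel_measurable_add borel_measurable_const) (auto simp: measurable_mat_borel_iff)
    moreover have "B x $$ (i, j) = ((F x)\<^sup>T * F x) $$ (i, j) + lam * (1\<^sub>m p $$ (i, j))" if "x \<in> space N" for x
      using c[OF that] ij by (simp add: B_def)
    ultimately show "(\<lambda>x. B x $$ (i, j)) \<in> borel_measurable N" by (subst measurable_cong) auto
  qed
  note A = measurable_adj_mat[OF Bm] and dt = measurable_det[OF Bm]
  have eq: "ridge_inv lam (F x) = inverse (det (B x)) \<cdot>\<^sub>m adj_mat (B x)" if "x \<in> space N" for x
    using ridge_inv_adj(1)[OF lam c[OF that]] by (simp add: B_def)
  show ?thesis
    unfolding measurable_mat_borel_iff
  proof (intro conjI ballI allI impI)
    show "ridge_inv lam (F x) \<in> carrier_mat p p" if "x \<in> space N" for x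
      by (rule ridge_inv_adj(2)[OF lam c[OF that]])
    fix i j assume ij: "i < p" "j < p"
    have "(\<lambda>x. inverse (det (B x)) * adj_mat (B x) $$ (i, j)) \<in> borel_measurable N"
      using A dt ij by (intro borel_measurable_times borel_measurable_inverse) (auto simp: measurable_mat_borel_iff)
    moreover have "ridge_inv lam (F x) $$ (i, j) = inverse (det (B x)) * adj_mat (B x) $$ (i, j)"
      if x: "x \<in> space N" for x
    proof -
      have "adj_mat (B x) \<in> carrier_mat p p" using A x by (auto simp: measurable_mat_borel_iff)
      then show ?thesis using ij by (simp add: eq[OF x])
    qed
    ultimately show "(\<lambda>x. ridge_inv lam (F x) $$ (i, j)) \<in> borel_measurable N" by (subst measurable_cong) auto
  qed
qed

lemma measurable_resid_mat:
  assumes lam: "lam > 0" and F: "F \<in> measurable N (mat_borel n p)"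
  shows "(\<lambda>x. resid_mat lam (F x)) \<in> measurable N (mat_borel n n)"
proof -
  have c: "F x \<in> carrier_mat n p" if "x \<in> space N" for x
    using F that by (auto simp: measurable_mat_borel_iff)
  have S: "(\<lambda>x. ridge_smoother lam (F x)) \<in> measurable N (mat_borel n n)"
    unfolding ridge_smoother_def
    by (intro measurable_mat_mult[of _ _ n p] measurable_mat_transpose measurable_ridge_inv[OF lam F] F)
  show ?thesis
    unfolding measurable_mat_borel_iff
  proof (intro conjI ballI allI impI)
    show "resid_mat lam (F x) \<in> carrier_mat n n" if "x \<in> space N" for x
      by (rule resid_mat_carrier[OF lam c[OF that]])
    fix i j assume ij: "i < n" "j < n"
    have "(\<lambda>x. 1\<^sub>m n $$ (i, j) - ridge_smoother lam (F x) $$ (i, j)) \<in> borel_measurable N"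
      using S ij by (intro borel_measurable_diff borel_measurable_const) (auto simp: measurable_mat_borel_iff)
    moreover have "resid_mat lam (F x) $$ (i, j) = 1\<^sub>m n $$ (i, j) - ridge_smoother lam (F x) $$ (i, j)"
      if x: "x \<in> space N" for x
    proof -
      have "ridge_smoother lam (F x) \<in> carrier_mat n n" using S x by (auto simp: measurable_mat_borel_iff)
      then show ?thesis using ij c[OF x] by (simp add: resid_mat_def)
    qed
    ultimately show "(\<lambda>x. resid_mat lam (F x) $$ (i, j)) \<in> borel_measurable N" by (subst measurable_cong) auto
  qed
qed

lemma measurable_signal_energy:
  assumes "lam > 0" "F \<in> measurable N (mat_borel n p)" "b \<in> measurable N (vec_borel p)"
  shows "(\<lambda>x. signal_energy lam (F x) (b x)) \<in> borel_measurable N"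
  unfolding signal_energy_def
  by (intro measurable_scalar_prod[of _ _ n] measurable_mult_mat_vec[of _ _ n n] measurable_mult_mat_vec[of _ _ n p]
      measurable_resid_mat[of _ _ _ n p] assms)

lemma measurable_signal_trace:
  assumes "lam > 0" "F \<in> measurable N (mat_borel n p)"
  shows "(\<lambda>x. signal_trace lam (F x)) \<in> borel_measurable N"
  unfolding signal_trace_def
  by (intro borel_measurable_times borel_measurable_diff borel_measurable_const measurable_mat_trace[of _ _ n]
      measurable_mat_mult[of _ _ n n] measurable_resid_mat[of _ _ _ n p] assms)

section \<open>Conditioning and rotational invariance\<close>

lemma (in prob_space) indep_rv_commute:
  assumes "indep_rv M S X T Y"
  shows "indep_rv M T Y S X"
  using assms unfolding indep_rv_def indep_sets2_eq by (metis Int_commute mult.commute)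

text \<open>Conditioning on \<open>X\<close>: the joint law is the product of the marginal laws, so a bound that holds for almost
every frozen value of \<open>X\<close> holds for the pair.\<close>

lemma (in prob_space) indep_rv_prob_le:
  assumes ind: "indep_rv M S X T Y" and B: "B \<in> sets (S \<Otimes>\<^sub>M T)"
    and le: "AE \<omega> in M. prob {\<omega>' \<in> space M. (X \<omega>, Y \<omega>') \<in> B} \<le> c"
  shows "prob {\<omega> \<in> space M. (X \<omega>, Y \<omega>) \<in> B} \<le> c"
proof -
  have X[measurable]: "X \<in> measurable M S" and Y[measurable]: "Y \<in> measurable M T"
    and sets_indep: "indep_set (sets (vimage_algebra (space M) X S)) (sets (vimage_algebra (space M) Y T))"
    using ind by (auto simp: indep_rv_def)
  interpret DX: prob_space "distr M S X" by (rule prob_space_distr[OF X])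
  interpret DY: prob_space "distr M T Y" by (rule prob_space_distr[OF Y])
  have prod: "distr M S X \<Otimes>\<^sub>M distr M T Y = distr M (S \<Otimes>\<^sub>M T) (\<lambda>\<omega>. (X \<omega>, Y \<omega>))"
  proof (rule pair_measure_eqI)
    show "sigma_finite_measure (distr M S X)" "sigma_finite_measure (distr M T Y)" by unfold_locales
    show "sets (distr M S X \<Otimes>\<^sub>M distr M T Y) = sets (distr M (S \<Otimes>\<^sub>M T) (\<lambda>\<omega>. (X \<omega>, Y \<omega>)))"
      by (simp cong: sets_pair_measure_cong)
    fix A C assume "A \<in> sets (distr M S X)" "C \<in> sets (distr M T Y)"
    then have A[measurable]: "A \<in> sets S" and C[measurable]: "C \<in> sets T" by auto
    have "prob ((X -` A \<inter> space M) \<inter> (Y -` C \<inter> space M)) = prob (X -` A \<inter> space M) * prob (Y -` C \<inter> space M)"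
      using A C by (intro indep_setD[OF sets_indep] in_vimage_algebra)
    moreover have "(\<lambda>\<omega>. (X \<omega>, Y \<omega>)) -` (A \<times> C) \<inter> space M = (X -` A \<inter> space M) \<inter> (Y -` C \<inter> space M)"
      by auto
    ultimately show "emeasure (distr M S X) A * emeasure (distr M T Y) C
        = emeasure (distr M (S \<Otimes>\<^sub>M T) (\<lambda>\<omega>. (X \<omega>, Y \<omega>))) (A \<times> C)"
      by (simp add: emeasure_distr emeasure_eq_measure ennreal_mult)
  qed
  have c0: "0 \<le> c"
  proof -
    have "AE \<omega> in M. 0 \<le> c" using le by eventually_elim (meson measure_nonneg order_trans)
    then show ?thesis by simp
  qed
  have "emeasure M {\<omega> \<in> space M. (X \<omega>, Y \<omega>) \<in> B} = emeasure (distr M (S \<Otimes>\<^sub>M T) (\<lambda>\<omega>. (X \<omega>, Y \<omega>))) B"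
    using B by (subst emeasure_distr) (auto intro!: arg_cong[where f = "emeasure M"])
  also have "\<dots> = (\<integral>\<^sup>+x. emeasure (distr M T Y) (Pair x -` B) \<partial>distr M S X)"
    using B unfolding prod[symmetric]
    by (intro DY.emeasure_pair_measure_alt) (simp cong: sets_pair_measure_cong)
  also have "\<dots> = (\<integral>\<^sup>+\<omega>. emeasure (distr M T Y) (Pair (X \<omega>) -` B) \<partial>M)"
  proof (rule nn_integral_distr[OF X])
    have "(\<lambda>x. emeasure (distr M T Y) (Pair x -` B)) \<in> borel_measurable S"
      using B by (intro DY.measurable_emeasure_Pair) (simp cong: sets_pair_measure_cong)
    then show "(\<lambda>x. emeasure (distr M T Y) (Pair x -` B)) \<in> borel_measurable (distr M S X)" by simp
  qed
  also have "\<dots> = (\<integral>\<^sup>+\<omega>. ennreal (prob {\<omega>' \<in> space M. (X \<omega>, Y \<omega>') \<in> B}) \<partial>M)"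
  proof (intro nn_integral_cong)
    fix \<omega> assume "\<omega> \<in> space M"
    then have "Pair (X \<omega>) -` B \<in> sets T" using B by (intro sets_Pair1)
    then show "emeasure (distr M T Y) (Pair (X \<omega>) -` B) = ennreal (prob {\<omega>' \<in> space M. (X \<omega>, Y \<omega>') \<in> B})"
      by (simp add: emeasure_distr emeasure_eq_measure vimage_def Int_def conj_commute)
  qed
  also have "\<dots> \<le> (\<integral>\<^sup>+\<omega>. ennreal c \<partial>M)"
    using le by (intro nn_integral_mono_AE) (auto simp: ennreal_leI)
  also have "\<dots> = ennreal c" by (simp add: emeasure_space_1)
  finally show ?thesis using c0 by (simp add: emeasure_eq_measure)
qed

text \<open>For a frozen design this is \<open>quadratic_form_tail\<close>; the bound is the same for all designs.\<close>

lemma (in prob_space) noise_energy_tail: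
  assumes lam: "lam > 0" and s: "1 \<le> s" "s \<le> 2" and n: "0 < n"
    and ind: "indep_rv M (vec_borel n) \<epsilon> (mat_borel n p) X"
    and comp: "indep_vars (\<lambda>_. borel) (\<lambda>i \<omega>. \<epsilon> \<omega> $ i) {..<n}" and m: "1 \<le> m"
    and mean: "\<And>i. i < n \<Longrightarrow> expectation (\<lambda>\<omega>. \<epsilon> \<omega> $ i) = 0"
    and var: "\<And>i. i < n \<Longrightarrow> expectation (\<lambda>\<omega>. (\<epsilon> \<omega> $ i)\<^sup>2) = \<sigma>\<^sup>2"
    and var_le: "(\<sigma> ^ 4) powr s \<le> m"
    and int4: "\<And>i. i < n \<Longrightarrow> integrable M (\<lambda>\<omega>. (\<epsilon> \<omega> $ i) ^ 4)"
    and mom4: "\<And>i. i < n \<Longrightarrow> expectation (\<lambda>\<omega>. (\<epsilon> \<omega> $ i) ^ 4) \<le> m"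
    and int4s: "\<And>i. i < n \<Longrightarrow> integrable M (\<lambda>\<omega>. ((\<epsilon> \<omega> $ i) ^ 4) powr s)"
    and mom4s: "\<And>i. i < n \<Longrightarrow> expectation (\<lambda>\<omega>. ((\<epsilon> \<omega> $ i) ^ 4) powr s) \<le> m"
    and x: "0 < x"
  shows "prob {\<omega> \<in> space M. real n * x \<le>
      \<bar>(resid_mat lam (X \<omega>) *\<^sub>v \<epsilon> \<omega>) \<bullet> (resid_mat lam (X \<omega>) *\<^sub>v \<epsilon> \<omega>)
        - \<sigma>\<^sup>2 * mat_trace (resid_mat lam (X \<omega>) * resid_mat lam (X \<omega>))\<bar>}
    \<le> exp 24 * (1 + 24 * (2080 * m ^ 3)) / (x\<^sup>2) powr s * real n powr (- s)" (is "_ \<le> ?c")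
proof -
  define f where "f z = (resid_mat lam (fst z) *\<^sub>v snd z) \<bullet> (resid_mat lam (fst z) *\<^sub>v snd z)
    - \<sigma>\<^sup>2 * mat_trace (resid_mat lam (fst z) * resid_mat lam (fst z))" for z :: "real mat \<times> real vec"
  let ?N = "mat_borel n p \<Otimes>\<^sub>M vec_borel n"
  have R: "(\<lambda>z. resid_mat lam (fst z)) \<in> measurable ?N (mat_borel n n)"
    by (rule measurable_resid_mat[OF lam measurable_fst])
  have fm[measurable]: "f \<in> borel_measurable ?N"
    unfolding f_def
    by (intro borel_measurable_diff borel_measurable_times borel_measurable_const
        measurable_scalar_prod[of _ _ n] measurable_mult_mat_vec[of _ _ n n] measurable_mat_trace[of _ _ n]
        measurable_mat_mult[of _ _ n n] R measurable_snd)
  define B where "B = {z \<in> space ?N. real n * x \<le> \<bar>f z\<bar>}"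
  have B: "B \<in> sets ?N" unfolding B_def by measurable
  have Xm: "X \<in> measurable M (mat_borel n p)" and em: "\<epsilon> \<in> measurable M (vec_borel n)"
    using ind by (auto simp: indep_rv_def)
  have Xc: "X \<omega> \<in> carrier_mat n p" and ec: "\<epsilon> \<omega> \<in> carrier_vec n" if "\<omega> \<in> space M" for \<omega>
    using Xm em that by (auto simp: measurable_mat_borel_iff measurable_vec_borel_iff)
  have inB: "(X \<omega>, \<epsilon> \<omega>') \<in> B \<longleftrightarrow> real n * x \<le> \<bar>f (X \<omega>, \<epsilon> \<omega>')\<bar>"
    if "\<omega> \<in> space M" "\<omega>' \<in> space M" for \<omega> \<omega>'
    using Xc ec that by (simp add: B_def space_pair_measure space_mat_borel space_vec_borel)
  have "prob {\<omega>' \<in> space M. (X \<omega>, \<epsilon> \<omega>') \<in> B} \<le> ?c" if w: "\<omega> \<in> space M" for \<omega>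
  proof -
    define a where "a i j = (resid_mat lam (X \<omega>) * resid_mat lam (X \<omega>)) $$ (i, j)" for i j
    note a = resid_sq_entries[OF lam Xc[OF w], folded a_def]
    have "prob {\<omega>' \<in> space M. real n * x \<le>
        \<bar>(\<Sum>i<n. \<Sum>j<n. a i j * \<epsilon> \<omega>' $ i * \<epsilon> \<omega>' $ j) - \<sigma>\<^sup>2 * (\<Sum>i<n. a i i)\<bar>} \<le> ?c"
      by (rule quadratic_form_tail[OF s n comp m mean var var_le int4 mom4 int4s mom4s a(1,2) x])
    also have "{\<omega>' \<in> space M. real n * x \<le>
        \<bar>(\<Sum>i<n. \<Sum>j<n. a i j * \<epsilon> \<omega>' $ i * \<epsilon> \<omega>' $ j) - \<sigma>\<^sup>2 * (\<Sum>i<n. a i i)\<bar>}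
      = {\<omega>' \<in> space M. (X \<omega>, \<epsilon> \<omega>') \<in> B}"
      using w ec by (auto simp: inB f_def a(3,4))
    finally show ?thesis .
  qed
  then have "prob {\<omega> \<in> space M. (X \<omega>, \<epsilon> \<omega>) \<in> B} \<le> ?c"
    by (intro indep_rv_prob_le[OF indep_rv_commute[OF ind] B] AE_I2)
  moreover have "{\<omega> \<in> space M. (X \<omega>, \<epsilon> \<omega>) \<in> B} = {\<omega> \<in> space M. real n * x \<le> \<bar>f (X \<omega>, \<epsilon> \<omega>)\<bar>}"
    using inB by auto
  ultimately show ?thesis by (simp add: f_def)
qed

text \<open>For a frozen design this is \<open>linear_form_tail\<close>: the coefficient vector has squared norm at most a
constant times \<open>n\<close>.\<close>

lemma (in prob_space) cross_term_tail:
  assumes lam: "lam > 0" and n: "0 < n" and b: "b \<in> carrier_vec p" and bb: "b \<bullet> b = r\<^sup>2 * real n"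
    and ind: "indep_rv M (vec_borel n) \<epsilon> (mat_borel n p) X"
    and comp: "indep_vars (\<lambda>_. borel) (\<lambda>i \<omega>. \<epsilon> \<omega> $ i) {..<n}" and m: "1 \<le> m"
    and mean: "\<And>i. i < n \<Longrightarrow> expectation (\<lambda>\<omega>. \<epsilon> \<omega> $ i) = 0"
    and int4: "\<And>i. i < n \<Longrightarrow> integrable M (\<lambda>\<omega>. (\<epsilon> \<omega> $ i) ^ 4)"
    and mom4: "\<And>i. i < n \<Longrightarrow> expectation (\<lambda>\<omega>. (\<epsilon> \<omega> $ i) ^ 4) \<le> m"
    and x: "0 < x"
  shows "prob {\<omega> \<in> space M. real n * x \<le>
      \<bar>(resid_mat lam (X \<omega>) *\<^sub>v \<epsilon> \<omega>) \<bullet> (resid_mat lam (X \<omega>) *\<^sub>v (X \<omega> *\<^sub>v b))\<bar>}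
    \<le> 3 * m\<^sup>2 * (lam / 2 * r\<^sup>2)\<^sup>2 / x ^ 4 * real n powr (- 2)" (is "_ \<le> ?c")
proof -
  define f where "f z = (resid_mat lam (fst z) *\<^sub>v snd z) \<bullet> (resid_mat lam (fst z) *\<^sub>v (fst z *\<^sub>v b))"
    for z :: "real mat \<times> real vec"
  let ?N = "mat_borel n p \<Otimes>\<^sub>M vec_borel n"
  have R: "(\<lambda>z. resid_mat lam (fst z)) \<in> measurable ?N (mat_borel n n)"
    by (rule measurable_resid_mat[OF lam measurable_fst])
  have bm: "(\<lambda>z. b) \<in> measurable ?N (vec_borel p)" by (simp add: space_vec_borel b)
  have fm[measurable]: "f \<in> borel_measurable ?N"
    unfolding f_def
    by (intro measurable_scalar_prod[of _ _ n] measurable_mult_mat_vec[OF R] measurable_snd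
        measurable_mult_mat_vec[OF measurable_fst bm])
  define B where "B = {z \<in> space ?N. real n * x \<le> \<bar>f z\<bar>}"
  have B: "B \<in> sets ?N" unfolding B_def by measurable
  have Xm: "X \<in> measurable M (mat_borel n p)" and em: "\<epsilon> \<in> measurable M (vec_borel n)"
    using ind by (auto simp: indep_rv_def)
  have Xc: "X \<omega> \<in> carrier_mat n p" and ec: "\<epsilon> \<omega> \<in> carrier_vec n" if "\<omega> \<in> space M" for \<omega>
    using Xm em that by (auto simp: measurable_mat_borel_iff measurable_vec_borel_iff)
  have inB: "(X \<omega>, \<epsilon> \<omega>') \<in> B \<longleftrightarrow> real n * x \<le> \<bar>f (X \<omega>, \<epsilon> \<omega>')\<bar>"
    if "\<omega> \<in> space M" "\<omega>' \<in> space M" for \<omega> \<omega>'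
    using Xc ec that by (simp add: B_def space_pair_measure space_mat_borel space_vec_borel)
  have "prob {\<omega>' \<in> space M. (X \<omega>, \<epsilon> \<omega>') \<in> B} \<le> ?c" if w: "\<omega> \<in> space M" for \<omega>
  proof -
    define c where "c = resid_mat lam (X \<omega>) *\<^sub>v (resid_mat lam (X \<omega>) *\<^sub>v (X \<omega> *\<^sub>v b))"
    note c = resid_cross_sum[OF lam Xc[OF w] _ b, folded c_def]
    have c_sq: "(\<Sum>i<n. (c $ i)\<^sup>2) \<le> lam / 2 * r\<^sup>2 * real n" using c(2)[OF ec[OF w]] by (simp add: bb)
    have "prob {\<omega>' \<in> space M. real n * x \<le> \<bar>\<Sum>i<n. c $ i * \<epsilon> \<omega>' $ i\<bar>} \<le> ?c"
      by (rule linear_form_tail[OF n comp m mean int4 mom4 c_sq x])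
    also have "{\<omega>' \<in> space M. real n * x \<le> \<bar>\<Sum>i<n. c $ i * \<epsilon> \<omega>' $ i\<bar>}
      = {\<omega>' \<in> space M. (X \<omega>, \<epsilon> \<omega>') \<in> B}"
      using w ec by (auto simp: inB f_def c(1))
    finally show ?thesis .
  qed
  then have "prob {\<omega> \<in> space M. (X \<omega>, \<epsilon> \<omega>) \<in> B} \<le> ?c"
    by (intro indep_rv_prob_le[OF indep_rv_commute[OF ind] B] AE_I2)
  moreover have "{\<omega> \<in> space M. (X \<omega>, \<epsilon> \<omega>) \<in> B} = {\<omega> \<in> space M. real n * x \<le> \<bar>f (X \<omega>, \<epsilon> \<omega>)\<bar>}"
    using inB by auto
  ultimately show ?thesis by (simp add: f_def)
qed

text \<open>Independent uniform signs in the first \<open>p\<close> coordinates and the value \<open>0\<close> in all others, so that the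
support is finite.\<close>

definition sign_pmf :: "nat \<Rightarrow> (nat \<Rightarrow> real) pmf" where
  "sign_pmf p = Pi_pmf {..<p} 0 (\<lambda>_. pmf_of_set {-1, 1})"

lemma sign_pmf_support:
  shows "finite (set_pmf (sign_pmf p))"
    and "f \<in> set_pmf (sign_pmf p) \<Longrightarrow> i < p \<Longrightarrow> f i = -1 \<or> f i = 1"
proof -
  have eq: "set_pmf (sign_pmf p) = PiE_dflt {..<p} 0 (\<lambda>_. {-1, 1})"
    by (simp add: sign_pmf_def set_Pi_pmf comp_def)
  show "finite (set_pmf (sign_pmf p))" unfolding eq by (intro finite_PiE_dflt) auto
  show "f \<in> set_pmf (sign_pmf p) \<Longrightarrow> i < p \<Longrightarrow> f i = -1 \<or> f i = 1"
    unfolding eq by (auto simp: PiE_dflt_def)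
qed

lemma sign_pmf_expectation:
  assumes "i < p"
  shows "measure_pmf.expectation (sign_pmf p) (\<lambda>f. h (f i)) = (h (-1) + h 1) / (2 :: real)"
proof -
  have "measure_pmf.expectation (sign_pmf p) (\<lambda>f. h (f i))
      = measure_pmf.expectation (map_pmf (\<lambda>f. f i) (sign_pmf p)) h" by simp
  also have "map_pmf (\<lambda>f. f i) (sign_pmf p) = pmf_of_set {-1, 1}"
    using assms by (simp add: sign_pmf_def Pi_pmf_component)
  finally show ?thesis by (simp add: integral_pmf_of_set)
qed

lemma sign_quadratic_form_tail:
  fixes a :: "nat \<Rightarrow> nat \<Rightarrow> real"
  assumes s: "1 \<le> s" "s \<le> 2" and p: "0 < p" and x: "0 < x"
    and sym: "\<And>i j. i < p \<Longrightarrow> j < p \<Longrightarrow> a i j = a j i"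
    and row: "\<And>i. i < p \<Longrightarrow> (\<Sum>j<p. (a i j)\<^sup>2) \<le> 1"
  shows "measure_pmf.prob (sign_pmf p)
      {f. real p * x \<le> \<bar>(\<Sum>i<p. \<Sum>j<p. a i j * f i * f j) - (\<Sum>i<p. a i i)\<bar>}
    \<le> exp 24 * (1 + 24 * 2080) / (x\<^sup>2) powr s * real p powr (- s)"
proof -
  have "prob_space.indep_vars (measure_pmf (sign_pmf p)) (\<lambda>_. borel) (\<lambda>i f. id (f i)) {..<p}"
    unfolding sign_pmf_def
    by (rule prob_space.indep_vars_compose2[OF measure_pmf.prob_space_axioms indep_vars_Pi_pmf]) auto
  then have ind: "prob_space.indep_vars (measure_pmf (sign_pmf p)) (\<lambda>_. borel) (\<lambda>i f. f i) {..<p}"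
    by simp
  have int: "integrable (measure_pmf (sign_pmf p)) g" for g :: "(nat \<Rightarrow> real) \<Rightarrow> real"
    by (rule integrable_measure_pmf_finite[OF sign_pmf_support(1)])
  note E = sign_pmf_expectation[of _ p]
  have "measure_pmf.prob (sign_pmf p) {f \<in> space (measure_pmf (sign_pmf p)). real p * x \<le>
      \<bar>(\<Sum>i<p. \<Sum>j<p. a i j * f i * f j) - 1\<^sup>2 * (\<Sum>i<p. a i i)\<bar>}
    \<le> exp 24 * (1 + 24 * (2080 * 1 ^ 3)) / (x\<^sup>2) powr s * real p powr (- s)"
  proof (rule prob_space.quadratic_form_tail[OF measure_pmf.prob_space_axioms s p ind order_refl])
    fix i assume i: "i < p"
    show "measure_pmf.expectation (sign_pmf p) (\<lambda>f. f i) = 0" using E[OF i, of "\<lambda>x. x"] by simp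
    show "measure_pmf.expectation (sign_pmf p) (\<lambda>f. (f i)\<^sup>2) = 1\<^sup>2" using E[OF i, of "\<lambda>x. x\<^sup>2"] by simp
    show "measure_pmf.expectation (sign_pmf p) (\<lambda>f. f i ^ 4) \<le> 1" using E[OF i, of "\<lambda>x. x ^ 4"] by simp
    show "measure_pmf.expectation (sign_pmf p) (\<lambda>f. (f i ^ 4) powr s) \<le> 1"
      using E[OF i, of "\<lambda>x. (x ^ 4) powr s"] by simp
  qed (use int sym row x in auto)
  then show ?thesis by simp
qed

text \<open>For every vector \<open>f\<close> of signs some orthogonal matrix takes the rescaled \<open>f\<close> to \<open>b\<close>, and it changes
neither the law of \<open>X\<close> nor the trace. So the probability in question is the same for \<open>b\<close> and for each
rescaled \<open>f\<close>, and equals its average over \<open>f\<close>. After exchanging this average with the expectation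
over \<open>X\<close>, the design is fixed and \<open>f\<close> is random, and the deviation becomes a quadratic form in signs.

The factor \<open>1 + r\<^sup>2\<close> in place of \<open>r\<^sup>2\<close> covers the case \<open>r = 0\<close>.\<close>

lemma right_rot_signal_tail:
  fixes M :: "'w measure"
  assumes prob: "prob_space M" and lam: "lam > 0" and s: "1 \<le> s" "s \<le> 2"
    and n: "0 < n" and p: "0 < p" and x: "0 < x"
    and rot: "right_rot_invariant M n p X"
    and b: "b \<in> carrier_vec p" and bb: "b \<bullet> b = r\<^sup>2 * real n"
  shows "measure M {\<omega> \<in> space M. x \<le> \<bar>signal_energy lam (X \<omega>) b / n - r\<^sup>2 * signal_trace lam (X \<omega>) / p\<bar>}
    \<le> exp 24 * (1 + 24 * 2080) / ((x / ((1 + r\<^sup>2) * lam))\<^sup>2) powr s * real p powr (- s)"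
proof -
  interpret prob_space M by (rule prob)
  define x' where "x' = x / ((1 + r\<^sup>2) * lam)"
  have r1: "0 < 1 + r\<^sup>2" by (simp add: add_pos_nonneg)
  have x': "0 < x'" using x lam r1 by (simp add: x'_def)
  define c where "c = exp 24 * (1 + 24 * 2080) / (x'\<^sup>2) powr s * real p powr (- s)"
  define F where "F A v = \<bar>signal_energy lam A v / n - r\<^sup>2 * signal_trace lam A / p\<bar>" for A v
  define vf where "vf f = (r * sqrt (n / p)) \<cdot>\<^sub>v vec p f" for f :: "nat \<Rightarrow> real"
  have X[measurable]: "X \<in> measurable M (mat_borel n p)" using rot by (simp add: right_rot_invariant_def)
  have Xc: "X \<omega> \<in> carrier_mat n p" if "\<omega> \<in> space M" for \<omega>
    using X that by (auto simp: measurable_mat_borel_iff)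
  have Fm: "(\<lambda>A. F A v) \<in> borel_measurable (mat_borel n p)" if v: "v \<in> carrier_vec p" for v
    unfolding F_def
    by (intro borel_measurable_abs borel_measurable_diff borel_measurable_divide borel_measurable_times
        borel_measurable_const measurable_signal_energy[OF lam, of _ _ n p] measurable_signal_trace[OF lam, of _ _ n p]
        measurable_ident measurable_const) (auto simp: space_vec_borel v)
  define G where "G f = {\<omega> \<in> space M. x \<le> F (X \<omega>) (vf f)}" for f
  have vfc: "vf f \<in> carrier_vec p" for f by (simp add: vf_def)
  have same: "prob {\<omega> \<in> space M. x \<le> F (X \<omega>) b} = prob (G f)" if f: "f \<in> set_pmf (sign_pmf p)" for f
  proof -
    have "f i * f i = 1" if "i < p" for i using sign_pmf_support(2)[OF f that] by auto
    then have "vec p f \<bullet> vec p f = real p" by (simp add: scalar_prod_def)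
    then have "vf f \<bullet> vf f = (r * sqrt (n / p))\<^sup>2 * real p" by (simp add: vf_def power2_eq_square)
    also have "\<dots> = b \<bullet> b" using p by (simp add: bb power_mult_distrib)
    finally obtain U where U: "orth_mat p U" and Ub: "U *\<^sub>v vf f = b"
      using orth_mat_moves_vector[OF b vfc] by metis
    have Uc: "U \<in> carrier_mat p p" using U by (simp add: orth_mat_def)
    have XU: "(\<lambda>\<omega>. X \<omega> * U) \<in> measurable M (mat_borel n p)"
      using Uc by (intro measurable_mat_mult[of _ _ n p] X measurable_const) (simp add: space_mat_borel)
    define H where "H = {A \<in> space (mat_borel n p). x \<le> F A (vf f)}"
    have H: "H \<in> sets (mat_borel n p)" unfolding H_def using Fm[OF vfc] by measurable
    have FU: "F (X \<omega> * U) (vf f) = F (X \<omega>) b" if "\<omega> \<in> space M" for \<omega>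
      using signal_energy_orth[OF lam Xc[OF that] U vfc] by (simp add: F_def Ub)
    have "prob {\<omega> \<in> space M. x \<le> F (X \<omega>) b} = measure (distr M (mat_borel n p) (\<lambda>\<omega>. X \<omega> * U)) H"
      using measurable_space[OF XU] FU
      by (subst measure_distr[OF XU H]) (auto intro!: arg_cong[where f = prob] simp: H_def)
    also have "\<dots> = measure (distr M (mat_borel n p) X) H"
      using rot U by (simp add: right_rot_invariant_def)
    also have "\<dots> = prob (G f)"
      using measurable_space[OF X]
      by (subst measure_distr[OF X H]) (auto intro!: arg_cong[where f = prob] simp: H_def G_def)
    finally show ?thesis .
  qed
  have Gs: "G f \<in> sets M" for f
    unfolding G_def using measurable_compose[OF X Fm[OF vfc[of f]]] by measurable
  have Gi: "integrable M (indicat_real (G f))" for f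
    using Gs by (intro integrable_real_indicator) (auto simp: emeasure_eq_measure)
  have pt: "(\<Sum>f\<in>set_pmf (sign_pmf p). pmf (sign_pmf p) f * indicator (G f) \<omega>) \<le> c" if w: "\<omega> \<in> space M" for \<omega>
  proof -
    obtain a where sym: "\<And>i j. i < p \<Longrightarrow> j < p \<Longrightarrow> a i j = a j i"
      and row: "\<And>i. i < p \<Longrightarrow> (\<Sum>j<p. (a i j)\<^sup>2) \<le> 1"
      and diag: "(\<Sum>i<p. a i i) = signal_trace lam (X \<omega>) / lam"
      and quad: "\<And>v. v \<in> carrier_vec p \<Longrightarrow>
        signal_energy lam (X \<omega>) v / lam = (\<Sum>i<p. \<Sum>j<p. a i j * v $ i * v $ j)"
      using signal_entries[OF lam Xc[OF w]] by blast
    define q where "q f = (\<Sum>i<p. \<Sum>j<p. a i j * f i * f j) - (\<Sum>i<p. a i i)" for f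
    have "(\<Sum>f\<in>set_pmf (sign_pmf p). pmf (sign_pmf p) f * indicator (G f) \<omega>)
        = (\<Sum>f\<in>{f \<in> set_pmf (sign_pmf p). \<omega> \<in> G f}. pmf (sign_pmf p) f)"
      unfolding sum.inter_filter[OF sign_pmf_support(1)] by (intro sum.cong) auto
    also have "\<dots> = measure_pmf.prob (sign_pmf p) {f \<in> set_pmf (sign_pmf p). \<omega> \<in> G f}"
      using sign_pmf_support(1) by (intro measure_measure_pmf_finite[symmetric]) auto
    also have "\<dots> \<le> measure_pmf.prob (sign_pmf p) {f. real p * x' \<le> \<bar>q f\<bar>}"
    proof (intro measure_pmf.finite_measure_mono, safe)
      fix f assume "\<omega> \<in> G f"
      then have "x \<le> F (X \<omega>) (vf f)" by (simp add: G_def)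
      also have "F (X \<omega>) (vf f) = r\<^sup>2 * lam / p * \<bar>q f\<bar>"
      proof -
        have "signal_energy lam (X \<omega>) (vec p f) = lam * (\<Sum>i<p. \<Sum>j<p. a i j * f i * f j)"
          using quad[of "vec p f"] lam by (simp add: field_simps)
        moreover have "signal_trace lam (X \<omega>) = lam * (\<Sum>i<p. a i i)" using diag lam by (simp add: field_simps)
        ultimately have "signal_energy lam (X \<omega>) (vf f) / n - r\<^sup>2 * signal_trace lam (X \<omega>) / p
            = r\<^sup>2 * lam / p * q f"
          using n p by (simp add: vf_def signal_energy_smult[OF lam Xc[OF w]] q_def power_mult_distrib field_simps)
        then show ?thesis using lam by (simp add: F_def abs_mult)
      qed
      also have "\<dots> \<le> (1 + r\<^sup>2) * lam / p * \<bar>q f\<bar>"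
        using lam by (intro mult_right_mono divide_right_mono) auto
      finally have "x \<le> (1 + r\<^sup>2) * lam / p * \<bar>q f\<bar>" .
      moreover have "x = (1 + r\<^sup>2) * lam * x'" using r1 lam by (simp add: x'_def)
      ultimately have "(1 + r\<^sup>2) * lam * x' \<le> (1 + r\<^sup>2) * lam * (\<bar>q f\<bar> / p)" by simp
      then have "x' \<le> \<bar>q f\<bar> / p" using r1 lam by (simp only: mult_le_cancel_left_pos mult_pos_pos)
      then show "real p * x' \<le> \<bar>q f\<bar>" using p by (simp add: field_simps)
    qed auto
    also have "\<dots> \<le> c"
      unfolding q_def c_def by (rule sign_quadratic_form_tail[OF s p x' sym row])
    finally show ?thesis .
  qed
  have "prob {\<omega> \<in> space M. x \<le> F (X \<omega>) b}
      = (\<Sum>f\<in>set_pmf (sign_pmf p). pmf (sign_pmf p) f * prob {\<omega> \<in> space M. x \<le> F (X \<omega>) b})"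
    by (simp add: sum_distrib_right[symmetric] sum_pmf_eq_1[OF sign_pmf_support(1)])
  also have "\<dots> = (\<Sum>f\<in>set_pmf (sign_pmf p). pmf (sign_pmf p) f * prob (G f))"
    by (intro sum.cong) (auto simp: same)
  also have "\<dots> = expectation (\<lambda>\<omega>. \<Sum>f\<in>set_pmf (sign_pmf p). pmf (sign_pmf p) f * indicator (G f) \<omega>)"
    using Gs Gi by (subst Bochner_Integration.integral_sum) auto
  also have "\<dots> \<le> expectation (\<lambda>\<omega>. c)"
    using Gi pt by (intro integral_mono) auto
  also have "\<dots> = c" by (simp add: prob_space)
  finally show ?thesis by (simp add: F_def c_def x'_def)
qed

section \<open>Almost sure convergence\<close>

text \<open>Borel--Cantelli for each of the thresholds \<open>1 / (k + 1)\<close>.\<close>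

lemma (in prob_space) AE_tendsto_0_of_tails:
  fixes Z :: "nat \<Rightarrow> 'a \<Rightarrow> real"
  assumes Zm: "\<And>n. 0 < n \<Longrightarrow> Z n \<in> borel_measurable M" and s: "1 < s"
    and tail: "\<And>x. 0 < x \<Longrightarrow> \<exists>C. eventually (\<lambda>n.
      prob {\<omega> \<in> space M. x \<le> \<bar>Z n \<omega>\<bar>} \<le> C * real n powr (- s)) sequentially"
  shows "AE \<omega> in M. (\<lambda>n. Z n \<omega>) \<longlonglongrightarrow> 0"
proof -
  have ev: "AE \<omega> in M. eventually (\<lambda>n. \<bar>Z n \<omega>\<bar> < x) sequentially" if x: "0 < x" for x
  proof -
    obtain C where "eventually (\<lambda>n. prob {\<omega> \<in> space M. x \<le> \<bar>Z n \<omega>\<bar>} \<le> C * real n powr (- s)) sequentially"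
      using tail[OF x] by blast
    define A where "A n = (if n = 0 then {} else {\<omega> \<in> space M. x \<le> \<bar>Z n \<omega>\<bar>})" for n
    have As: "A n \<in> sets M" for n using Zm[of n] unfolding A_def by (cases "n = 0") auto
    have "summable (\<lambda>n. C * real n powr (- s))" using s by (intro summable_mult) (simp add: summable_real_powr_iff)
    then have "summable (\<lambda>n. prob (A n))"
    proof (rule summable_comparison_test_ev[rotated])
      show "eventually (\<lambda>n. norm (prob (A n)) \<le> C * real n powr (- s)) sequentially"
        using \<open>eventually (\<lambda>n. prob {\<omega> \<in> space M. x \<le> \<bar>Z n \<omega>\<bar>} \<le> C * real n powr (- s)) sequentially\<close>
          eventually_gt_at_top[of 0] by eventually_elim (simp add: A_def)
    qed
    then have "AE \<omega> in M. eventually (\<lambda>n. \<omega> \<in> space M - A n) sequentially"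
      by (intro borel_cantelli_AE1 As) (auto simp: emeasure_eq_measure)
    then show ?thesis
    proof eventually_elim
      case (elim \<omega>)
      then show ?case using eventually_gt_at_top[of 0] by eventually_elim (auto simp: A_def split: if_splits)
    qed
  qed
  have "AE \<omega> in M. \<forall>k. eventually (\<lambda>n. \<bar>Z n \<omega>\<bar> < 1 / real (Suc k)) sequentially"
    unfolding AE_all_countable by (intro allI ev) simp
  then show ?thesis
  proof eventually_elim
    case (elim \<omega>)
    show ?case
    proof (rule tendstoI)
      fix e :: real assume "0 < e"
      then obtain k where "1 / real (Suc k) < e" using nat_approx_posE by blast
      then show "eventually (\<lambda>n. dist (Z n \<omega>) 0 < e) sequentially"
        using elim[rule_format, of k] by (auto elim!: eventually_mono)
    qed
  qed
qed

text \<open>Bounds the fourth moment (\<open>a = 1\<close>) and the moment of order \<open>4 s\<close> (\<open>a = s\<close>) of the noise by its moment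
of order \<open>4 + \<eta>\<close>.\<close>

lemma powr_fourth_le:
  fixes x :: real
  assumes "0 \<le> a" "4 * a \<le> 4 + \<eta>"
  shows "(x ^ 4) powr a \<le> 1 + \<bar>x\<bar> powr (4 + \<eta>)"
proof (cases "\<bar>x\<bar> \<le> 1")
  case True
  then have "\<bar>x\<bar> ^ 4 \<le> 1" by (intro power_le_one) auto
  then have "(x ^ 4) powr a \<le> 1" using assms by (intro powr_le1) auto
  then show ?thesis by (simp add: add_increasing2)
next
  case False
  have fourth: "\<bar>x\<bar> powr 4 = x ^ 4" using False by (simp add: powr_numeral)
  have "(x ^ 4) powr a = \<bar>x\<bar> powr (4 * a)"
    using powr_powr[of "\<bar>x\<bar>" 4 a] by (simp only: fourth)
  also have "\<dots> \<le> \<bar>x\<bar> powr (4 + \<eta>)" using False assms by (intro powr_mono) auto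
  finally show ?thesis by simp
qed

text \<open>The deterministic part of the argument. Besides the three random errors, the only difference between
GCV and its limit is \<open>n / p\<close> in place of \<open>1 / \<gamma>\<close>; its coefficient \<open>(v - \<lambda> v') / v\<^sup>2\<close> is bounded because
\<open>0 \<le> v - \<lambda> v' \<le> v\<close>.\<close>

lemma GCV_error_bound:
  fixes r \<sigma> :: real
  assumes lam: "lam > 0" and n: "n > 0" and p: "p > 0" and g: "\<gamma> > 0" and svd: "is_svd n p A Q D W"
    and b: "b \<in> carrier_vec p" and e: "e \<in> carrier_vec n" and v0: "0 < v0" "v0 \<le> v_D D (- lam)"
  defines "z1 \<equiv> signal_energy lam A b / n - r\<^sup>2 * signal_trace lam A / p"
    and "z2 \<equiv> ((resid_mat lam A *\<^sub>v e) \<bullet> (resid_mat lam A *\<^sub>v (A *\<^sub>v b))) / n"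
    and "z3 \<equiv> ((resid_mat lam A *\<^sub>v e) \<bullet> (resid_mat lam A *\<^sub>v e)
      - \<sigma>\<^sup>2 * mat_trace (resid_mat lam A * resid_mat lam A)) / n"
  shows "\<bar>GCV lam A (A *\<^sub>v b + e)
        - (r\<^sup>2 * (v_D D (-lam) - lam * deriv (v_D D) (-lam)) + \<sigma>\<^sup>2 * \<gamma> * deriv (v_D D) (-lam))
          / (\<gamma> * (v_D D (-lam))\<^sup>2)\<bar>
    \<le> (\<bar>z1\<bar> + 2 * \<bar>z2\<bar> + \<bar>z3\<bar>) / (lam * v0)\<^sup>2 + r\<^sup>2 * \<bar>real n / real p - 1 / \<gamma>\<bar> / v0"
proof -
  define v where "v = v_D D (- lam)"
  define v' where "v' = deriv (v_D D) (- lam)"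
  have v: "0 < v" "v0 \<le> v" using v0 by (auto simp: v_def)
  have d: "0 \<le> v - lam * v'" "v - lam * v' \<le> v"
    using deriv_v_D_bounds[OF lam, of D] lam by (auto simp: v_def v'_def)
  note tr = svd_resid_traces[OF lam n svd, folded v_def v'_def]
  have st: "signal_trace lam A = lam\<^sup>2 * real n * (v - lam * v')"
    by (simp add: signal_trace_def tr power2_eq_square algebra_simps)
  have e1: "signal_energy lam A b / n = z1 + lam\<^sup>2 * (r\<^sup>2 * (real n / real p) * (v - lam * v'))"
    using p by (simp add: z1_def st)
  have e3: "((resid_mat lam A *\<^sub>v e) \<bullet> (resid_mat lam A *\<^sub>v e)) / n = z3 + lam\<^sup>2 * (\<sigma>\<^sup>2 * v')"
    using n by (simp add: z3_def tr diff_divide_distrib)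
  have "GCV lam A (A *\<^sub>v b + e) = (signal_energy lam A b / n
      + 2 * (((resid_mat lam A *\<^sub>v e) \<bullet> (resid_mat lam A *\<^sub>v (A *\<^sub>v b))) / n)
      + ((resid_mat lam A *\<^sub>v e) \<bullet> (resid_mat lam A *\<^sub>v e)) / n) / (lam * v)\<^sup>2"
    unfolding GCV_decomposition[OF lam n svd b e] v_def by (simp add: add_divide_distrib)
  also have "\<dots> = (z1 + 2 * z2 + z3
      + lam\<^sup>2 * (r\<^sup>2 * (real n / real p) * (v - lam * v') + \<sigma>\<^sup>2 * v')) / (lam * v)\<^sup>2"
    unfolding e1 e3 z2_def[symmetric] by (simp add: distrib_left)
  also have "\<dots> = (z1 + 2 * z2 + z3) / (lam * v)\<^sup>2
      + (r\<^sup>2 * (real n / real p) * (v - lam * v') + \<sigma>\<^sup>2 * v') / v\<^sup>2"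
    using lam v(1) by (simp add: add_divide_distrib power_mult_distrib)
  finally have G: "GCV lam A (A *\<^sub>v b + e) = (z1 + 2 * z2 + z3) / (lam * v)\<^sup>2
      + (r\<^sup>2 * (real n / real p) * (v - lam * v') + \<sigma>\<^sup>2 * v') / v\<^sup>2" .
  have t: "(r\<^sup>2 * (v - lam * v') + \<sigma>\<^sup>2 * \<gamma> * v') / (\<gamma> * v\<^sup>2)
      = (r\<^sup>2 * (1 / \<gamma>) * (v - lam * v') + \<sigma>\<^sup>2 * v') / v\<^sup>2"
    using g v(1) by (simp add: field_simps)
  have "GCV lam A (A *\<^sub>v b + e) - (r\<^sup>2 * (v - lam * v') + \<sigma>\<^sup>2 * \<gamma> * v') / (\<gamma> * v\<^sup>2)
      = (z1 + 2 * z2 + z3) / (lam * v)\<^sup>2 + r\<^sup>2 * (real n / real p - 1 / \<gamma>) * ((v - lam * v') / v\<^sup>2)"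
    unfolding G t by (simp add: diff_divide_distrib add_divide_distrib algebra_simps)
  also have "\<bar>\<dots>\<bar> \<le> \<bar>z1 + 2 * z2 + z3\<bar> / (lam * v)\<^sup>2
      + r\<^sup>2 * \<bar>real n / real p - 1 / \<gamma>\<bar> * \<bar>(v - lam * v') / v\<^sup>2\<bar>"
    by (rule order_trans[OF abs_triangle_ineq]) (simp add: abs_mult)
  also have "\<dots> \<le> (\<bar>z1\<bar> + 2 * \<bar>z2\<bar> + \<bar>z3\<bar>) / (lam * v0)\<^sup>2
      + r\<^sup>2 * \<bar>real n / real p - 1 / \<gamma>\<bar> * (1 / v0)"
  proof (intro add_mono mult_left_mono frac_le)
    show "(lam * v0)\<^sup>2 \<le> (lam * v)\<^sup>2" using lam v v0 by (intro power_mono mult_left_mono) auto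
    have "\<bar>(v - lam * v') / v\<^sup>2\<bar> \<le> v / v\<^sup>2" using d v by (simp add: divide_right_mono)
    also have "\<dots> = 1 / v" using v by (simp add: power2_eq_square)
    also have "\<dots> \<le> 1 / v0" using v v0 by (simp add: frac_le)
    finally show "\<bar>(v - lam * v') / v\<^sup>2\<bar> \<le> 1 / v0" .
  qed (use lam v0 in auto)
  finally show ?thesis by (simp add: v_def v'_def)
qed

theorem theorem1:
  fixes M :: "'w measure"
    and p :: "nat \<Rightarrow> nat"
    and X Q D W :: "nat \<Rightarrow> 'w \<Rightarrow> real mat"
    and \<beta> \<epsilon> y :: "nat \<Rightarrow> 'w \<Rightarrow> real vec"
    and \<gamma> r \<sigma> \<eta> K C lam :: real
  assumes prob: "prob_space M"
    and gamma: "\<gamma> > 0" "(\<lambda>n. real (p n) / real n) \<longlonglongrightarrow> \<gamma>"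
    and X_inv: "\<And>n. n > 0 \<Longrightarrow> right_rot_invariant M n (p n) (X n)"
    and svd_meas: "\<And>n. n > 0 \<Longrightarrow> Q n \<in> measurable M (mat_borel n n)"
      "\<And>n. n > 0 \<Longrightarrow> D n \<in> measurable M (mat_borel n (p n))"
      "\<And>n. n > 0 \<Longrightarrow> W n \<in> measurable M (mat_borel (p n) (p n))"
    and svd: "\<And>n \<omega>. n > 0 \<Longrightarrow> \<omega> \<in> space M \<Longrightarrow>
      is_svd n (p n) (X n \<omega>) (Q n \<omega>) (D n \<omega>) (W n \<omega>)"
    and D_bound: "AE \<omega> in M. limsup (\<lambda>n. ereal (max_sv (D n \<omega>))) < ereal C"
    and y: "\<And>n \<omega>. n > 0 \<Longrightarrow> \<omega> \<in> space M \<Longrightarrow> y n \<omega> = X n \<omega> *\<^sub>v \<beta> n \<omega> + \<epsilon> n \<omega>"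
    and r: "r \<ge> 0"
    and beta_norm: "\<And>n. n > 0 \<Longrightarrow> AE \<omega> in M. vec_norm2 (\<beta> n \<omega>) = r * sqrt (real n)"
    and beta_indep: "\<And>n. n > 0 \<Longrightarrow>
      indep_rv M (vec_borel (p n)) (\<beta> n)
        (mat_borel n (p n) \<Otimes>\<^sub>M vec_borel n) (\<lambda>\<omega>. (X n \<omega>, \<epsilon> n \<omega>))"
    and eps_indep_X: "\<And>n. n > 0 \<Longrightarrow>
      indep_rv M (vec_borel n) (\<epsilon> n) (mat_borel n (p n)) (X n)"
    and eps_indep: "\<And>n. n > 0 \<Longrightarrow>
      prob_space.indep_vars M (\<lambda>_. borel) (\<lambda>i \<omega>. \<epsilon> n \<omega> $ i) {..<n}"
    and eps_mean: "\<And>n i. i < n \<Longrightarrow> prob_space.expectation M (\<lambda>\<omega>. \<epsilon> n \<omega> $ i) = 0"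
    and eps_var: "\<And>n i. i < n \<Longrightarrow> prob_space.expectation M (\<lambda>\<omega>. (\<epsilon> n \<omega> $ i)\<^sup>2) = \<sigma>\<^sup>2"
    and eta: "\<eta> > 0"
    and eps_moment: "\<And>n i. i < n \<Longrightarrow> integrable M (\<lambda>\<omega>. \<bar>\<epsilon> n \<omega> $ i\<bar> powr (4 + \<eta>))"
      "\<And>n i. i < n \<Longrightarrow> prob_space.expectation M (\<lambda>\<omega>. \<bar>\<epsilon> n \<omega> $ i\<bar> powr (4 + \<eta>)) \<le> K"
    and lam: "lam > 0"
  shows "AE \<omega> in M.
    (\<lambda>n. GCV lam (X n \<omega>) (y n \<omega>)
        - (r\<^sup>2 * (v_D (D n \<omega>) (-lam) - lam * deriv (v_D (D n \<omega>)) (-lam))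
            + \<sigma>\<^sup>2 * \<gamma> * deriv (v_D (D n \<omega>)) (-lam))
          / (\<gamma> * (v_D (D n \<omega>) (-lam))\<^sup>2))
      \<longlonglongrightarrow> 0"
proof -
  interpret prob_space M by (rule prob)
  \<comment> \<open>Moments of order \<open>4 s\<close> are available since \<open>4 s \<le> 4 + \<eta>\<close>; capping \<open>\<eta>\<close> at \<open>4\<close> gives \<open>s \<le> 2\<close>.\<close>
  define s where "s = 1 + min \<eta> 4 / 4"
  have s: "1 < s" "1 \<le> s" "s \<le> 2" "0 \<le> s" "4 * s \<le> 4 + \<eta>" using eta by (auto simp: s_def)
  define m where "m = 1 + \<bar>K\<bar> + (\<sigma> ^ 4) powr s"
  have m: "1 \<le> m" "(\<sigma> ^ 4) powr s \<le> m" "1 + K \<le> m" by (auto simp: m_def add_increasing2)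
  have Xm: "X n \<in> measurable M (mat_borel n (p n))" if "n > 0" for n
    using X_inv[OF that] by (simp add: right_rot_invariant_def)
  have em: "\<epsilon> n \<in> measurable M (vec_borel n)" if "n > 0" for n
    using eps_indep_X[OF that] by (simp add: indep_rv_def)
  have bm: "\<beta> n \<in> measurable M (vec_borel (p n))" if "n > 0" for n
    using beta_indep[OF that] by (simp add: indep_rv_def)
  have Xc: "X n \<omega> \<in> carrier_mat n (p n)" and ec: "\<epsilon> n \<omega> \<in> carrier_vec n" and bc: "\<beta> n \<omega> \<in> carrier_vec (p n)"
    if "n > 0" "\<omega> \<in> space M" for n \<omega>
    using Xm em bm that by (auto simp: measurable_mat_borel_iff measurable_vec_borel_iff)
  have moments: "integrable M (\<lambda>\<omega>. ((\<epsilon> n \<omega> $ i) ^ 4) powr a)" "expectation (\<lambda>\<omega>. ((\<epsilon> n \<omega> $ i) ^ 4) powr a) \<le> m"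
    if i: "i < n" and a: "0 \<le> a" "4 * a \<le> 4 + \<eta>" for n i a
  proof -
    have "(\<lambda>\<omega>. \<epsilon> n \<omega> $ i) \<in> borel_measurable M"
      using em[of n] i by (auto simp: measurable_vec_borel_iff)
    then have meas: "(\<lambda>\<omega>. ((\<epsilon> n \<omega> $ i) ^ 4) powr a) \<in> borel_measurable M" by measurable
    have int: "integrable M (\<lambda>\<omega>. 1 + \<bar>\<epsilon> n \<omega> $ i\<bar> powr (4 + \<eta>))" using eps_moment(1)[OF i] by simp
    show *: "integrable M (\<lambda>\<omega>. ((\<epsilon> n \<omega> $ i) ^ 4) powr a)"
      by (rule Bochner_Integration.integrable_bound[OF int meas]) (use powr_fourth_le[OF a] in auto)
    have "expectation (\<lambda>\<omega>. ((\<epsilon> n \<omega> $ i) ^ 4) powr a) \<le> expectation (\<lambda>\<omega>. 1 + \<bar>\<epsilon> n \<omega> $ i\<bar> powr (4 + \<eta>))"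
      by (intro integral_mono * int powr_fourth_le[OF a])
    also have "\<dots> \<le> 1 + K" using eps_moment[OF i] by (simp add: prob_space)
    finally show "expectation (\<lambda>\<omega>. ((\<epsilon> n \<omega> $ i) ^ 4) powr a) \<le> m" using m by linarith
  qed
  have mom4: "integrable M (\<lambda>\<omega>. (\<epsilon> n \<omega> $ i) ^ 4)" "expectation (\<lambda>\<omega>. (\<epsilon> n \<omega> $ i) ^ 4) \<le> m" if i: "i < n" for n i
    using moments[OF i, of 1] eta by simp_all
  have mom4s: "integrable M (\<lambda>\<omega>. ((\<epsilon> n \<omega> $ i) ^ 4) powr s)" "expectation (\<lambda>\<omega>. ((\<epsilon> n \<omega> $ i) ^ 4) powr s) \<le> m"
    if i: "i < n" for n i
    using moments[OF i s(4,5)] by auto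
  have bb: "AE \<omega> in M. \<beta> n \<omega> \<bullet> \<beta> n \<omega> = r\<^sup>2 * real n" if n: "n > 0" for n
    using beta_norm[OF n]
  proof eventually_elim
    case (elim \<omega>)
    then have "(sqrt (\<beta> n \<omega> \<bullet> \<beta> n \<omega>))\<^sup>2 = (r * sqrt (real n))\<^sup>2" by (simp add: vec_norm2_def)
    then show ?case using scalar_prod_self_nonneg[of "\<beta> n \<omega>"] by (simp add: power_mult_distrib)
  qed
  define R where "R n \<omega> = resid_mat lam (X n \<omega>)" for n \<omega>
  define Z1 where "Z1 n \<omega> = signal_energy lam (X n \<omega>) (\<beta> n \<omega>) / real n
    - r\<^sup>2 * signal_trace lam (X n \<omega>) / real (p n)" for n \<omega>
  define Z2 where "Z2 n \<omega> = ((R n \<omega> *\<^sub>v \<epsilon> n \<omega>) \<bullet> (R n \<omega> *\<^sub>v (X n \<omega> *\<^sub>v \<beta> n \<omega>))) / real n" for n \<omega>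
  define Z3 where "Z3 n \<omega> = ((R n \<omega> *\<^sub>v \<epsilon> n \<omega>) \<bullet> (R n \<omega> *\<^sub>v \<epsilon> n \<omega>)
    - \<sigma>\<^sup>2 * mat_trace (R n \<omega> * R n \<omega>)) / real n" for n \<omega>
  have Rm: "R n \<in> measurable M (mat_borel n n)" if "n > 0" for n
    unfolding R_def by (rule measurable_resid_mat[OF lam Xm[OF that]])
  have Zm: "Z1 n \<in> borel_measurable M" "Z2 n \<in> borel_measurable M" "Z3 n \<in> borel_measurable M" if n: "n > 0" for n
    unfolding Z1_def Z2_def Z3_def
    by (intro borel_measurable_diff borel_measurable_divide borel_measurable_times borel_measurable_const
        measurable_signal_energy[OF lam Xm[OF n] bm[OF n]] measurable_signal_trace[OF lam Xm[OF n]]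
        measurable_scalar_prod[of _ _ n] measurable_mult_mat_vec[OF Rm[OF n]] measurable_mult_mat_vec[OF Xm[OF n] bm[OF n]]
        em[OF n] measurable_mat_trace[OF measurable_mat_mult[OF Rm[OF n] Rm[OF n]]])+
  \<comment> \<open>The signal tail is of order \<open>p\<^sup>-\<^sup>s\<close>; this converts it to order \<open>n\<^sup>-\<^sup>s\<close>.\<close>
  have p_large: "eventually (\<lambda>n. 0 < n \<and> \<gamma> / 2 * real n \<le> real (p n)) sequentially"
  proof -
    have "eventually (\<lambda>n. \<gamma> / 2 < real (p n) / real n) sequentially"
      using gamma by (intro order_tendstoD(1)[OF gamma(2)]) simp
    then show ?thesis using eventually_gt_at_top[of 0]
      by eventually_elim (simp add: field_simps)
  qed
  have Z1: "AE \<omega> in M. (\<lambda>n. Z1 n \<omega>) \<longlonglongrightarrow> 0"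
  proof (rule AE_tendsto_0_of_tails[OF Zm(1) s(1)])
    fix x :: real assume x: "0 < x"
    define c where "c = exp 24 * (1 + 24 * 2080) / ((x / ((1 + r\<^sup>2) * lam))\<^sup>2) powr s"
    have c0: "c \<ge> 0" by (simp add: c_def)
    have "eventually (\<lambda>n. prob {\<omega> \<in> space M. x \<le> \<bar>Z1 n \<omega>\<bar>} \<le> (c * (\<gamma> / 2) powr (- s)) * real n powr (- s)) sequentially"
      using p_large
    proof eventually_elim
      case (elim n)
      then have n: "0 < n" and pn: "\<gamma> / 2 * real n \<le> real (p n)" by auto
      have p: "0 < p n" using pn n gamma(1) by (cases "p n = 0") (auto simp: mult_le_0_iff)
      let ?N = "vec_borel (p n) \<Otimes>\<^sub>M (mat_borel n (p n) \<Otimes>\<^sub>M vec_borel n)"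
      define f where "f z = signal_energy lam (fst (snd z)) (fst z) / real n
        - r\<^sup>2 * signal_trace lam (fst (snd z)) / real (p n)" for z :: "real vec \<times> real mat \<times> real vec"
      have m1: "(\<lambda>z. fst (snd z)) \<in> measurable ?N (mat_borel n (p n))" by measurable
      have [measurable]: "f \<in> borel_measurable ?N"
        unfolding f_def
        by (intro borel_measurable_diff borel_measurable_divide borel_measurable_times borel_measurable_const
            measurable_signal_energy[OF lam m1 measurable_fst] measurable_signal_trace[OF lam m1])
      define B where "B = {z \<in> space ?N. x \<le> \<bar>f z\<bar>}"
      have B: "B \<in> sets ?N" unfolding B_def by measurable
      have inB: "(\<beta> n \<omega>, (X n \<omega>', \<epsilon> n \<omega>')) \<in> B \<longleftrightarrow> x \<le> \<bar>f (\<beta> n \<omega>, (X n \<omega>', \<epsilon> n \<omega>'))\<bar>"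
        if "\<omega> \<in> space M" "\<omega>' \<in> space M" for \<omega> \<omega>'
        using Xc[OF n] ec[OF n] bc[OF n] that
        by (simp add: B_def space_pair_measure space_mat_borel space_vec_borel)
      have "AE \<omega> in M. prob {\<omega>' \<in> space M. (\<beta> n \<omega>, (X n \<omega>', \<epsilon> n \<omega>')) \<in> B} \<le> c * real (p n) powr (- s)"
        using bb[OF n] AE_space
      proof eventually_elim
        case (elim \<omega>)
        have "{\<omega>' \<in> space M. (\<beta> n \<omega>, (X n \<omega>', \<epsilon> n \<omega>')) \<in> B} = {\<omega>' \<in> space M.
            x \<le> \<bar>signal_energy lam (X n \<omega>') (\<beta> n \<omega>) / n - r\<^sup>2 * signal_trace lam (X n \<omega>') / p n\<bar>}"
          using elim inB by (auto simp: f_def)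
        then show ?case
          using right_rot_signal_tail[OF prob lam s(2,3) n p x X_inv[OF n] bc[OF n elim(2)] elim(1)]
          by (simp add: c_def)
      qed
      then have "prob {\<omega> \<in> space M. (\<beta> n \<omega>, (X n \<omega>, \<epsilon> n \<omega>)) \<in> B} \<le> c * real (p n) powr (- s)"
        by (rule indep_rv_prob_le[OF beta_indep[OF n] B])
      moreover have "{\<omega> \<in> space M. (\<beta> n \<omega>, (X n \<omega>, \<epsilon> n \<omega>)) \<in> B} = {\<omega> \<in> space M. x \<le> \<bar>Z1 n \<omega>\<bar>}"
        using inB by (auto simp: f_def Z1_def)
      ultimately have "prob {\<omega> \<in> space M. x \<le> \<bar>Z1 n \<omega>\<bar>} \<le> c * real (p n) powr (- s)" by simp
      also have "\<dots> \<le> c * (\<gamma> / 2 * real n) powr (- s)"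
        using pn n gamma(1) s(4) c0 by (intro mult_left_mono powr_mono2') auto
      also have "\<dots> = (c * (\<gamma> / 2) powr (- s)) * real n powr (- s)"
        by (subst powr_mult) simp
      finally show ?case .
    qed
    then show "\<exists>C. eventually (\<lambda>n. prob {\<omega> \<in> space M. x \<le> \<bar>Z1 n \<omega>\<bar>} \<le> C * real n powr (- s)) sequentially"
      by blast
  qed
  have Z2: "AE \<omega> in M. (\<lambda>n. Z2 n \<omega>) \<longlonglongrightarrow> 0"
  proof (rule AE_tendsto_0_of_tails[where s = 2, OF Zm(2)])
    fix x :: real assume x: "0 < x"
    define c where "c = 3 * m\<^sup>2 * (lam / 2 * r\<^sup>2)\<^sup>2 / x ^ 4"
    have "eventually (\<lambda>n. prob {\<omega> \<in> space M. x \<le> \<bar>Z2 n \<omega>\<bar>} \<le> c * real n powr (- 2)) sequentially"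
      using eventually_gt_at_top[of 0]
    proof eventually_elim
      case n: (elim n)
      let ?N = "vec_borel (p n) \<Otimes>\<^sub>M (mat_borel n (p n) \<Otimes>\<^sub>M vec_borel n)"
      define f where "f z = (resid_mat lam (fst (snd z)) *\<^sub>v snd (snd z))
        \<bullet> (resid_mat lam (fst (snd z)) *\<^sub>v (fst (snd z) *\<^sub>v fst z))" for z :: "real vec \<times> real mat \<times> real vec"
      have m1: "(\<lambda>z. fst (snd z)) \<in> measurable ?N (mat_borel n (p n))" by measurable
      have m2: "(\<lambda>z. snd (snd z)) \<in> measurable ?N (vec_borel n)" by measurable
      have [measurable]: "f \<in> borel_measurable ?N"
        unfolding f_def
        by (intro measurable_scalar_prod[of _ _ n] measurable_mult_mat_vec[OF measurable_resid_mat[OF lam m1]]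
            m2 measurable_mult_mat_vec[OF m1 measurable_fst])
      define B where "B = {z \<in> space ?N. real n * x \<le> \<bar>f z\<bar>}"
      have B: "B \<in> sets ?N" unfolding B_def by measurable
      have inB: "(\<beta> n \<omega>, (X n \<omega>', \<epsilon> n \<omega>')) \<in> B \<longleftrightarrow> real n * x \<le> \<bar>f (\<beta> n \<omega>, (X n \<omega>', \<epsilon> n \<omega>'))\<bar>"
        if "\<omega> \<in> space M" "\<omega>' \<in> space M" for \<omega> \<omega>'
        using Xc[OF n] ec[OF n] bc[OF n] that
        by (simp add: B_def space_pair_measure space_mat_borel space_vec_borel)
      have "AE \<omega> in M. prob {\<omega>' \<in> space M. (\<beta> n \<omega>, (X n \<omega>', \<epsilon> n \<omega>')) \<in> B} \<le> c * real n powr (- 2)"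
        using bb[OF n] AE_space
      proof eventually_elim
        case (elim \<omega>)
        have "{\<omega>' \<in> space M. (\<beta> n \<omega>, (X n \<omega>', \<epsilon> n \<omega>')) \<in> B} = {\<omega>' \<in> space M. real n * x \<le>
            \<bar>(resid_mat lam (X n \<omega>') *\<^sub>v \<epsilon> n \<omega>') \<bullet> (resid_mat lam (X n \<omega>') *\<^sub>v (X n \<omega>' *\<^sub>v \<beta> n \<omega>))\<bar>}"
          using elim inB by (auto simp: f_def)
        then show ?case
          using cross_term_tail[OF lam n bc[OF n elim(2)] elim(1) eps_indep_X[OF n] eps_indep[OF n] m(1) eps_mean mom4 x]
          by (simp add: c_def)
      qed
      then have "prob {\<omega> \<in> space M. (\<beta> n \<omega>, (X n \<omega>, \<epsilon> n \<omega>)) \<in> B} \<le> c * real n powr (- 2)"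
        by (rule indep_rv_prob_le[OF beta_indep[OF n] B])
      moreover have "{\<omega> \<in> space M. (\<beta> n \<omega>, (X n \<omega>, \<epsilon> n \<omega>)) \<in> B} = {\<omega> \<in> space M. x \<le> \<bar>Z2 n \<omega>\<bar>}"
        using inB n by (auto simp: f_def Z2_def R_def field_simps)
      ultimately show ?case by simp
    qed
    then show "\<exists>C. eventually (\<lambda>n. prob {\<omega> \<in> space M. x \<le> \<bar>Z2 n \<omega>\<bar>} \<le> C * real n powr (- 2)) sequentially"
      by blast
  qed simp_all
  have Z3: "AE \<omega> in M. (\<lambda>n. Z3 n \<omega>) \<longlonglongrightarrow> 0"
  proof (rule AE_tendsto_0_of_tails[OF Zm(3) s(1)])
    fix x :: real assume x: "0 < x"
    define c where "c = exp 24 * (1 + 24 * (2080 * m ^ 3)) / (x\<^sup>2) powr s"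
    have "eventually (\<lambda>n. prob {\<omega> \<in> space M. x \<le> \<bar>Z3 n \<omega>\<bar>} \<le> c * real n powr (- s)) sequentially"
      using eventually_gt_at_top[of 0]
    proof eventually_elim
      case n: (elim n)
      have "{\<omega> \<in> space M. x \<le> \<bar>Z3 n \<omega>\<bar>} = {\<omega> \<in> space M. real n * x \<le>
          \<bar>(resid_mat lam (X n \<omega>) *\<^sub>v \<epsilon> n \<omega>) \<bullet> (resid_mat lam (X n \<omega>) *\<^sub>v \<epsilon> n \<omega>)
            - \<sigma>\<^sup>2 * mat_trace (resid_mat lam (X n \<omega>) * resid_mat lam (X n \<omega>))\<bar>}"
        using n by (auto simp: Z3_def R_def field_simps)
      then show ?case
        using noise_energy_tail[OF lam s(2,3) n eps_indep_X[OF n] eps_indep[OF n] m(1) eps_mean eps_var m(2) mom4 mom4s x]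
        by (simp add: c_def)
    qed
    then show "\<exists>C. eventually (\<lambda>n. prob {\<omega> \<in> space M. x \<le> \<bar>Z3 n \<omega>\<bar>} \<le> C * real n powr (- s)) sequentially"
      by blast
  qed
  define v0 where "v0 = 1 / (C\<^sup>2 + lam)"
  have v0: "0 < v0" using lam by (simp add: v0_def add_nonneg_pos)
  define \<rho> where "\<rho> n = real n / real (p n)" for n
  have np: "\<rho> \<longlonglongrightarrow> 1 / \<gamma>"
  proof -
    have "(\<lambda>n. inverse (real (p n) / real n)) \<longlonglongrightarrow> inverse \<gamma>"
      using gamma by (intro tendsto_inverse) auto
    then show ?thesis by (simp add: \<rho>_def[abs_def] inverse_eq_divide)
  qed
  show ?thesis
    using Z1 Z2 Z3 D_bound AE_space
  proof eventually_elim
    case (elim \<omega>)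
    have w: "\<omega> \<in> space M" by (rule elim(5))
    have Dle: "eventually (\<lambda>n. max_sv (D n \<omega>) \<le> C) sequentially"
      using Limsup_lessD[OF elim(4)] by (rule eventually_mono) simp
    define U where "U n = (\<bar>Z1 n \<omega>\<bar> + 2 * \<bar>Z2 n \<omega>\<bar> + \<bar>Z3 n \<omega>\<bar>) / (lam * v0)\<^sup>2
      + r\<^sup>2 * \<bar>\<rho> n - 1 / \<gamma>\<bar> / v0" for n
    have "U \<longlonglongrightarrow> (\<bar>0\<bar> + 2 * \<bar>0\<bar> + \<bar>0\<bar>) / (lam * v0)\<^sup>2 + r\<^sup>2 * \<bar>1 / \<gamma> - 1 / \<gamma>\<bar> / v0"
      unfolding U_def using elim(1-3) np lam v0 by (intro tendsto_intros) auto
    then have U: "U \<longlonglongrightarrow> 0" by simp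
    show ?case
    proof (rule Lim_null_comparison[OF _ U])
      show "eventually (\<lambda>n. norm (GCV lam (X n \<omega>) (y n \<omega>)
          - (r\<^sup>2 * (v_D (D n \<omega>) (-lam) - lam * deriv (v_D (D n \<omega>)) (-lam))
            + \<sigma>\<^sup>2 * \<gamma> * deriv (v_D (D n \<omega>)) (-lam)) / (\<gamma> * (v_D (D n \<omega>) (-lam))\<^sup>2)) \<le> U n) sequentially"
        using p_large Dle
      proof eventually_elim
        case (elim n)
        then have n: "0 < n" and pn: "\<gamma> / 2 * real n \<le> real (p n)" by auto
        have p: "0 < p n" using pn n gamma(1) by (cases "p n = 0") (auto simp: mult_le_0_iff)
        note sv = svd[OF n w]
        have "v0 \<le> v_D (D n \<omega>) (- lam)"
          unfolding v0_def using sv elim by (intro v_D_lower_bound[OF lam n p]) (auto simp: is_svd_def)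
        from GCV_error_bound[OF lam n p gamma(1) sv bc[OF n w] ec[OF n w] v0 this, of r \<sigma>]
        show ?case by (simp add: y[OF n w] U_def \<rho>_def Z1_def Z2_def Z3_def R_def)
      qed
    qed
  qed
qed

end
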